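(* Let $\Omega\subset\mathbb{R}^d$ ($d\ge 1$) be a bounded, convex, open set, let $p$ satisfy $1<p<\infty$ if $d=1,2$ and $1<p<\frac{d+2}{d-2}$ if $d\ge 3$, and let $\gamma=\frac{p}{p-1}$. Let $u_0\in H^1_0(\Omega)$ be nontrivial and let $\{u_n\}_{n=0}^\infty$ be the sequence generated by $u_{n+1}=\mathcal{A}(u_n)$. Then $$\liminf_{n\to\infty}E_1[u_n]\le E_M[u_0].$$ Moreover, if $\phi$ is a nontrivial solution of $-\phi+\Delta\phi+|\phi|^{p-1}\phi=0$ in $\Omega$, $\phi|_{\partial\Omega}=0$, obtained as the strong $H^1_0(\Omega)$ limit of a subsequence of $\{u_n\}$, then $$E_1[\phi]\le E_M[u_0].$$
   Context: All functions are real valued and $\Omega$ is nonempty. $\langle\cdot,\cdot\rangle$ is the $L^2(\Omega)$ inner product (extended to the duality between $H^{-1}$ and $H^1_0$). $H^1_0(\Omega)$ carries the inner product $\langle f,g\rangle_{H^1}=\int_\Omega fg+\nabla f\cdot\nabla g$ with norm $\|\cdot\|_{H^1}$. $\mathcal{L}=I-\Delta:H^1_0(\Omega)\to H^{-1}(\Omega)$ (Dirichlet boundary conditions), and $\mathcal{L}^{-1}$ is its inverse. For $u\in H^1_0(\Omega)$, $u\ne0$, set $$M[u]=\frac{\langle\mathcal{L}u,u\rangle}{\langle|u|^{p-1}u,u\rangle}=\frac{\|u\|_{H^1}^2}{\|u\|_{L^{p+1}}^{p+1}},\qquad \mathcal{A}(u)=M[u]^\gamma\,\mathcal{L}^{-1}(|u|^{p-1}u).$$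 The iterates are well defined, since $\mathcal{A}(u)\in H^1_0(\Omega)\setminus\{0\}$ whenever $u\in H^1_0(\Omega)\setminus\{0\}$. The energies are $$E_1[\psi]=\tfrac12\|\psi\|_{H^1}^2-\tfrac1{p+1}\|\psi\|_{L^{p+1}}^{p+1},$$ and, for $\psi\neq0$, $E_M[\psi]=\tfrac12\|\psi\|_{H^1}^2-\tfrac1{p+1}M[\psi]\,\|\psi\|_{L^{p+1}}^{p+1}$ if $M[\psi]\le1$, and $E_M[\psi]=+\infty$ if $M[\psi]>1$. Solutions are understood in the weak sense: $\int_\Omega\nabla\phi\cdot\nabla v+\phi v-|\phi|^{p-1}\phi v=0$ for all $v\in H^1_0(\Omega)$. *)

theory Defs
  imports "HOL-Analysis.Analysis"
begin

(* Functions on Omega are represented by total functions on the ambient Euclidean space whose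
   values outside Omega are irrelevant; elements of L^2 and H^1_0 are representatives, and
   equality in these spaces is equality almost everywhere on Omega. *)

section \<open>Test functions\<close>

primrec Ck :: "nat \<Rightarrow> ('a::euclidean_space \<Rightarrow> real) \<Rightarrow> bool" where
  "Ck 0 f \<longleftrightarrow> continuous_on UNIV f"
| "Ck (Suc k) f \<longleftrightarrow> (\<exists>g. (\<forall>x. GDERIV f x :> g x) \<and> (\<forall>b\<in>Basis. Ck k (\<lambda>x. g x \<bullet> b)))"

definition gradient :: "('a::euclidean_space \<Rightarrow> real) \<Rightarrow> 'a \<Rightarrow> 'a" where
  "gradient f x = (THE D. GDERIV f x :> D)"

definition test_functions :: "'a::euclidean_space set \<Rightarrow> ('a \<Rightarrow> real) set" where
  "test_functions \<Omega> = {\<phi>. (\<forall>k. Ck k \<phi>) \<and> compact (closure {x. \<phi> x \<noteq> 0}) \<and>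
     closure {x. \<phi> x \<noteq> 0} \<subseteq> \<Omega>}"

section \<open>Sobolev spaces\<close>

definition L2_space :: "'a::euclidean_space set \<Rightarrow> ('a \<Rightarrow> 'b::euclidean_space) set" where
  "L2_space \<Omega> = {f. f \<in> borel_measurable (lebesgue_on \<Omega>) \<and>
     integrable (lebesgue_on \<Omega>) (\<lambda>x. (norm (f x))\<^sup>2)}"

definition locally_integrable ::
    "'a::euclidean_space set \<Rightarrow> ('a \<Rightarrow> 'b::euclidean_space) \<Rightarrow> bool" where
  "locally_integrable \<Omega> f \<longleftrightarrow> (\<forall>K. compact K \<and> K \<subseteq> \<Omega> \<longrightarrow> set_integrable lebesgue K f)"

(* The integration-by-parts identities for all partial derivatives, written as one
   vector-valued equation. *)
definition has_weak_gradient ::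
    "'a::euclidean_space set \<Rightarrow> ('a \<Rightarrow> real) \<Rightarrow> ('a \<Rightarrow> 'a) \<Rightarrow> bool" where
  "has_weak_gradient \<Omega> u g \<longleftrightarrow> locally_integrable \<Omega> u \<and> locally_integrable \<Omega> g \<and>
     (\<forall>\<phi>\<in>test_functions \<Omega>.
        (\<integral>x. u x *\<^sub>R gradient \<phi> x \<partial>lebesgue_on \<Omega>) = - (\<integral>x. \<phi> x *\<^sub>R g x \<partial>lebesgue_on \<Omega>))"

(* Weak gradients are unique almost everywhere on Omega, so that the choice of the
   representative does not affect any integral below. *)
definition weak_gradient :: "'a::euclidean_space set \<Rightarrow> ('a \<Rightarrow> real) \<Rightarrow> 'a \<Rightarrow> 'a" where
  "weak_gradient \<Omega> u = (SOME g. has_weak_gradient \<Omega> u g)"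

definition H1_space :: "'a::euclidean_space set \<Rightarrow> ('a \<Rightarrow> real) set" where
  "H1_space \<Omega> = {u \<in> L2_space \<Omega>. \<exists>g\<in>L2_space \<Omega>. has_weak_gradient \<Omega> u g}"

definition H1_inner :: "'a::euclidean_space set \<Rightarrow> ('a \<Rightarrow> real) \<Rightarrow> ('a \<Rightarrow> real) \<Rightarrow> real" where
  "H1_inner \<Omega> f g =
     (\<integral>x. f x * g x + weak_gradient \<Omega> f x \<bullet> weak_gradient \<Omega> g x \<partial>lebesgue_on \<Omega>)"

definition H1_norm :: "'a::euclidean_space set \<Rightarrow> ('a \<Rightarrow> real) \<Rightarrow> real" where
  "H1_norm \<Omega> f = sqrt (H1_inner \<Omega> f f)"

definition H10_space :: "'a::euclidean_space set \<Rightarrow> ('a \<Rightarrow> real) set" where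
  "H10_space \<Omega> = {u \<in> H1_space \<Omega>. \<exists>\<phi> :: nat \<Rightarrow> 'a \<Rightarrow> real.
     (\<forall>n. \<phi> n \<in> test_functions \<Omega>) \<and> (\<lambda>n. H1_norm \<Omega> (\<lambda>x. \<phi> n x - u x)) \<longlonglongrightarrow> 0}"

definition nontrivial_on :: "'a::euclidean_space set \<Rightarrow> ('a \<Rightarrow> real) \<Rightarrow> bool" where
  "nontrivial_on \<Omega> u \<longleftrightarrow> \<not> (AE x in lebesgue_on \<Omega>. u x = 0)"

definition Lq_norm :: "'a::euclidean_space set \<Rightarrow> real \<Rightarrow> ('a \<Rightarrow> real) \<Rightarrow> real" where
  "Lq_norm \<Omega> q u = (\<integral>x. \<bar>u x\<bar> powr q \<partial>lebesgue_on \<Omega>) powr (1 / q)"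

section \<open>The operator and the iteration\<close>

(* Elements of H^{-1} are functionals on H^1_0 (made extensional outside H^1_0, so that equal
   functionals are equal HOL functions). The Dirichlet operator I - Laplacian is the usual
   weak one. *)
definition dirichlet_op ::
    "'a::euclidean_space set \<Rightarrow> ('a \<Rightarrow> real) \<Rightarrow> ('a \<Rightarrow> real) \<Rightarrow> real" where
  "dirichlet_op \<Omega> u = (\<lambda>v\<in>H10_space \<Omega>. H1_inner \<Omega> u v)"

definition L2_functional ::
    "'a::euclidean_space set \<Rightarrow> ('a \<Rightarrow> real) \<Rightarrow> ('a \<Rightarrow> real) \<Rightarrow> real" where
  "L2_functional \<Omega> f = (\<lambda>v\<in>H10_space \<Omega>. \<integral>x. f x * v x \<partial>lebesgue_on \<Omega>)"

(* The preimage in H^1_0 is determined almost everywhere on Omega. *)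
definition dirichlet_op_inv ::
    "'a::euclidean_space set \<Rightarrow> (('a \<Rightarrow> real) \<Rightarrow> real) \<Rightarrow> 'a \<Rightarrow> real" where
  "dirichlet_op_inv \<Omega> = inv_into (H10_space \<Omega>) (dirichlet_op \<Omega>)"

definition power_nl :: "real \<Rightarrow> ('a \<Rightarrow> real) \<Rightarrow> 'a \<Rightarrow> real" where
  "power_nl p u x = \<bar>u x\<bar> powr (p - 1) * u x"

definition M_quot :: "'a::euclidean_space set \<Rightarrow> real \<Rightarrow> ('a \<Rightarrow> real) \<Rightarrow> real" where
  "M_quot \<Omega> p u = dirichlet_op \<Omega> u u / L2_functional \<Omega> (power_nl p u) u"

definition A_map ::
    "'a::euclidean_space set \<Rightarrow> real \<Rightarrow> real \<Rightarrow> ('a \<Rightarrow> real) \<Rightarrow> 'a \<Rightarrow> real" where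
  "A_map \<Omega> p \<gamma> u x =
     M_quot \<Omega> p u powr \<gamma> * dirichlet_op_inv \<Omega> (L2_functional \<Omega> (power_nl p u)) x"

section \<open>Energies and weak solutions\<close>

definition E_one :: "'a::euclidean_space set \<Rightarrow> real \<Rightarrow> ('a \<Rightarrow> real) \<Rightarrow> real" where
  "E_one \<Omega> p \<psi> = 1 / 2 * (H1_norm \<Omega> \<psi>)\<^sup>2 - 1 / (p + 1) * Lq_norm \<Omega> (p + 1) \<psi> powr (p + 1)"

definition E_M :: "'a::euclidean_space set \<Rightarrow> real \<Rightarrow> ('a \<Rightarrow> real) \<Rightarrow> ereal" where
  "E_M \<Omega> p \<psi> =
     (if M_quot \<Omega> p \<psi> \<le> 1
      then ereal (1 / 2 * (H1_norm \<Omega> \<psi>)\<^sup>2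
             - 1 / (p + 1) * M_quot \<Omega> p \<psi> * Lq_norm \<Omega> (p + 1) \<psi> powr (p + 1))
      else \<infinity>)"

definition weak_solution :: "'a::euclidean_space set \<Rightarrow> real \<Rightarrow> ('a \<Rightarrow> real) \<Rightarrow> bool" where
  "weak_solution \<Omega> p \<phi> \<longleftrightarrow> \<phi> \<in> H10_space \<Omega> \<and>
     (\<forall>v\<in>H10_space \<Omega>.
        (\<integral>x. weak_gradient \<Omega> \<phi> x \<bullet> weak_gradient \<Omega> v x + \<phi> x * v x - power_nl p \<phi> x * v x
           \<partial>lebesgue_on \<Omega>) = 0)"

end

theory Submission
  imports Defs
begin

text \<open>
  Put \<open>q = p + 1\<close>, let \<open>N(u)\<close> be the squared \<open>H\<^sup>1\<close> norm of \<open>u\<close> and \<open>P(u)\<close> the integral of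
  \<open>|u|^q\<close>, so that \<open>M[u] = N(u) / P(u)\<close>. The theorem rests on the scale invariant quantity
  \<open>R(u) = N(u)^q / P(u)^2\<close>. Its power \<open>R(u)^(1/(p-1))\<close> is the squared norm of that multiple of \<open>u\<close>
  which lies on the Nehari manifold \<open>N = P\<close>, and \<open>E\<^sub>1\<close> is largest there among all multiples of
  \<open>u\<close>. Therefore \<open>E\<^sub>1[u] \<le> (1/2 - 1/q) R(u)^(1/(p-1))\<close> for every nontrivial \<open>u\<close> (\<open>E_one_le_rayleigh\<close>). If
  \<open>M[u\<^sub>0] \<le> 1\<close>, then \<open>E\<^sub>M[u\<^sub>0] = (1/2 - 1/q) N(u\<^sub>0)\<close> and \<open>R(u\<^sub>0)^(1/(p-1)) \<le> N(u\<^sub>0)\<close>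
  (\<open>rayleigh_le_H1_sq\<close>). So the bound \<open>E\<^sub>1[u\<^sub>n] \<le> E\<^sub>M[u\<^sub>0]\<close> holds for every single iterate as soon
  as \<open>R\<close> does not increase along the iteration; if \<open>M[u\<^sub>0] > 1\<close> the right-hand side is infinite.

  For the monotonicity (\<open>rayleigh_decreasing\<close>), let \<open>w\<close> be the preimage of \<open>|u|^(p-1) u\<close> under
  \<open>I - \<Delta>\<close>. Testing its equation with \<open>u\<close> and using Cauchy-Schwarz gives \<open>P(u)^2 \<le> N(w) N(u)\<close>;
  testing with \<open>w\<close> and using Hoelder gives \<open>N(w) \<le> P(u)^(p/q) P(w)^(1/q)\<close>. The two together say
  \<open>R(w) \<le> R(u)\<close>, and the next iterate is a positive multiple of \<open>w\<close>.

  For a limit \<open>\<phi>\<close> in \<open>H\<^sup>1\<close> of a subsequence, the bound on \<open>E\<^sub>1[\<phi>]\<close> follows since \<open>N\<close> is continuous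
  and \<open>P\<close> is upper semicontinuous, the latter by the Sobolev inequality \<open>P(v) \<le> C N(v)^(q/2)\<close>
  (\<open>E_one_le_of_H1_limit\<close>).

  The analysis behind these few lines has three ingredients. The Sobolev inequality in the
  subcritical range is obtained by averaging the fundamental theorem of calculus over rays that
  leave \<open>\<Omega>\<close> (\<open>Sobolev_test_functions\<close>). Weak gradients are unique because indicator functions of
  boxes are limits of test functions (\<open>fundamental_lemma_calculus_of_variations\<close>). And \<open>I - \<Delta>\<close> has
  the required preimages by the Riesz representation theorem (\<open>Riesz_closed_subspace\<close>), applied to
  the closure of the graphs of \<open>\<phi> \<mapsto> (\<phi>, \<nabla>\<phi>)\<close> in the space of square integrable functions.
\<close>

section \<open>Integral inequalities\<close>

lemma powr_weighted_am_gm: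
  fixes a b x y :: real
  assumes "0 < a" "0 < b" "a + b = 1" "0 \<le> x" "0 \<le> y"
  shows "x powr a * y powr b \<le> a * x + b * y"
proof (cases "x = 0 \<or> y = 0")
  case True
  then show ?thesis using assms by auto
next
  case False
  then show ?thesis using Youngs_inequality_0[of a b x y] assms by auto
qed

text \<open>Hoelder's inequality in the form of a weighted geometric mean: after dividing \<open>f\<close> and \<open>g\<close> by
  their integrals it is the integrated weighted inequality of arithmetic and geometric means. Both
  uses with conjugate exponents and interpolation between two weighted integrals have this shape.\<close>

lemma Hoelder_integral:
  fixes f g :: "'x \<Rightarrow> real"
  assumes ab: "0 < a" "0 < b" "a + b = 1"
    and f: "integrable M f" "\<And>x. 0 \<le> f x" and g: "integrable M g" "\<And>x. 0 \<le> g x"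
  shows "integrable M (\<lambda>x. f x powr a * g x powr b)"
    and "(\<integral>x. f x powr a * g x powr b \<partial>M) \<le> (\<integral>x. f x \<partial>M) powr a * (\<integral>x. g x \<partial>M) powr b"
proof -
  have [measurable]: "f \<in> borel_measurable M" "g \<in> borel_measurable M"
    using f g by auto
  show int: "integrable M (\<lambda>x. f x powr a * g x powr b)"
  proof (rule Bochner_Integration.integrable_bound)
    show "integrable M (\<lambda>x. a * f x + b * g x)"
      using f g by auto
    show "AE x in M. norm (f x powr a * g x powr b) \<le> norm (a * f x + b * g x)"
    proof (rule AE_I2)
      fix x
      show "norm (f x powr a * g x powr b) \<le> norm (a * f x + b * g x)"
        using powr_weighted_am_gm[OF ab f(2)[of x] g(2)[of x]] ab f(2)[of x] g(2)[of x] by auto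
    qed
  qed measurable
  define F where "F = (\<integral>x. f x \<partial>M)"
  define G where "G = (\<integral>x. g x \<partial>M)"
  have "0 \<le> F" "0 \<le> G" unfolding F_def G_def using f g by auto
  show "(\<integral>x. f x powr a * g x powr b \<partial>M) \<le> (\<integral>x. f x \<partial>M) powr a * (\<integral>x. g x \<partial>M) powr b"
  proof (cases "F = 0 \<or> G = 0")
    case True
    then have "AE x in M. f x = 0 \<or> g x = 0"
    proof
      assume "F = 0"
      then have "AE x in M. f x = 0"
        using integral_nonneg_eq_0_iff_AE[OF f(1)] f(2) unfolding F_def by auto
      then show ?thesis by auto
    next
      assume "G = 0"
      then have "AE x in M. g x = 0"
        using integral_nonneg_eq_0_iff_AE[OF g(1)] g(2) unfolding G_def by auto
      then show ?thesis by auto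
    qed
    then have "AE x in M. f x powr a * g x powr b = 0"
      by eventually_elim auto
    then have "(\<integral>x. f x powr a * g x powr b \<partial>M) = 0"
      by (rule integral_eq_zero_AE)
    then show ?thesis by auto
  next
    case False
    then have FG: "0 < F" "0 < G" using \<open>0 \<le> F\<close> \<open>0 \<le> G\<close> by auto
    have "(\<integral>x. f x powr a * g x powr b \<partial>M)
        \<le> (\<integral>x. F powr a * G powr b * (a / F * f x + b / G * g x) \<partial>M)"
    proof (rule integral_mono[OF int])
      show "integrable M (\<lambda>x. F powr a * G powr b * (a / F * f x + b / G * g x))"
        using f g by auto
      fix x
      have "(f x / F) powr a * (g x / G) powr b \<le> a * (f x / F) + b * (g x / G)"
        using powr_weighted_am_gm[OF ab, of "f x / F" "g x / G"] f(2)[of x] g(2)[of x] FG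
        by (simp add: divide_nonneg_pos)
      moreover have "f x powr a * g x powr b
          = F powr a * G powr b * ((f x / F) powr a * (g x / G) powr b)"
        using FG f(2)[of x] g(2)[of x] by (simp add: powr_divide field_simps)
      ultimately show "f x powr a * g x powr b
          \<le> F powr a * G powr b * (a / F * f x + b / G * g x)"
        by (simp add: mult_left_mono)
    qed
    also have "\<dots> = F powr a * G powr b * (a / F * F + b / G * G)"
      using f g by (simp add: F_def G_def)
    also have "\<dots> = F powr a * G powr b" using FG ab by simp
    finally show ?thesis unfolding F_def G_def .
  qed
qed

text \<open>The integrals are bounded by a convergent sequence, so that norms on the right-hand side of an
  inequality can pass to their limits at the same time.\<close>

lemma integrable_Fatou:
  fixes f :: "nat \<Rightarrow> 'x \<Rightarrow> real"
  assumes f: "\<And>n. integrable M (f n)" "\<And>n x. 0 \<le> f n x"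
    and g: "g \<in> borel_measurable M" "\<And>x. 0 \<le> g x"
    and lim: "AE x in M. (\<lambda>n. f n x) \<longlonglongrightarrow> g x"
    and c: "\<And>n. (\<integral>x. f n x \<partial>M) \<le> c n" "c \<longlonglongrightarrow> C"
  shows "integrable M g" and "(\<integral>x. g x \<partial>M) \<le> C"
proof -
  have [measurable]: "f n \<in> borel_measurable M" for n using f by auto
  have c0: "0 \<le> c n" for n
    using c(1)[of n] Bochner_Integration.integral_nonneg[of M "f n"] f(2) by (meson order_trans)
  then have C0: "0 \<le> C" using c(2) by (simp add: LIMSEQ_le_const)
  have "(\<integral>\<^sup>+x. ennreal (g x) \<partial>M) = (\<integral>\<^sup>+x. liminf (\<lambda>n. ennreal (f n x)) \<partial>M)"
  proof (rule nn_integral_cong_AE)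
    show "AE x in M. ennreal (g x) = liminf (\<lambda>n. ennreal (f n x))"
      using lim
    proof eventually_elim
      case (elim x)
      then have "(\<lambda>n. ennreal (f n x)) \<longlonglongrightarrow> ennreal (g x)" by (rule tendsto_ennrealI)
      from lim_imp_Liminf[OF _ this] show ?case by simp
    qed
  qed
  also have "\<dots> \<le> liminf (\<lambda>n. \<integral>\<^sup>+x. ennreal (f n x) \<partial>M)"
    by (rule nn_integral_liminf) simp
  also have "\<dots> \<le> liminf (\<lambda>n. ennreal (c n))"
  proof (rule Liminf_mono, rule eventuallyI)
    fix n
    show "(\<integral>\<^sup>+x. ennreal (f n x) \<partial>M) \<le> ennreal (c n)"
      using c(1)[of n] f by (simp add: nn_integral_eq_integral ennreal_leI)
  qed
  also have "\<dots> = ennreal C"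
    using lim_imp_Liminf[OF _ tendsto_ennrealI[OF c(2)]] by simp
  finally have le: "(\<integral>\<^sup>+x. ennreal (g x) \<partial>M) \<le> ennreal C" .
  show int: "integrable M g"
    by (rule integrableI_nonneg) (use g le in \<open>auto intro: le_less_trans\<close>)
  show "(\<integral>x. g x \<partial>M) \<le> C"
    using le g C0 int by (simp add: nn_integral_eq_integral)
qed

section \<open>The Hilbert space of square integrable functions\<close>

abbreviation sq_norm :: "'a::euclidean_space set \<Rightarrow> ('a \<Rightarrow> 'b::euclidean_space) \<Rightarrow> real" where
  "sq_norm \<Omega> f \<equiv> \<integral>x. (norm (f x))\<^sup>2 \<partial>lebesgue_on \<Omega>"

lemma L2_spaceD:
  assumes "f \<in> L2_space \<Omega>"
  shows "f \<in> borel_measurable (lebesgue_on \<Omega>)" "integrable (lebesgue_on \<Omega>) (\<lambda>x. (norm (f x))\<^sup>2)"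
  using assms by (auto simp: L2_space_def)

lemma L2_space_inner_integrable:
  assumes "f \<in> L2_space \<Omega>" "g \<in> L2_space \<Omega>"
  shows "integrable (lebesgue_on \<Omega>) (\<lambda>x. f x \<bullet> g x)"
proof (rule Bochner_Integration.integrable_bound)
  note [measurable] = assms[THEN L2_spaceD(1)]
  show "integrable (lebesgue_on \<Omega>) (\<lambda>x. (norm (f x))\<^sup>2 + (norm (g x))\<^sup>2)"
    using assms[THEN L2_spaceD(2)] by auto
  show "(\<lambda>x. f x \<bullet> g x) \<in> borel_measurable (lebesgue_on \<Omega>)" by measurable
  show "AE x in lebesgue_on \<Omega>. norm (f x \<bullet> g x) \<le> norm ((norm (f x))\<^sup>2 + (norm (g x))\<^sup>2)"
  proof (rule AE_I2)
    fix x
    have "\<bar>f x \<bullet> g x\<bar> \<le> norm (f x) * norm (g x)" by (rule Cauchy_Schwarz_ineq2)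
    also have "\<dots> \<le> (norm (f x))\<^sup>2 + (norm (g x))\<^sup>2"
      using sum_squares_bound[of "norm (f x)" "norm (g x)"] by (auto intro: order_trans[rotated])
    finally show "norm (f x \<bullet> g x) \<le> norm ((norm (f x))\<^sup>2 + (norm (g x))\<^sup>2)" by simp
  qed
qed

lemma norm_sq_add_scale:
  fixes a b :: "'b::real_inner"
  shows "(norm (a + c *\<^sub>R b))\<^sup>2 = (norm a)\<^sup>2 + 2 * c * (a \<bullet> b) + c\<^sup>2 * (norm b)\<^sup>2"
  unfolding power2_norm_eq_inner
  by (simp add: inner_add_left inner_add_right inner_commute power2_eq_square algebra_simps)

lemma L2_space_lincomb:
  assumes "f \<in> L2_space \<Omega>" "g \<in> L2_space \<Omega>"
  shows "(\<lambda>x. f x + c *\<^sub>R g x) \<in> L2_space \<Omega>"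
    and "sq_norm \<Omega> (\<lambda>x. f x + c *\<^sub>R g x)
      = sq_norm \<Omega> f + 2 * c * (\<integral>x. f x \<bullet> g x \<partial>lebesgue_on \<Omega>) + c\<^sup>2 * sq_norm \<Omega> g"
proof -
  note [measurable] = assms[THEN L2_spaceD(1)]
  note [simp] = assms[THEN L2_spaceD(2)] L2_space_inner_integrable[OF assms]
  show "(\<lambda>x. f x + c *\<^sub>R g x) \<in> L2_space \<Omega>"
    unfolding L2_space_def by (auto simp: norm_sq_add_scale)
  show "sq_norm \<Omega> (\<lambda>x. f x + c *\<^sub>R g x)
      = sq_norm \<Omega> f + 2 * c * (\<integral>x. f x \<bullet> g x \<partial>lebesgue_on \<Omega>) + c\<^sup>2 * sq_norm \<Omega> g"
    by (simp add: norm_sq_add_scale)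
qed

lemma L2_space_diff:
  assumes "f \<in> L2_space \<Omega>" "g \<in> L2_space \<Omega>"
  shows "(\<lambda>x. f x - g x) \<in> L2_space \<Omega>"
  using L2_space_lincomb(1)[OF assms, of "-1"] by simp

lemma L2_Cauchy_Schwarz:
  assumes "f \<in> L2_space \<Omega>" "g \<in> L2_space \<Omega>"
  shows "\<bar>\<integral>x. f x \<bullet> g x \<partial>lebesgue_on \<Omega>\<bar> \<le> sqrt (sq_norm \<Omega> f) * sqrt (sq_norm \<Omega> g)"
proof -
  note H = Hoelder_integral[of "1/2" "1/2", OF _ _ _ assms(1)[THEN L2_spaceD(2)] _ assms(2)[THEN L2_spaceD(2)]]
  have "\<bar>\<integral>x. f x \<bullet> g x \<partial>lebesgue_on \<Omega>\<bar> \<le> (\<integral>x. \<bar>f x \<bullet> g x\<bar> \<partial>lebesgue_on \<Omega>)"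
    by (rule integral_abs_bound)
  also have "\<dots> \<le> (\<integral>x. ((norm (f x))\<^sup>2) powr (1/2) * ((norm (g x))\<^sup>2) powr (1/2) \<partial>lebesgue_on \<Omega>)"
    by (rule integral_mono)
      (use L2_space_inner_integrable[OF assms] H(1) in
        \<open>auto simp: powr_half_sqrt Cauchy_Schwarz_ineq2\<close>)
  also have "\<dots> \<le> sq_norm \<Omega> f powr (1/2) * sq_norm \<Omega> g powr (1/2)"
    by (rule H(2)) auto
  finally show ?thesis by (simp add: powr_half_sqrt)
qed

lemma L2_tendsto_inner:
  assumes f: "\<And>n::nat. f n \<in> L2_space \<Omega>" "f' \<in> L2_space \<Omega>"
    and lim: "(\<lambda>n. sq_norm \<Omega> (\<lambda>x. f n x - f' x)) \<longlonglongrightarrow> 0" and h: "h \<in> L2_space \<Omega>"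
  shows "(\<lambda>n. \<integral>x. f n x \<bullet> h x \<partial>lebesgue_on \<Omega>) \<longlonglongrightarrow> (\<integral>x. f' x \<bullet> h x \<partial>lebesgue_on \<Omega>)"
proof (rule Lim_transform2)
  show "(\<lambda>n. \<integral>x. f' x \<bullet> h x \<partial>lebesgue_on \<Omega>) \<longlonglongrightarrow> (\<integral>x. f' x \<bullet> h x \<partial>lebesgue_on \<Omega>)" by simp
  have "(\<lambda>n. sqrt (sq_norm \<Omega> (\<lambda>x. f n x - f' x)) * sqrt (sq_norm \<Omega> h)) \<longlonglongrightarrow> 0"
    using tendsto_mult[OF tendsto_real_sqrt[OF lim] tendsto_const[of "sqrt (sq_norm \<Omega> h)"]] by simp
  then show "(\<lambda>n. (\<integral>x. f' x \<bullet> h x \<partial>lebesgue_on \<Omega>) - (\<integral>x. f n x \<bullet> h x \<partial>lebesgue_on \<Omega>)) \<longlonglongrightarrow> 0"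
  proof (rule Lim_null_comparison[rotated], intro always_eventually allI)
    fix n
    have "(\<integral>x. f n x \<bullet> h x \<partial>lebesgue_on \<Omega>) - (\<integral>x. f' x \<bullet> h x \<partial>lebesgue_on \<Omega>)
        = (\<integral>x. (f n x - f' x) \<bullet> h x \<partial>lebesgue_on \<Omega>)"
      using L2_space_inner_integrable[OF f(1)[of n] h] L2_space_inner_integrable[OF f(2) h]
      by (simp add: inner_diff_left)
    then show "norm ((\<integral>x. f' x \<bullet> h x \<partial>lebesgue_on \<Omega>) - (\<integral>x. f n x \<bullet> h x \<partial>lebesgue_on \<Omega>))
        \<le> sqrt (sq_norm \<Omega> (\<lambda>x. f n x - f' x)) * sqrt (sq_norm \<Omega> h)"
      using L2_Cauchy_Schwarz[OF L2_space_diff[OF f(1)[of n] f(2)] h]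
      unfolding real_norm_def by linarith
  qed
qed

lemma L2_triangle:
  assumes "f \<in> L2_space \<Omega>" "g \<in> L2_space \<Omega>"
  shows "\<bar>sqrt (sq_norm \<Omega> f) - sqrt (sq_norm \<Omega> g)\<bar> \<le> sqrt (sq_norm \<Omega> (\<lambda>x. f x - g x))"
proof (rule power2_le_imp_le)
  have "(\<integral>x. f x \<bullet> g x \<partial>lebesgue_on \<Omega>) \<le> sqrt (sq_norm \<Omega> f) * sqrt (sq_norm \<Omega> g)"
    using L2_Cauchy_Schwarz[OF assms] by simp
  moreover have "sq_norm \<Omega> (\<lambda>x. f x - g x)
      = sq_norm \<Omega> f - 2 * (\<integral>x. f x \<bullet> g x \<partial>lebesgue_on \<Omega>) + sq_norm \<Omega> g"
    using L2_space_lincomb(2)[OF assms, of "-1"] by simp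
  moreover have "0 \<le> sq_norm \<Omega> (\<lambda>x. f x - g x)" "0 \<le> sq_norm \<Omega> f" "0 \<le> sq_norm \<Omega> g"
    by simp_all
  ultimately show "\<bar>sqrt (sq_norm \<Omega> f) - sqrt (sq_norm \<Omega> g)\<bar>\<^sup>2
      \<le> (sqrt (sq_norm \<Omega> (\<lambda>x. f x - g x)))\<^sup>2"
    by (simp only: power2_abs power2_diff real_sqrt_pow2)
qed simp

lemma L2_tendsto_sq_norm:
  assumes f: "\<And>n::nat. f n \<in> L2_space \<Omega>" "f' \<in> L2_space \<Omega>"
    and lim: "(\<lambda>n. sq_norm \<Omega> (\<lambda>x. f n x - f' x)) \<longlonglongrightarrow> 0"
  shows "(\<lambda>n. sq_norm \<Omega> (f n)) \<longlonglongrightarrow> sq_norm \<Omega> f'"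
proof -
  have "(\<lambda>n. sqrt (sq_norm \<Omega> (\<lambda>x. f n x - f' x))) \<longlonglongrightarrow> 0"
    using tendsto_real_sqrt[OF lim] by simp
  then have "(\<lambda>n. sqrt (sq_norm \<Omega> (f n)) - sqrt (sq_norm \<Omega> f')) \<longlonglongrightarrow> 0"
    by (rule Lim_null_comparison[rotated], intro always_eventually allI)
      (use L2_triangle[OF f(1) f(2)] in auto)
  then have "(\<lambda>n. sqrt (sq_norm \<Omega> (f n))) \<longlonglongrightarrow> sqrt (sq_norm \<Omega> f')"
    by (simp add: LIM_zero_iff)
  from tendsto_power[OF this, of 2] show ?thesis by simp
qed

lemma sq_norm_diff_triangle:
  assumes "f \<in> L2_space \<Omega>" "g \<in> L2_space \<Omega>" "h \<in> L2_space \<Omega>"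
  shows "sq_norm \<Omega> (\<lambda>x. f x - h x)
    \<le> 2 * sq_norm \<Omega> (\<lambda>x. f x - g x) + 2 * sq_norm \<Omega> (\<lambda>x. g x - h x)"
proof -
  note a = L2_space_diff[OF assms(1,2)] and b = L2_space_diff[OF assms(2,3)]
  have "sq_norm \<Omega> (\<lambda>x. (f x - g x) + 1 *\<^sub>R (g x - h x)) + sq_norm \<Omega> (\<lambda>x. (f x - g x) + (-1) *\<^sub>R (g x - h x))
    = 2 * sq_norm \<Omega> (\<lambda>x. f x - g x) + 2 * sq_norm \<Omega> (\<lambda>x. g x - h x)"
    unfolding L2_space_lincomb(2)[OF a b] by simp
  moreover have "0 \<le> sq_norm \<Omega> (\<lambda>x. (f x - g x) + (-1) *\<^sub>R (g x - h x))"
    by (rule Bochner_Integration.integral_nonneg) simp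
  moreover have "sq_norm \<Omega> (\<lambda>x. (f x - g x) + 1 *\<^sub>R (g x - h x)) = sq_norm \<Omega> (\<lambda>x. f x - h x)" by simp
  ultimately show ?thesis by linarith
qed

lemma L2_finite_L1:
  assumes fin: "finite_measure (lebesgue_on \<Omega>)" and f: "f \<in> L2_space \<Omega>"
  shows "integrable (lebesgue_on \<Omega>) f"
    and "(\<integral>x. norm (f x) \<partial>lebesgue_on \<Omega>) \<le> sqrt (sq_norm \<Omega> f) * sqrt (measure (lebesgue_on \<Omega>) \<Omega>)"
proof -
  interpret finite_measure "lebesgue_on \<Omega>" by fact
  note [measurable] = L2_spaceD(1)[OF f]
  have n: "(\<lambda>x. norm (f x)) \<in> L2_space \<Omega>" and o: "(\<lambda>x. 1::real) \<in> L2_space \<Omega>"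
    using f by (auto simp: L2_space_def)
  have "integrable (lebesgue_on \<Omega>) (\<lambda>x. norm (f x))"
    using L2_space_inner_integrable[OF n o] by simp
  then show "integrable (lebesgue_on \<Omega>) f" by (simp add: integrable_norm_iff)
  show "(\<integral>x. norm (f x) \<partial>lebesgue_on \<Omega>) \<le> sqrt (sq_norm \<Omega> f) * sqrt (measure (lebesgue_on \<Omega>) \<Omega>)"
    using L2_Cauchy_Schwarz[OF n o] by simp
qed

text \<open>On a set of finite measure, convergence in \<open>L\<^sup>2\<close> implies convergence in \<open>L\<^sup>1\<close>.\<close>

lemma L2_AE_subseq:
  assumes fin: "finite_measure (lebesgue_on \<Omega>)"
    and f: "\<And>n::nat. f n \<in> L2_space \<Omega>" "f' \<in> L2_space \<Omega>"
    and lim: "(\<lambda>n. sq_norm \<Omega> (\<lambda>x. f n x - f' x)) \<longlonglongrightarrow> 0"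
  obtains r :: "nat \<Rightarrow> nat" where "strict_mono r" "AE x in lebesgue_on \<Omega>. (\<lambda>n. f (r n) x) \<longlonglongrightarrow> f' x"
proof -
  have d: "(\<lambda>x. f n x - f' x) \<in> L2_space \<Omega>" for n by (intro L2_space_diff f)
  have "(\<lambda>n. sqrt (sq_norm \<Omega> (\<lambda>x. f n x - f' x)) * sqrt (measure (lebesgue_on \<Omega>) \<Omega>)) \<longlonglongrightarrow> 0"
    using tendsto_mult[OF tendsto_real_sqrt[OF lim] tendsto_const] by simp
  then have "(\<lambda>n. \<integral>x. norm (f n x - f' x) \<partial>lebesgue_on \<Omega>) \<longlonglongrightarrow> 0"
    by (rule Lim_null_comparison[rotated], intro always_eventually allI)
      (use L2_finite_L1(2)[OF fin d] in simp)
  from tendsto_L1_AE_subseq[OF L2_finite_L1(1)[OF fin d] this]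
  obtain r :: "nat \<Rightarrow> nat" where "strict_mono r" "AE x in lebesgue_on \<Omega>. (\<lambda>n. f (r n) x - f' x) \<longlonglongrightarrow> 0"
    by auto
  then show ?thesis using that by (simp add: LIM_zero_iff)
qed

text \<open>The Riesz-Fischer theorem. A Cauchy sequence is Cauchy in \<open>L\<^sup>1\<close> because the measure is finite, so a
  subsequence converges almost everywhere, and Fatou's lemma turns the Cauchy condition into
  convergence in \<open>L\<^sup>2\<close>.\<close>

lemma L2_complete:
  assumes fin: "finite_measure (lebesgue_on \<Omega>)"
    and f: "\<And>n::nat. f n \<in> L2_space \<Omega>"
    and Cauchy: "\<And>e. 0 < e \<Longrightarrow> \<exists>N. \<forall>m\<ge>N. \<forall>n\<ge>N. sq_norm \<Omega> (\<lambda>x. f m x - f n x) < e"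
  obtains f' where "f' \<in> L2_space \<Omega>" "(\<lambda>n. sq_norm \<Omega> (\<lambda>x. f n x - f' x)) \<longlonglongrightarrow> 0"
proof -
  have d: "(\<lambda>x. f m x - f n x) \<in> L2_space \<Omega>" for m n by (intro L2_space_diff f)
  have [measurable]: "f n \<in> borel_measurable (lebesgue_on \<Omega>)" for n using L2_spaceD(1)[OF f] .
  obtain r :: "nat \<Rightarrow> nat" where r: "strict_mono r" "AE x in lebesgue_on \<Omega>. Cauchy (\<lambda>i. f (r i) x)"
  proof (rule cauchy_L1_AE_cauchy_subseq)
    show "integrable (lebesgue_on \<Omega>) (f n)" for n using L2_finite_L1(1)[OF fin f] .
    fix e :: real assume e: "0 < e"
    define \<mu> where "\<mu> = measure (lebesgue_on \<Omega>) \<Omega> + 1"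
    have \<mu>: "0 < \<mu>" unfolding \<mu>_def by (simp add: add_nonneg_pos)
    obtain N where N: "\<forall>m\<ge>N. \<forall>n\<ge>N. sq_norm \<Omega> (\<lambda>x. f m x - f n x) < e\<^sup>2 / \<mu>"
      using Cauchy[of "e\<^sup>2 / \<mu>"] e \<mu> by auto
    have "(\<integral>x. norm (f m x - f n x) \<partial>lebesgue_on \<Omega>) < e" if "m \<ge> N" "n \<ge> N" for m n
    proof -
      have "(\<integral>x. norm (f m x - f n x) \<partial>lebesgue_on \<Omega>)
          \<le> sqrt (sq_norm \<Omega> (\<lambda>x. f m x - f n x)) * sqrt (measure (lebesgue_on \<Omega>) \<Omega>)"
        by (rule L2_finite_L1(2)[OF fin d])
      also have "\<dots> \<le> sqrt (sq_norm \<Omega> (\<lambda>x. f m x - f n x)) * sqrt \<mu>"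
        by (intro mult_left_mono) (auto simp: \<mu>_def)
      also have "\<dots> < sqrt (e\<^sup>2 / \<mu>) * sqrt \<mu>"
        using N that \<mu> by (intro mult_strict_right_mono) auto
      also have "\<dots> = e" using e \<mu> by (simp add: real_sqrt_divide)
      finally show ?thesis .
    qed
    then show "\<exists>N. \<forall>i\<ge>N. \<forall>j\<ge>N. (\<integral>x. norm (f i x - f j x) \<partial>lebesgue_on \<Omega>) < e" by blast
  qed auto
  define f' where "f' x = lim (\<lambda>i. f (r i) x)" for x
  have meas[measurable]: "f' \<in> borel_measurable (lebesgue_on \<Omega>)"
    unfolding f'_def[abs_def] by measurable
  have lim: "AE x in lebesgue_on \<Omega>. (\<lambda>i. f (r i) x) \<longlonglongrightarrow> f' x"
    using r(2) by eventually_elim (simp add: f'_def Cauchy_convergent_iff convergent_LIMSEQ_iff)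
  have key: "integrable (lebesgue_on \<Omega>) (\<lambda>x. (norm (f n x - f' x))\<^sup>2) \<and> sq_norm \<Omega> (\<lambda>x. f n x - f' x) \<le> e"
    if n: "n \<ge> N" and N: "\<forall>m\<ge>N. \<forall>n\<ge>N. sq_norm \<Omega> (\<lambda>x. f m x - f n x) < e" for n N e
  proof -
    have rN: "r (i + N) \<ge> N" for i using seq_suble[OF r(1), of "i + N"] by simp
    have L: "AE x in lebesgue_on \<Omega>. (\<lambda>i. (norm (f n x - f (r (i + N)) x))\<^sup>2) \<longlonglongrightarrow> (norm (f n x - f' x))\<^sup>2"
      using lim
    proof eventually_elim
      case (elim x)
      show ?case by (intro tendsto_intros LIMSEQ_ignore_initial_segment elim)
    qed
    have "(\<integral>x. (norm (f n x - f (r (i + N)) x))\<^sup>2 \<partial>lebesgue_on \<Omega>) \<le> e" for i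
      using N n rN[of i] by (simp add: less_imp_le)
    from integrable_Fatou[OF L2_spaceD(2)[OF d] _ _ _ L this tendsto_const]
    show ?thesis by simp
  qed
  obtain N1 where "\<forall>m\<ge>N1. \<forall>n\<ge>N1. sq_norm \<Omega> (\<lambda>x. f m x - f n x) < 1" using Cauchy[of 1] by auto
  from key[OF order_refl this] have "(\<lambda>x. f N1 x - f' x) \<in> L2_space \<Omega>"
    by (auto simp: L2_space_def)
  from L2_space_diff[OF f[of N1] this] have f': "f' \<in> L2_space \<Omega>" by simp
  have "(\<lambda>n. sq_norm \<Omega> (\<lambda>x. f n x - f' x)) \<longlonglongrightarrow> 0"
  proof (rule LIMSEQ_I)
    fix e :: real assume "0 < e"
    then obtain N where "\<forall>m\<ge>N. \<forall>n\<ge>N. sq_norm \<Omega> (\<lambda>x. f m x - f n x) < e / 2" using Cauchy[of "e/2"] by auto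
    from key[OF _ this] \<open>0 < e\<close> show "\<exists>N. \<forall>n\<ge>N. norm (sq_norm \<Omega> (\<lambda>x. f n x - f' x) - 0) < e"
      by (intro exI[of _ N]) fastforce
  qed
  with f' show ?thesis using that by blast
qed

text \<open>The first variation of a quadratic functional at a minimum vanishes.\<close>

lemma quadratic_nonneg_imp_linear_zero:
  fixes a b :: real
  assumes "\<And>t. 0 \<le> t\<^sup>2 * a + 2 * t * b"
  shows "b = 0"
proof (rule ccontr)
  assume b: "b \<noteq> 0"
  define A where "A = \<bar>a\<bar> + 1"
  have A: "0 < A" "a < A" unfolding A_def by auto
  have "0 \<le> (b / A)\<^sup>2 * a - 2 * (b / A) * b" using assms[of "- (b / A)"] by simp
  also have "\<dots> \<le> (b / A)\<^sup>2 * A - 2 * (b / A) * b" using A by (intro diff_right_mono mult_left_mono) auto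
  also have "\<dots> = - (b\<^sup>2 / A)" using A by (simp add: power2_eq_square field_simps)
  also have "\<dots> < 0" using b A by simp
  finally show False by simp
qed

text \<open>The representing element is the minimiser of \<open>\<parallel>f\<parallel>\<^sup>2 - 2 l(f)\<close> on the subspace. By the parallelogram
  identity a minimising sequence is Cauchy. The subspace consists of functions instead of classes
  modulo equality almost everywhere, which is why it is a set closed under linear combinations and
  limits rather than an instance of a Hilbert space type.\<close>

lemma Riesz_closed_subspace:
  fixes S :: "('a::euclidean_space \<Rightarrow> 'b::euclidean_space) set"
  assumes fin: "finite_measure (lebesgue_on \<Omega>)"
    and S: "S \<subseteq> L2_space \<Omega>" "S \<noteq> {}"
    and lin: "\<And>f g c. f \<in> S \<Longrightarrow> g \<in> S \<Longrightarrow> (\<lambda>x. f x + c *\<^sub>R g x) \<in> S"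
    and closed: "\<And>f f'. (\<And>n::nat. f n \<in> S) \<Longrightarrow> f' \<in> L2_space \<Omega> \<Longrightarrow>
        (\<lambda>n. sq_norm \<Omega> (\<lambda>x. f n x - f' x)) \<longlonglongrightarrow> 0 \<Longrightarrow> f' \<in> S"
    and l_lin: "\<And>f g c. f \<in> S \<Longrightarrow> g \<in> S \<Longrightarrow> l (\<lambda>x. f x + c *\<^sub>R g x) = l f + c * l g"
    and l_bdd: "\<And>f. f \<in> S \<Longrightarrow> \<bar>l f\<bar> \<le> C * sqrt (sq_norm \<Omega> f)"
  shows "\<exists>w\<in>S. \<forall>f\<in>S. (\<integral>x. w x \<bullet> f x \<partial>lebesgue_on \<Omega>) = l f"
proof -
  define J where "J f = sq_norm \<Omega> f - 2 * l f" for f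
  have L2: "f \<in> L2_space \<Omega>" if "f \<in> S" for f using S that by auto
  have lower: "- C\<^sup>2 \<le> J f" if "f \<in> S" for f
  proof -
    have "0 \<le> (sqrt (sq_norm \<Omega> f) - C)\<^sup>2" by simp
    then have "2 * (C * sqrt (sq_norm \<Omega> f)) \<le> sq_norm \<Omega> f + C\<^sup>2" by (simp add: power2_diff mult.commute mult.left_commute)
    then show ?thesis using l_bdd[OF that] unfolding J_def by linarith
  qed
  have bdd: "bdd_below (J ` S)" using lower by (intro bdd_belowI2)
  define I where "I = (INF f\<in>S. J f)"
  have I: "I \<le> J f" if "f \<in> S" for f unfolding I_def using bdd that by (rule cINF_lower)
  have "\<exists>f\<in>S. J f < I + 1 / (real n + 1)" for n
    using cINF_less_iff[OF S(2) bdd, of "I + 1 / (real n + 1)"] unfolding I_def by auto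
  then obtain f where f: "\<And>n. f n \<in> S" "\<And>n. J (f n) < I + 1 / (real n + 1)" by metis
  (* Parallelogram identity; the functional is at least I at the midpoint of f m and f n. *)
  have par: "sq_norm \<Omega> (\<lambda>x. f m x - f n x) \<le> 2 / (real m + 1) + 2 / (real n + 1)" for m n
  proof -
    have d: "(\<lambda>x. f m x + (-1) *\<^sub>R f n x) \<in> S" by (intro lin f)
    have mid: "(\<lambda>x. f m x + (-1/2) *\<^sub>R (f m x + (-1) *\<^sub>R f n x)) \<in> S"
      by (intro lin f d)
    define ip where "ip = (\<integral>x. f m x \<bullet> f n x \<partial>lebesgue_on \<Omega>)"
    have dm: "sq_norm \<Omega> (\<lambda>x. f m x + (-1) *\<^sub>R f n x) = sq_norm \<Omega> (f m) - 2 * ip + sq_norm \<Omega> (f n)"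
      unfolding L2_space_lincomb(2)[OF L2[OF f(1)] L2[OF f(1)]] ip_def by simp
    have ipd: "(\<integral>x. f m x \<bullet> (f m x + (-1) *\<^sub>R f n x) \<partial>lebesgue_on \<Omega>) = sq_norm \<Omega> (f m) - ip"
      using L2_space_inner_integrable[OF L2[OF f(1)[of m]] L2[OF f(1)[of n]]]
        L2_space_inner_integrable[OF L2[OF f(1)[of m]] L2[OF f(1)[of m]]]
      by (simp add: inner_diff_right ip_def power2_norm_eq_inner)
    have "I \<le> J (\<lambda>x. f m x + (-1/2) *\<^sub>R (f m x + (-1) *\<^sub>R f n x))" by (rule I[OF mid])
    also have "\<dots> = sq_norm \<Omega> (f m) - (sq_norm \<Omega> (f m) - ip) 
        + 1/4 * (sq_norm \<Omega> (f m) - 2 * ip + sq_norm \<Omega> (f n)) - 2 * (l (f m) - 1/2 * (l (f m) - l (f n)))"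
      unfolding J_def L2_space_lincomb(2)[OF L2[OF f(1)] L2[OF d]] dm ipd l_lin[OF f(1) d] l_lin[OF f(1) f(1)]
      by (simp add: power2_eq_square)
    finally have "4 * I \<le> sq_norm \<Omega> (f m) + sq_norm \<Omega> (f n) + 2 * ip - 4 * l (f m) - 4 * l (f n)"
      by (simp add: algebra_simps)
    moreover have "sq_norm \<Omega> (\<lambda>x. f m x - f n x) = sq_norm \<Omega> (f m) - 2 * ip + sq_norm \<Omega> (f n)"
      using dm by simp
    ultimately have "sq_norm \<Omega> (\<lambda>x. f m x - f n x) \<le> 2 * J (f m) + 2 * J (f n) - 4 * I"
      unfolding J_def by simp
    then show ?thesis using f(2)[of m] f(2)[of n] by simp
  qed
  obtain w where w: "w \<in> L2_space \<Omega>" "(\<lambda>n. sq_norm \<Omega> (\<lambda>x. f n x - w x)) \<longlonglongrightarrow> 0"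
  proof (rule L2_complete[OF fin L2[OF f(1)]])
    fix e :: real assume e: "0 < e"
    obtain N where N: "4 / e < real N" using reals_Archimedean2 by blast
    have "sq_norm \<Omega> (\<lambda>x. f m x - f n x) < e" if "m \<ge> N" "n \<ge> N" for m n
    proof -
      have "2 / (real k + 1) < e / 2" if "k \<ge> N" for k
      proof -
        have "4 / e < real k + 1" using N that by linarith
        then show ?thesis using e by (simp add: field_simps)
      qed
      from this[OF that(1)] this[OF that(2)] par[of m n] show ?thesis by linarith
    qed
    then show "\<exists>N. \<forall>m\<ge>N. \<forall>n\<ge>N. sq_norm \<Omega> (\<lambda>x. f m x - f n x) < e" by blast
  qed
  have wS: "w \<in> S" using closed[OF f(1) w] .
  have l_diff: "l (f n) - l w = l (\<lambda>x. f n x - w x)" for n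
    using l_lin[OF f(1)[of n] wS, of "-1"] by simp
  have "(\<lambda>n. C * sqrt (sq_norm \<Omega> (\<lambda>x. f n x - w x))) \<longlonglongrightarrow> 0"
    using tendsto_mult[OF tendsto_const[of C] tendsto_real_sqrt[OF w(2)]] by simp
  then have "(\<lambda>n. l (f n) - l w) \<longlonglongrightarrow> 0"
  proof (rule Lim_null_comparison[rotated], intro always_eventually allI)
    fix n
    have "(\<lambda>x. f n x - w x) \<in> S" using lin[OF f(1)[of n] wS, of "-1"] by simp
    from l_bdd[OF this] show "norm (l (f n) - l w) \<le> C * sqrt (sq_norm \<Omega> (\<lambda>x. f n x - w x))"
      by (simp add: l_diff)
  qed
  then have "(\<lambda>n. l (f n)) \<longlonglongrightarrow> l w" by (simp add: LIM_zero_iff)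
  then have Jlim: "(\<lambda>n. J (f n)) \<longlonglongrightarrow> J w"
    unfolding J_def by (intro tendsto_intros L2_tendsto_sq_norm[OF L2[OF f(1)] w])
  have "(\<lambda>n. I + 1 / (real n + 1)) \<longlonglongrightarrow> I + 0"
    using LIMSEQ_inverse_real_of_nat by (intro tendsto_intros) (simp add: inverse_eq_divide add.commute)
  then have "J w \<le> I"
    using f(2) by (intro LIMSEQ_le[OF Jlim]) (auto intro: less_imp_le)
  then have min: "J w \<le> J g" if "g \<in> S" for g using I[OF that] by simp
  have "(\<integral>x. w x \<bullet> g x \<partial>lebesgue_on \<Omega>) = l g" if g: "g \<in> S" for g
  proof -
    have "0 \<le> t\<^sup>2 * sq_norm \<Omega> g + 2 * t * ((\<integral>x. w x \<bullet> g x \<partial>lebesgue_on \<Omega>) - l g)" for t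
      using min[OF lin[OF wS g, of t]]
      unfolding J_def L2_space_lincomb(2)[OF L2[OF wS] L2[OF g]] l_lin[OF wS g]
      by (simp add: algebra_simps)
    from quadratic_nonneg_imp_linear_zero[OF this] show ?thesis by simp
  qed
  with wS show ?thesis by blast
qed


section \<open>Smooth functions\<close>

lemma Ck_SucI:
  assumes "\<And>x. GDERIV f x :> g x" "\<And>b. b \<in> Basis \<Longrightarrow> Ck k (\<lambda>x. g x \<bullet> b)"
  shows "Ck (Suc k) f"
  using assms by auto

lemma GDERIV_continuous_on:
  assumes "\<And>x. GDERIV f x :> g x"
  shows "continuous_on UNIV f"
  using assms unfolding gderiv_def
  by (meson continuous_at_imp_continuous_on has_derivative_continuous)

text \<open>Needed for products: the derivative of a product of functions of class \<open>C^(k+1)\<close> contains the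
  functions themselves, as functions of class \<open>C^k\<close>.\<close>

lemma Ck_SucD: "Ck (Suc k) f \<Longrightarrow> Ck k f"
proof (induction k arbitrary: f)
  case 0
  then show ?case using GDERIV_continuous_on[of f] by auto
next
  case (Suc k)
  then obtain g where g: "\<And>x. GDERIV f x :> g x" "\<And>b. b \<in> Basis \<Longrightarrow> Ck (Suc k) (\<lambda>x. g x \<bullet> b)"
    using Ck.simps(2)[of "Suc k" f] by blast
  show ?case by (rule Ck_SucI[OF g(1) Suc.IH[OF g(2)]])
qed

lemma Ck_const: "Ck k (\<lambda>x. c)"
proof (induction k arbitrary: c)
  case (Suc k)
  show ?case by (rule Ck_SucI[OF GDERIV_const]) (use Suc in simp)
qed simp

lemma Ck_lincomb:
  assumes "Ck k f" "Ck k g"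
  shows "Ck k (\<lambda>x. f x + c * g x)"
  using assms
proof (induction k arbitrary: f g)
  case 0
  then show ?case by (auto intro!: continuous_intros)
next
  case (Suc k)
  then obtain f' g' where fg: "\<And>x. GDERIV f x :> f' x" "\<And>b. b \<in> Basis \<Longrightarrow> Ck k (\<lambda>x. f' x \<bullet> b)"
    "\<And>x. GDERIV g x :> g' x" "\<And>b. b \<in> Basis \<Longrightarrow> Ck k (\<lambda>x. g' x \<bullet> b)"
    unfolding Ck.simps by blast
  show ?case
  proof (rule Ck_SucI)
    show "GDERIV (\<lambda>x. f x + c * g x) x :> f' x + c *\<^sub>R g' x" for x
      using GDERIV_add[OF fg(1)[of x] GDERIV_mult[OF GDERIV_const[of c] fg(3)[of x]]] by simp
    show "Ck k (\<lambda>x. (f' x + c *\<^sub>R g' x) \<bullet> b)" if "b \<in> Basis" for b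
      using Suc.IH[OF fg(2,4)[OF that]] by (simp add: inner_add_left)
  qed
qed

lemma Ck_mult:
  assumes "Ck k f" "Ck k g"
  shows "Ck k (\<lambda>x. f x * g x)"
  using assms
proof (induction k arbitrary: f g)
  case 0
  then show ?case by (auto intro!: continuous_intros)
next
  case (Suc k)
  then obtain f' g' where fg: "\<And>x. GDERIV f x :> f' x" "\<And>b. b \<in> Basis \<Longrightarrow> Ck k (\<lambda>x. f' x \<bullet> b)"
    "\<And>x. GDERIV g x :> g' x" "\<And>b. b \<in> Basis \<Longrightarrow> Ck k (\<lambda>x. g' x \<bullet> b)"
    unfolding Ck.simps by blast
  show ?case
  proof (rule Ck_SucI)
    show "GDERIV (\<lambda>x. f x * g x) x :> f x *\<^sub>R g' x + g x *\<^sub>R f' x" for x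
      by (rule GDERIV_mult[OF fg(1,3)])
    show "Ck k (\<lambda>x. (f x *\<^sub>R g' x + g x *\<^sub>R f' x) \<bullet> b)" if "b \<in> Basis" for b
      using Ck_lincomb[OF Suc.IH[OF Ck_SucD[OF Suc.prems(1)] fg(4)[OF that]]
          Suc.IH[OF Ck_SucD[OF Suc.prems(2)] fg(2)[OF that]], of 1]
      by (simp add: inner_add_left)
  qed
qed

lemma Ck_prod:
  assumes "finite I" "\<And>i. i \<in> I \<Longrightarrow> Ck k (f i)"
  shows "Ck k (\<lambda>x. \<Prod>i\<in>I. f i x)"
  using assms
proof (induction I rule: finite_induct)
  case empty
  then show ?case by (simp add: Ck_const)
next
  case (insert i I)
  then show ?case by (simp add: Ck_mult)
qed

text \<open>The derivatives of \<open>exp(-1/t)\<close>, extended by zero, are linear combinations of these functions.\<close>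

definition flat_exp :: "nat \<Rightarrow> real \<Rightarrow> real" where
  "flat_exp n t = (if 0 < t then exp (- 1 / t) / t ^ n else 0)"

lemma flat_exp_tendsto_0: "(flat_exp n \<longlongrightarrow> 0) (at 0)"
proof -
  have "((\<lambda>s::real. s ^ n / exp s) \<longlongrightarrow> 0) at_top" by (rule tendsto_power_div_exp_0)
  then have "((\<lambda>t. (inverse t) ^ n / exp (inverse t)) \<longlongrightarrow> 0) (at_right (0::real))"
    by (rule filterlim_compose[OF _ filterlim_inverse_at_top_right])
  moreover have "\<forall>\<^sub>F t in at_right 0. (inverse t) ^ n / exp (inverse t) = flat_exp n t"
    by (rule eventually_at_rightI[of 0 1])
      (auto simp: flat_exp_def exp_minus field_simps power_inverse)
  ultimately have "(flat_exp n \<longlongrightarrow> 0) (at_right 0)" by (rule Lim_transform_eventually)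
  moreover have "(flat_exp n \<longlongrightarrow> 0) (at_left 0)"
    by (rule Lim_transform_eventually[OF tendsto_const])
      (auto simp: flat_exp_def eventually_at_filter)
  ultimately show ?thesis by (simp add: filterlim_split_at)
qed

text \<open>The family is closed under differentiation up to linear combinations. At the origin the difference
  quotient of one member is the next member.\<close>

lemma DERIV_flat_exp:
  "(flat_exp n has_real_derivative flat_exp (n + 2) t - real n * flat_exp (n + 1) t) (at t)"
proof -
  consider "0 < t" | "t < 0" | "t = 0" by linarith
  then show ?thesis
  proof cases
    case 1
    have "((\<lambda>t. exp (- 1 / t) / t ^ n) has_real_derivative
        flat_exp (n + 2) t - real n * flat_exp (n + 1) t) (at t)"
    proof (cases n)
      case 0
      then show ?thesis using 1
        by (auto intro!: derivative_eq_intros simp: flat_exp_def power2_eq_square field_simps)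
    next
      case (Suc m)
      have "((\<lambda>t. exp (- 1 / t) / t ^ n) has_real_derivative
          (exp (- 1 / t) * (1 / t\<^sup>2) * t ^ n - exp (- 1 / t) * (real n * t ^ (n - Suc 0))) / (t ^ n * t ^ n)) (at t)"
        using 1 by (auto intro!: derivative_eq_intros simp: power2_eq_square)
      moreover have "(exp (- 1 / t) * (1 / t\<^sup>2) * t ^ n - exp (- 1 / t) * (real n * t ^ (n - Suc 0))) / (t ^ n * t ^ n)
          = flat_exp (n + 2) t - real n * flat_exp (n + 1) t"
        using 1 Suc by (simp add: flat_exp_def power2_eq_square field_simps)
      ultimately show ?thesis by simp
    qed
    then show ?thesis
      by (rule has_field_derivative_transform_within[where d = t])
        (use 1 in \<open>auto simp: flat_exp_def dist_real_def\<close>)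
  next
    case 2
    have "((\<lambda>t. 0) has_real_derivative flat_exp (n + 2) t - real n * flat_exp (n + 1) t) (at t)"
      using 2 by (simp add: flat_exp_def)
    then show ?thesis
      by (rule has_field_derivative_transform_within[where d = "- t"])
        (use 2 in \<open>auto simp: flat_exp_def dist_real_def\<close>)
  next
    case 3
    have "(\<lambda>h. (flat_exp n (0 + h) - flat_exp n 0) / h) = flat_exp (n + 1)"
      by (rule ext) (auto simp: flat_exp_def)
    then show ?thesis using flat_exp_tendsto_0[of "n + 1"] 3
      by (simp add: DERIV_def flat_exp_def[of _ 0])
  qed
qed

lemma Ck_flat_exp_affine: "Ck k (\<lambda>x. flat_exp n (x \<bullet> v + d))"
proof (induction k arbitrary: n)
  case 0
  have "continuous_on UNIV (flat_exp n)"
    using DERIV_flat_exp[of n] by (meson DERIV_isCont continuous_at_imp_continuous_on)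
  then show ?case
    by (auto intro!: continuous_on_compose2[of UNIV "flat_exp n"] continuous_intros)
next
  case (Suc k)
  show ?case
  proof (rule Ck_SucI)
    show "GDERIV (\<lambda>x. flat_exp n (x \<bullet> v + d)) x :>
        (flat_exp (n + 2) (x \<bullet> v + d) - real n * flat_exp (n + 1) (x \<bullet> v + d)) *\<^sub>R v" for x
    proof (rule GDERIV_DERIV_compose[OF _ DERIV_flat_exp])
      show "GDERIV (\<lambda>x. x \<bullet> v + d) x :> v"
        unfolding gderiv_def by (auto intro!: derivative_eq_intros)
    qed
    show "Ck k (\<lambda>x. ((flat_exp (n + 2) (x \<bullet> v + d) - real n * flat_exp (n + 1) (x \<bullet> v + d)) *\<^sub>R v) \<bullet> b)" for b
      using Ck_mult[OF Ck_lincomb[OF Suc.IH[of "n+2"] Suc.IH[of "n+1"], of "- real n"] Ck_const[of k "v \<bullet> b"]]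
      by simp
  qed
qed

section \<open>Test functions and weak gradients\<close>

text \<open>For \<open>m > 0\<close> a smooth function that is positive exactly on the open box; it increases to 1 there as
  \<open>m\<close> grows.\<close>

definition box_bump :: "'a::euclidean_space \<Rightarrow> 'a \<Rightarrow> nat \<Rightarrow> 'a \<Rightarrow> real" where
  "box_bump a b m x = (\<Prod>i\<in>Basis. flat_exp 0 (real m * (x \<bullet> i - a \<bullet> i)) * flat_exp 0 (real m * (b \<bullet> i - x \<bullet> i)))"

lemma box_bump_eq_0: "x \<notin> box a b \<Longrightarrow> box_bump a b m x = 0"
proof -
  assume "x \<notin> box a b"
  then obtain i where "i \<in> Basis" "\<not> (0 < x \<bullet> i - a \<bullet> i) \<or> \<not> (0 < b \<bullet> i - x \<bullet> i)"
    by (auto simp: mem_box)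
  then have "flat_exp 0 (real m * (x \<bullet> i - a \<bullet> i)) * flat_exp 0 (real m * (b \<bullet> i - x \<bullet> i)) = 0"
    by (auto simp: flat_exp_def zero_less_mult_iff)
  then show ?thesis using \<open>i \<in> Basis\<close> unfolding box_bump_def by (intro prod_zero) auto
qed

lemma flat_exp_bounds: "0 \<le> flat_exp 0 t" "flat_exp 0 t \<le> 1"
  by (auto simp: flat_exp_def)

lemma box_bump_bounds: "0 \<le> box_bump a b m x" "box_bump a b m x \<le> 1"
  unfolding box_bump_def
  by (auto intro!: prod_nonneg prod_le_1 mult_nonneg_nonneg mult_le_one flat_exp_bounds)

lemma box_bump_tendsto_indicator: "(\<lambda>m. box_bump a b m x) \<longlonglongrightarrow> indicator (box a b) x"
proof (cases "x \<in> box a b")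
  case True
  have *: "(\<lambda>m. flat_exp 0 (real m * s)) \<longlonglongrightarrow> 1" if "0 < s" for s
  proof -
    have "(\<lambda>m. exp (- (1 / (real m * s)))) \<longlonglongrightarrow> exp (- 0)"
      using that by (intro tendsto_intros) real_asymp
    moreover have "\<forall>\<^sub>F m in sequentially. exp (- (1 / (real m * s))) = flat_exp 0 (real m * s)"
      using eventually_gt_at_top[of 0] by eventually_elim (use that in \<open>auto simp: flat_exp_def\<close>)
    ultimately show ?thesis by (simp add: Lim_transform_eventually)
  qed
  have "(\<lambda>m. box_bump a b m x) \<longlonglongrightarrow> (\<Prod>i\<in>(Basis::'a set). 1 * 1)"
    unfolding box_bump_def using True by (intro tendsto_prod tendsto_mult *) (auto simp: mem_box)
  then show ?thesis using True by simp
qed (simp add: box_bump_eq_0)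

lemma box_bump_test_function:
  assumes "cbox a b \<subseteq> \<Omega>"
  shows "box_bump a b m \<in> test_functions \<Omega>"
proof -
  have "closure {x. box_bump a b m x \<noteq> 0} \<subseteq> cbox a b"
    by (rule closure_minimal) (use box_bump_eq_0[of _ a b m] box_subset_cbox in auto)
  moreover have "Ck k (box_bump a b m)" for k
  proof -
    have *: "Ck k (\<lambda>x. flat_exp 0 (real m * (x \<bullet> i - a \<bullet> i)))"
      "Ck k (\<lambda>x. flat_exp 0 (real m * (b \<bullet> i - x \<bullet> i)))" for i
      using Ck_flat_exp_affine[of k 0 "real m *\<^sub>R i" "- real m * (a \<bullet> i)"]
        Ck_flat_exp_affine[of k 0 "- real m *\<^sub>R i" "real m * (b \<bullet> i)"]
      by (simp_all add: algebra_simps)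
    show ?thesis unfolding box_bump_def[abs_def] by (intro Ck_prod Ck_mult *) simp
  qed
  moreover have "compact (closure {x. box_bump a b m x \<noteq> 0})"
    using calculation(1) compact_cbox bounded_cbox bounded_subset compact_eq_bounded_closed by blast
  ultimately show ?thesis unfolding test_functions_def using assms by blast
qed

lemma GDERIV_unique: "GDERIV f x :> D \<Longrightarrow> GDERIV f x :> E \<Longrightarrow> D = E"
proof -
  assume "GDERIV f x :> D" "GDERIV f x :> E"
  then have "(\<lambda>h. h \<bullet> D) = (\<lambda>h. h \<bullet> E)" unfolding gderiv_def by (rule has_derivative_unique)
  then show ?thesis by (metis inner_commute vector_eq_rdot)
qed

lemma gradient_eq: "GDERIV f x :> D \<Longrightarrow> gradient f x = D"
  unfolding gradient_def using GDERIV_unique by blast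

text \<open>Outside of the support, which is closed, the function vanishes in a neighbourhood, hence so does
  its gradient.\<close>

lemma test_functionD:
  assumes "\<phi> \<in> test_functions \<Omega>"
  shows "GDERIV \<phi> x :> gradient \<phi> x" "continuous_on UNIV \<phi>" "continuous_on UNIV (gradient \<phi>)"
    "x \<notin> \<Omega> \<Longrightarrow> \<phi> x = 0" "x \<notin> \<Omega> \<Longrightarrow> gradient \<phi> x = 0"
proof -
  have Ck: "Ck k \<phi>" for k using assms by (simp add: test_functions_def)
  from Ck[of "Suc 0"] obtain g where g: "\<And>x. GDERIV \<phi> x :> g x" "\<And>b. b \<in> Basis \<Longrightarrow> continuous_on UNIV (\<lambda>x. g x \<bullet> b)"
    by auto
  have eq: "gradient \<phi> = g" using gradient_eq[OF g(1)] by auto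
  show G: "GDERIV \<phi> x :> gradient \<phi> x" for x using g(1) eq by simp
  show "continuous_on UNIV \<phi>" using Ck[of 0] by simp
  show "continuous_on UNIV (gradient \<phi>)" unfolding eq using g(2) continuous_on_componentwise by blast
  let ?K = "closure {x. \<phi> x \<noteq> 0}"
  have K: "?K \<subseteq> \<Omega>" using assms by (simp add: test_functions_def)
  have zero: "\<phi> y = 0" if "y \<notin> ?K" for y
    using that subsetD[OF closure_subset, of y "{x. \<phi> x \<noteq> 0}"] by auto
  show "\<phi> x = 0" if "x \<notin> \<Omega>" using zero K that by blast
  show "gradient \<phi> x = 0" if "x \<notin> \<Omega>"
  proof -
    have "x \<notin> ?K" using that K by blast
    then have "open (- ?K)" "x \<in> - ?K" by (auto simp only: open_Compl closed_closure Compl_iff)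
    moreover have "0 = \<phi> y" if "y \<in> - ?K" for y using zero[of y] that by simp
    ultimately have "GDERIV \<phi> x :> 0"
      unfolding gderiv_def
      by (intro has_derivative_transform_within_open[OF GDERIV_const[unfolded gderiv_def]])
    then show ?thesis by (rule gradient_eq)
  qed
qed

lemma test_function_lincomb:
  assumes "\<phi> \<in> test_functions \<Omega>" "\<psi> \<in> test_functions \<Omega>"
  shows "(\<lambda>x. \<phi> x + c * \<psi> x) \<in> test_functions \<Omega>"
    and "gradient (\<lambda>x. \<phi> x + c * \<psi> x) x = gradient \<phi> x + c *\<^sub>R gradient \<psi> x"
proof -
  show "gradient (\<lambda>x. \<phi> x + c * \<psi> x) x = gradient \<phi> x + c *\<^sub>R gradient \<psi> x"
    using GDERIV_add[OF test_functionD(1)[OF assms(1)] GDERIV_mult[OF GDERIV_const[of c] test_functionD(1)[OF assms(2)]]]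
    by (intro gradient_eq) simp
  let ?K = "closure {x. \<phi> x \<noteq> 0} \<union> closure {x. \<psi> x \<noteq> 0}"
  have K: "compact ?K" "?K \<subseteq> \<Omega>" using assms by (auto simp: test_functions_def intro: compact_Un)
  have "closure {x. \<phi> x + c * \<psi> x \<noteq> 0} \<subseteq> ?K"
  proof (rule closure_minimal)
    show "{x. \<phi> x + c * \<psi> x \<noteq> 0} \<subseteq> ?K"
    proof
      fix x assume "x \<in> {x. \<phi> x + c * \<psi> x \<noteq> 0}"
      then have "x \<in> {x. \<phi> x \<noteq> 0} \<or> x \<in> {x. \<psi> x \<noteq> 0}" by auto
      then show "x \<in> ?K"
        by (elim disjE) (intro UnI1 UnI2 closure_subset[THEN subsetD]; assumption)+
    qed
  qed (intro closed_Un closed_closure)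
  then have "compact (closure {x. \<phi> x + c * \<psi> x \<noteq> 0})" "closure {x. \<phi> x + c * \<psi> x \<noteq> 0} \<subseteq> \<Omega>"
    using K(2) bounded_subset[OF compact_imp_bounded[OF K(1)]]
    unfolding compact_eq_bounded_closed by (blast intro: closed_closure)+
  moreover have "Ck k (\<lambda>x. \<phi> x + c * \<psi> x)" for k
    using assms by (intro Ck_lincomb) (auto simp: test_functions_def)
  ultimately show "(\<lambda>x. \<phi> x + c * \<psi> x) \<in> test_functions \<Omega>"
    unfolding test_functions_def by blast
qed

lemma lebesgue_on_integral_extend:
  fixes f :: "'a::euclidean_space \<Rightarrow> 'b::euclidean_space"
  assumes "\<Omega> \<in> sets lebesgue" "\<And>x. x \<notin> \<Omega> \<Longrightarrow> f x = 0"
  shows "integral\<^sup>L (lebesgue_on \<Omega>) f = integral\<^sup>L lebesgue f"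
    and "integrable (lebesgue_on \<Omega>) f \<longleftrightarrow> integrable lebesgue f"
proof -
  have "(\<lambda>x. indicator \<Omega> x *\<^sub>R f x) = f" using assms(2) by (auto simp: indicator_def)
  then show "integral\<^sup>L (lebesgue_on \<Omega>) f = integral\<^sup>L lebesgue f"
    "integrable (lebesgue_on \<Omega>) f \<longleftrightarrow> integrable lebesgue f"
    using assms(1) by (simp_all add: integral_restrict_space integrable_restrict_space)
qed

lemma continuous_compact_support_integrable:
  fixes f :: "'a::euclidean_space \<Rightarrow> 'b::euclidean_space"
  assumes "continuous_on UNIV f" "\<And>x. x \<notin> cball 0 R \<Longrightarrow> f x = 0"
  shows "integrable lborel f"
proof -
  have "set_integrable lborel (cball 0 R) f"
    unfolding set_integrable_def
    by (intro borel_integrable_compact continuous_on_subset[OF assms(1)]) auto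
  moreover have "(\<lambda>x. indicator (cball 0 R) x *\<^sub>R f x) = f" using assms(2) by (auto simp: indicator_def)
  ultimately show ?thesis by (simp add: set_integrable_def)
qed

lemma continuous_compact_support_bounded:
  fixes f :: "'a::euclidean_space \<Rightarrow> 'b::euclidean_space"
  assumes "continuous_on UNIV f" "\<And>x. x \<notin> cball 0 R \<Longrightarrow> f x = 0"
  obtains B where "0 \<le> B" "\<And>x. norm (f x) \<le> B"
proof -
  have "bounded (f ` cball 0 R)"
    using assms(1) continuous_on_subset by (intro compact_imp_bounded compact_continuous_image) auto
  then obtain B where "\<And>x. x \<in> cball 0 R \<Longrightarrow> norm (f x) \<le> B" unfolding bounded_iff by blast
  then have "norm (f x) \<le> max B 0" for x using assms(2)[of x]
    by (cases "x \<in> cball 0 R") (auto intro: le_max_iff_disj[THEN iffD2])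
  then show ?thesis using that[of "max B 0"] by simp
qed

lemma integral_translate:
  fixes f :: "'a::euclidean_space \<Rightarrow> 'b::euclidean_space"
  assumes "f \<in> borel_measurable borel"
  shows "(\<integral>x. f (c + x) \<partial>lborel) = (\<integral>x. f x \<partial>lborel)"
    and "integrable lborel f \<Longrightarrow> integrable lborel (\<lambda>x. f (c + x))"
  using assms
  by (subst (2) lborel_distr_plus[symmetric, of c], simp add: integral_distr,
      subst (asm) lborel_distr_plus[symmetric, of c], simp add: integrable_distr_eq)

lemma GDERIV_lipschitz:
  assumes "\<And>x. GDERIV f x :> g x" "\<And>x. norm (g x) \<le> B"
  shows "\<bar>f y - f x\<bar> \<le> B * norm (y - x)"
proof -
  have "norm (f y - f x) \<le> B * norm (y - x)"
  proof (rule differentiable_bound[where S = UNIV and f' = "\<lambda>x h. h \<bullet> g x"])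
    show "(f has_derivative (\<lambda>h. h \<bullet> g x)) (at x within UNIV)" for x using assms(1) by (simp add: gderiv_def)
    show "onorm (\<lambda>h. h \<bullet> g x) \<le> B" for x
    proof (rule onorm_bound)
      show "0 \<le> B" using assms(2)[of x] norm_ge_zero order_trans by blast
      show "norm (h \<bullet> g x) \<le> B * norm h" for h
        using Cauchy_Schwarz_ineq2[of h "g x"] mult_left_mono[OF assms(2)[of x] norm_ge_zero[of h]]
        by (simp add: mult.commute)
    qed
  qed auto
  then show ?thesis by simp
qed

text \<open>The integral of a difference quotient vanishes by translation invariance, and the difference
  quotients are dominated by the Lipschitz constant on a slightly larger ball.\<close>

lemma integral_gradient_zero:
  fixes f :: "'a::euclidean_space \<Rightarrow> real"
  assumes f: "\<And>x. GDERIV f x :> g x" and g: "continuous_on UNIV g"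
    and supp: "\<And>x. x \<notin> cball 0 R \<Longrightarrow> f x = 0" "\<And>x. x \<notin> cball 0 R \<Longrightarrow> g x = 0"
  shows "(\<integral>x. g x \<partial>lborel) = 0"
proof -
  have f_cont: "continuous_on UNIV f" by (rule GDERIV_continuous_on[OF f])
  have [measurable]: "f \<in> borel_measurable borel" "g \<in> borel_measurable borel"
    using f_cont g by (simp_all add: borel_measurable_continuous_onI)
  have f_int: "integrable lborel f" by (rule continuous_compact_support_integrable[OF f_cont supp(1)])
  have g_int: "integrable lborel g" by (rule continuous_compact_support_integrable[OF g supp(2)])
  obtain B where B: "0 \<le> B" "\<And>x. norm (g x) \<le> B"
    using continuous_compact_support_bounded[OF g supp(2)] by blast
  have "(\<integral>x. g x \<partial>lborel) \<bullet> b = 0 \<bullet> b" if b: "b \<in> Basis" for b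
  proof -
    (* Steps of length at most 1, so that all difference quotients live in the ball of radius R + 1. *)
    define h where "h n = 1 / (real n + 1)" for n :: nat
    have h: "0 < h n" "h n \<le> 1" for n by (auto simp: h_def)
    have h0: "h \<longlonglongrightarrow> 0"
      unfolding h_def[abs_def] using LIMSEQ_inverse_real_of_nat by (simp add: inverse_eq_divide add.commute)
    have lim: "(\<lambda>n. \<integral>x. (f (h n *\<^sub>R b + x) - f x) / h n \<partial>lborel) \<longlonglongrightarrow> (\<integral>x. g x \<bullet> b \<partial>lborel)"
    proof (rule integral_dominated_convergence[where w = "\<lambda>x. B * indicator (cball 0 (R + 1)) x"])
      show "integrable lborel (\<lambda>x. B * indicator (cball 0 (R + 1)) x :: real)"
        using emeasure_lborel_cball_finite[of 0 "R + 1"]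
        by (intro integrable_mult_right integrable_real_indicator) auto
      show "AE x in lborel. norm ((f (h n *\<^sub>R b + x) - f x) / h n) \<le> B * indicator (cball 0 (R + 1)) x" for n
      proof (rule AE_I2)
        fix x
        show "norm ((f (h n *\<^sub>R b + x) - f x) / h n) \<le> B * indicator (cball 0 (R + 1)) x"
        proof (cases "x \<in> cball 0 (R + 1)")
          case True
          have "\<bar>f (h n *\<^sub>R b + x) - f x\<bar> \<le> B * norm (h n *\<^sub>R b + x - x)" by (rule GDERIV_lipschitz[OF f B(2)])
          also have "\<dots> = B * h n" using b h(1)[of n] by simp
          finally show ?thesis using True h(1)[of n] by (simp add: field_simps)
        next
          case False
          have "norm x \<le> norm (h n *\<^sub>R b + x) + norm (h n *\<^sub>R b)" 
            using norm_triangle_ineq4[of "h n *\<^sub>R b + x" "h n *\<^sub>R b"] by simp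
          then have "h n *\<^sub>R b + x \<notin> cball 0 R" "x \<notin> cball 0 R" using False b h[of n] by auto
          then show ?thesis using supp(1) B(1) by simp
        qed
      qed
      show "AE x in lborel. (\<lambda>n. (f (h n *\<^sub>R b + x) - f x) / h n) \<longlonglongrightarrow> g x \<bullet> b"
      proof (rule AE_I2)
        fix x
        have "((\<lambda>t. x + t *\<^sub>R b) has_derivative (\<lambda>t. t *\<^sub>R b)) (at 0)"
          by (auto intro!: derivative_eq_intros)
        moreover have "(f has_derivative (\<lambda>k. k \<bullet> g x)) (at (x + 0 *\<^sub>R b))" using f by (simp add: gderiv_def)
        ultimately have "((\<lambda>t. f (x + t *\<^sub>R b)) has_derivative (\<lambda>t. (t *\<^sub>R b) \<bullet> g x)) (at 0)"
          using has_derivative_compose by fast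
        moreover have "(\<lambda>t. (t *\<^sub>R b) \<bullet> g x) = (*) (g x \<bullet> b)" by (auto simp: inner_commute)
        ultimately have "((\<lambda>t. f (x + t *\<^sub>R b)) has_field_derivative (g x \<bullet> b)) (at 0)"
          by (simp add: has_field_derivative_def)
        then have "((\<lambda>t. (f (x + t *\<^sub>R b) - f x) / t) \<longlongrightarrow> g x \<bullet> b) (at 0)" by (simp add: DERIV_def)
        moreover have "filterlim h (at 0) sequentially"
          using h0 h(1) by (simp add: filterlim_at less_imp_neq[symmetric])
        ultimately have "((\<lambda>n. (f (x + h n *\<^sub>R b) - f x) / h n) \<longlongrightarrow> g x \<bullet> b) sequentially"
          by (rule filterlim_compose)
        then show "(\<lambda>n. (f (h n *\<^sub>R b + x) - f x) / h n) \<longlonglongrightarrow> g x \<bullet> b" by (simp add: add.commute)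
      qed
    qed measurable
    have zero: "(\<integral>x. (f (h n *\<^sub>R b + x) - f x) / h n \<partial>lborel) = 0" for n
      using integral_translate[of f "h n *\<^sub>R b"] f_int by simp
    have "(\<integral>x. g x \<bullet> b \<partial>lborel) = 0" using LIMSEQ_unique[OF lim[unfolded zero] tendsto_const] .
    then show ?thesis using g_int by (simp add: integral_inner_left)
  qed
  then show ?thesis by (rule euclidean_eqI)
qed

lemma test_function_support_ball:
  assumes "bounded \<Omega>" "\<phi> \<in> test_functions \<Omega>"
  obtains R where "\<And>x. x \<notin> cball 0 R \<Longrightarrow> \<phi> x = 0" "\<And>x. x \<notin> cball 0 R \<Longrightarrow> gradient \<phi> x = 0"
proof -
  obtain R where "\<Omega> \<subseteq> cball 0 R" using assms(1) by (auto simp: bounded_iff subset_iff)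
  then show ?thesis using test_functionD(4,5)[OF assms(2)] that by blast
qed

lemma locally_integrable_continuous:
  fixes f :: "'a::euclidean_space \<Rightarrow> 'b::euclidean_space"
  assumes "continuous_on UNIV f"
  shows "locally_integrable \<Omega> f"
  unfolding locally_integrable_def
proof (intro allI impI)
  fix K assume "compact K \<and> K \<subseteq> \<Omega>"
  then have "set_integrable lborel K f"
    unfolding set_integrable_def
    by (intro borel_integrable_compact continuous_on_subset[OF assms]) auto
  then show "set_integrable lebesgue K f"
    unfolding set_integrable_def
    by (subst integrable_completion) auto
qed

text \<open>Integration by parts: the gradient of the product of two test functions has integral zero.\<close>

lemma test_function_has_weak_gradient:
  assumes \<Omega>: "bounded \<Omega>" "\<Omega> \<in> sets lebesgue" and \<phi>: "\<phi> \<in> test_functions \<Omega>"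
  shows "has_weak_gradient \<Omega> \<phi> (gradient \<phi>)"
  unfolding has_weak_gradient_def
proof (intro conjI ballI)
  note c = test_functionD(2,3)[OF \<phi>]
  show "locally_integrable \<Omega> \<phi>" "locally_integrable \<Omega> (gradient \<phi>)"
    using c by (simp_all add: locally_integrable_continuous)
  fix \<psi> assume \<psi>: "\<psi> \<in> test_functions \<Omega>"
  note c' = test_functionD(2,3)[OF \<psi>]
  obtain R where R: "\<Omega> \<subseteq> cball 0 R" using \<Omega>(1) by (auto simp: bounded_iff subset_iff)
  then have z: "\<phi> x = 0" "gradient \<phi> x = 0" "\<psi> x = 0" "gradient \<psi> x = 0" if "x \<notin> cball 0 R" for x
    using test_functionD(4,5)[OF \<phi>] test_functionD(4,5)[OF \<psi>] that by blast+
  have i: "integrable lborel (\<lambda>x. \<phi> x *\<^sub>R gradient \<psi> x)" "integrable lborel (\<lambda>x. \<psi> x *\<^sub>R gradient \<phi> x)"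
    using z by (auto intro!: continuous_compact_support_integrable continuous_intros c c')
  have "(\<integral>x. \<phi> x *\<^sub>R gradient \<psi> x + \<psi> x *\<^sub>R gradient \<phi> x \<partial>lborel) = 0"
  proof (rule integral_gradient_zero)
    show "GDERIV (\<lambda>x. \<phi> x * \<psi> x) x :> \<phi> x *\<^sub>R gradient \<psi> x + \<psi> x *\<^sub>R gradient \<phi> x" for x
      by (rule GDERIV_mult) (intro test_functionD(1)[OF \<phi>] test_functionD(1)[OF \<psi>])+
  qed (use z in \<open>auto intro!: continuous_intros c c'\<close>)
  then have "(\<integral>x. \<phi> x *\<^sub>R gradient \<psi> x \<partial>lborel) = - (\<integral>x. \<psi> x *\<^sub>R gradient \<phi> x \<partial>lborel)"
    using i by (simp add: eq_neg_iff_add_eq_0)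
  moreover have "(\<integral>x. \<phi> x *\<^sub>R gradient \<psi> x \<partial>lebesgue_on \<Omega>) = (\<integral>x. \<phi> x *\<^sub>R gradient \<psi> x \<partial>lborel)"
    using test_functionD(4)[OF \<phi>] i(1)
    by (subst lebesgue_on_integral_extend(1)[OF \<Omega>(2)]) (auto simp: integral_completion)
  moreover have "(\<integral>x. \<psi> x *\<^sub>R gradient \<phi> x \<partial>lebesgue_on \<Omega>) = (\<integral>x. \<psi> x *\<^sub>R gradient \<phi> x \<partial>lborel)"
    using test_functionD(4)[OF \<psi>] i(2)
    by (subst lebesgue_on_integral_extend(1)[OF \<Omega>(2)]) (auto simp: integral_completion)
  ultimately show "(\<integral>x. \<phi> x *\<^sub>R gradient \<psi> x \<partial>lebesgue_on \<Omega>) = - (\<integral>x. \<psi> x *\<^sub>R gradient \<phi> x \<partial>lebesgue_on \<Omega>)"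
    by simp
qed

text \<open>The bump functions increase to the indicator function of the open box, whose boundary is a null
  set.\<close>

lemma integral_cbox_zero_of_test_functions:
  fixes h :: "'a::euclidean_space \<Rightarrow> 'b::euclidean_space"
  assumes \<Omega>: "open \<Omega>" and h: "locally_integrable \<Omega> h"
    and zero: "\<And>\<psi>. \<psi> \<in> test_functions \<Omega> \<Longrightarrow> (\<integral>x. \<psi> x *\<^sub>R h x \<partial>lebesgue_on \<Omega>) = 0"
    and sub: "cbox a b \<subseteq> \<Omega>"
  shows "(\<integral>x. indicator (cbox a b) x *\<^sub>R h x \<partial>lebesgue) = 0"
proof -
  have \<Omega>s: "\<Omega> \<in> sets lebesgue" using \<Omega> by simp
  have int: "integrable lebesgue (\<lambda>x. indicator (cbox a b) x *\<^sub>R h x)"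
    using h sub compact_cbox unfolding locally_integrable_def set_integrable_def by blast
  define h' where "h' x = indicator (cbox a b) x *\<^sub>R h x" for x
  have int: "integrable lebesgue h'" using int by (simp add: h'_def[abs_def])
  note [measurable] = borel_measurable_integrable[OF int]
  have [measurable]: "box_bump a b m \<in> borel_measurable lebesgue" for m
    using test_functionD(2)[OF box_bump_test_function[OF sub]]
    by (intro measurable_completion) (simp add: borel_measurable_continuous_onI)
  have [measurable]: "indicat_real (box a b) \<in> borel_measurable lebesgue"
    by (intro borel_measurable_indicator) simp
  have m: "(\<lambda>x. indicat_real (box a b) x *\<^sub>R h' x) \<in> borel_measurable lebesgue"
    by (rule borel_measurable_scaleR) fact+
  have eq: "box_bump a b m x *\<^sub>R h x = box_bump a b m x *\<^sub>R h' x" for m x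
    using box_bump_eq_0[of x a b m] box_subset_cbox[of a b] by (auto simp: indicator_def h'_def)
  have "(\<lambda>m. \<integral>x. box_bump a b m x *\<^sub>R h x \<partial>lebesgue)
      \<longlonglongrightarrow> (\<integral>x. indicator (box a b) x *\<^sub>R h' x \<partial>lebesgue)"
    unfolding eq
  proof (rule integral_dominated_convergence[where w = "\<lambda>x. norm (h' x)"])
    show "integrable lebesgue (\<lambda>x. norm (h' x))"
      using int by (rule integrable_norm)
    show "AE x in lebesgue. (\<lambda>m. box_bump a b m x *\<^sub>R h' x)
        \<longlonglongrightarrow> indicator (box a b) x *\<^sub>R h' x"
      by (rule AE_I2) (intro tendsto_intros box_bump_tendsto_indicator)
    show "AE x in lebesgue. norm (box_bump a b m x *\<^sub>R h' x)
        \<le> norm (h' x)" for m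
      using box_bump_bounds[of a b m]
      by (intro AE_I2) (simp add: mult_left_le_one_le mult.assoc)
  qed (use m in measurable)
  moreover have "(\<integral>x. box_bump a b m x *\<^sub>R h x \<partial>lebesgue) = 0" for m
    using zero[OF box_bump_test_function[OF sub], of m] test_functionD(4)[OF box_bump_test_function[OF sub]]
    by (subst (asm) lebesgue_on_integral_extend(1)[OF \<Omega>s]) auto
  ultimately have "(\<integral>x. indicator (box a b) x *\<^sub>R h' x \<partial>lebesgue) = 0"
    by (simp add: LIMSEQ_const_iff)
  moreover have "(\<integral>x. indicator (box a b) x *\<^sub>R h' x \<partial>lebesgue)
      = (\<integral>x. h' x \<partial>lebesgue)"
  proof (rule integral_cong_AE)
    have "AE x in lebesgue. x \<notin> cbox a b - box a b"
      using negligible_frontier_interval[of a b]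
      by (intro AE_not_in) (simp only: negligible_iff_null_sets)
    then show "AE x in lebesgue. indicator (box a b) x *\<^sub>R h' x
        = h' x"
      by eventually_elim (auto simp: indicator_def h'_def)
  qed (use m in simp_all)
  ultimately show ?thesis by (simp add: h'_def)
qed

text \<open>On each closed box inside the domain the averages over small cubes converge to \<open>h\<close> almost
  everywhere, and all these averages are zero. Countably many closed boxes cover the domain.\<close>

lemma fundamental_lemma_calculus_of_variations:
  fixes h :: "'a::euclidean_space \<Rightarrow> 'b::euclidean_space"
  assumes \<Omega>: "open \<Omega>" and h: "locally_integrable \<Omega> h"
    and zero: "\<And>\<psi>. \<psi> \<in> test_functions \<Omega> \<Longrightarrow> (\<integral>x. \<psi> x *\<^sub>R h x \<partial>lebesgue_on \<Omega>) = 0"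
  shows "AE x in lebesgue_on \<Omega>. h x = 0"
proof -
  have box: "AE x in lebesgue. x \<in> cbox a b \<longrightarrow> h x = 0" if sub: "cbox a b \<subseteq> \<Omega>" for a b
  proof -
    define h' where "h' x = indicator (cbox a b) x *\<^sub>R h x" for x
    have int: "integrable lebesgue h'"
      using h sub compact_cbox unfolding h'_def locally_integrable_def set_integrable_def by blast
    have setint: "set_integrable lebesgue (cbox c d) h'" for c d
      unfolding set_integrable_def by (rule integrable_mult_indicator[OF _ int]) simp
    have cz: "integral (cbox c d) h' = 0" for c d
    proof -
      obtain e f where ef: "cbox c d \<inter> cbox a b = cbox e f" using Int_interval[of c d a b] by blast
      have "integral (cbox c d) h' = (\<integral>x. indicator (cbox c d) x *\<^sub>R h' x \<partial>lebesgue)"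
        using set_lebesgue_integral_eq_integral(2)[OF setint] by (simp add: set_lebesgue_integral_def)
      also have "\<dots> = (\<integral>x. indicator (cbox e f) x *\<^sub>R h x \<partial>lebesgue)"
        unfolding ef[symmetric] h'_def by (simp add: indicator_inter_arith)
      also have "\<dots> = 0"
        by (rule integral_cbox_zero_of_test_functions[OF \<Omega> h zero]) (use ef sub in auto)
      finally show ?thesis .
    qed
    obtain N where N: "negligible N" and lim: "\<And>x e. x \<notin> N \<Longrightarrow> 0 < e \<Longrightarrow>
        \<exists>d>0. \<forall>t. 0 < t \<and> t < d \<longrightarrow> norm (integral (cbox x (x + t *\<^sub>R One)) h' /\<^sub>R t ^ DIM('a) - h' x) < e"
      using integrable_ccontinuous_explicit[of h'] set_lebesgue_integral_eq_integral(1)[OF setint] by blast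
    have "h' x = 0" if x: "x \<notin> N" for x
    proof (rule ccontr)
      assume "h' x \<noteq> 0"
      then have "\<exists>d>0::real. \<forall>t. \<not> (0 < t \<and> t < d)"
        using lim[OF x, of "norm (h' x)"] unfolding cz by simp
      then show False using dense[of "0::real"] by blast
    qed
    moreover have "AE x in lebesgue. x \<notin> N"
      using N by (simp add: negligible_iff_null_sets AE_not_in)
    ultimately have "AE x in lebesgue. h' x = 0" by (auto elim!: eventually_mono)
    then show ?thesis by eventually_elim (auto simp: h'_def)
  qed
  obtain \<D> where D: "countable \<D>" "\<D> \<subseteq> Pow \<Omega>" "\<And>X. X \<in> \<D> \<Longrightarrow> \<exists>a b. X = cbox a b" "\<Union>\<D> = \<Omega>"
    using open_countable_Union_open_cbox[OF \<Omega>] by blast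
  have "AE x in lebesgue. \<forall>X\<in>\<D>. x \<in> X \<longrightarrow> h x = 0"
    unfolding AE_ball_countable[OF D(1)]
  proof
    fix X assume "X \<in> \<D>"
    then obtain a b where "X = cbox a b" "cbox a b \<subseteq> \<Omega>" using D(2,3) by blast
    then show "AE x in lebesgue. x \<in> X \<longrightarrow> h x = 0" using box by simp
  qed
  then have "AE x in lebesgue. x \<in> \<Omega> \<longrightarrow> h x = 0" by eventually_elim (use D(4) in blast)
  then show ?thesis using \<Omega> by (simp add: AE_restrict_space_iff)
qed

lemma test_function_times_locally_integrable:
  fixes h :: "'a::euclidean_space \<Rightarrow> 'b::euclidean_space"
  assumes \<Omega>: "\<Omega> \<in> sets lebesgue" and h: "locally_integrable \<Omega> h" and \<psi>: "\<psi> \<in> test_functions \<Omega>"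
  shows "integrable (lebesgue_on \<Omega>) (\<lambda>x. \<psi> x *\<^sub>R h x)"
proof -
  let ?K = "closure {x. \<psi> x \<noteq> 0}"
  have K: "compact ?K" "?K \<subseteq> \<Omega>" using \<psi> by (auto simp: test_functions_def)
  have int: "integrable lebesgue (\<lambda>x. indicator ?K x *\<^sub>R h x)"
    using h K unfolding locally_integrable_def set_integrable_def by blast
  define h' where "h' x = indicator ?K x *\<^sub>R h x" for x
  have int: "integrable lebesgue h'" using int by (simp add: h'_def[abs_def])
  note [measurable] = borel_measurable_integrable[OF int]
  note c = test_functionD(2)[OF \<psi>]
  have [measurable]: "\<psi> \<in> borel_measurable lebesgue"
    using c by (intro measurable_completion) (simp add: borel_measurable_continuous_onI)
  have "bounded (\<psi> ` ?K)" using K(1) c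
    by (intro compact_imp_bounded compact_continuous_image) (auto intro: continuous_on_subset)
  then obtain B where B: "\<And>x. x \<in> ?K \<Longrightarrow> \<bar>\<psi> x\<bar> \<le> B" unfolding bounded_iff by auto
  have eq: "\<psi> x *\<^sub>R h x = \<psi> x *\<^sub>R h' x" for x
    using closure_subset[THEN subsetD, of x "{x. \<psi> x \<noteq> 0}"] by (cases "\<psi> x = 0") (auto simp: h'_def)
  have "integrable lebesgue (\<lambda>x. \<psi> x *\<^sub>R h x)"
    unfolding eq
  proof (rule Bochner_Integration.integrable_bound[OF integrable_scaleR_right[OF int, of B]])
    show "AE x in lebesgue. norm (\<psi> x *\<^sub>R h' x) \<le> norm (B *\<^sub>R h' x)"
    proof (rule AE_I2)
      fix x
      show "norm (\<psi> x *\<^sub>R h' x) \<le> norm (B *\<^sub>R h' x)"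
        using B[of x] by (auto simp: indicator_def h'_def intro!: mult_right_mono)
    qed
  qed measurable
  then show ?thesis
    using test_functionD(4)[OF \<psi>] by (subst lebesgue_on_integral_extend(2)[OF \<Omega>]) auto
qed

lemma weak_gradient_unique:
  assumes \<Omega>: "open \<Omega>" and "has_weak_gradient \<Omega> u g" "has_weak_gradient \<Omega> u g'"
  shows "AE x in lebesgue_on \<Omega>. g x = g' x"
proof -
  have g: "locally_integrable \<Omega> g" "locally_integrable \<Omega> g'"
    using assms by (auto simp: has_weak_gradient_def)
  have "AE x in lebesgue_on \<Omega>. g x - g' x = 0"
  proof (rule fundamental_lemma_calculus_of_variations[OF \<Omega>])
    show "locally_integrable \<Omega> (\<lambda>x. g x - g' x)"
      using g unfolding locally_integrable_def by (blast intro: set_integral_diff(1))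
    fix \<psi> assume \<psi>: "\<psi> \<in> test_functions \<Omega>"
    have \<Omega>s: "\<Omega> \<in> sets lebesgue" using \<Omega> by simp
    have "(\<integral>x. \<psi> x *\<^sub>R g x \<partial>lebesgue_on \<Omega>) = (\<integral>x. \<psi> x *\<^sub>R g' x \<partial>lebesgue_on \<Omega>)"
      using assms \<psi> unfolding has_weak_gradient_def by (metis neg_equal_iff_equal)
    then show "(\<integral>x. \<psi> x *\<^sub>R (g x - g' x) \<partial>lebesgue_on \<Omega>) = 0"
      using test_function_times_locally_integrable[OF \<Omega>s g(1) \<psi>]
        test_function_times_locally_integrable[OF \<Omega>s g(2) \<psi>]
      by (simp add: scaleR_diff_right)
  qed
  then show ?thesis by simp
qed


section \<open>The subcritical Sobolev inequality\<close>

lemma nn_integral_powr_unit_interval: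
  assumes "-1 < (e::real)"
  shows "(\<integral>\<^sup>+t. ennreal (indicator {0..1} t * t powr e) \<partial>lborel) = ennreal (1 / (e + 1))"
proof -
  have "((\<lambda>t. t powr e) has_integral (1 / (e + 1))) {0..1}"
    using has_integral_powr_from_0[of e 1] assms by simp
  from nn_integral_has_integral_lebesgue[OF _ this] show ?thesis
    by (simp add: nn_integral_completion mult.commute)
qed

lemma nn_integral_affine_image:
  fixes h :: "'a::euclidean_space \<Rightarrow> ennreal"
  assumes [measurable]: "h \<in> borel_measurable borel" and t: "0 < t"
  shows "ennreal (t ^ DIM('a)) * (\<integral>\<^sup>+z. h (x + t *\<^sub>R z) \<partial>lborel) = (\<integral>\<^sup>+z. h z \<partial>lborel)"
  using t
  by (subst (2) lborel_affine[of t x])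
     (simp_all add: nn_integral_density nn_integral_distr nn_integral_cmult)

text \<open>Pairs \<open>(t, z)\<close> of a ray parameter in \<open>[0,1]\<close> with density \<open>t^(-s)\<close> and an offset \<open>z\<close> in the unit ball
  around \<open>c\<close>; the point \<open>x + t z\<close> runs through the rays issuing from \<open>x\<close>. The density is chosen such
  that all weights that occur below are nonnegative powers of \<open>t\<close>, hence bounded.\<close>

definition ray_measure :: "real \<Rightarrow> 'a::euclidean_space \<Rightarrow> (real \<times> 'a) measure" where
  "ray_measure s c = density lborel (\<lambda>t. ennreal (indicator {0..1} t * t powr - s)) \<Otimes>\<^sub>M
     density lborel (\<lambda>z. ennreal (indicator (ball c 1) z))"

lemma sets_ray_measure[measurable_cong]: "sets (ray_measure s c) = sets (borel \<Otimes>\<^sub>M borel)"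
  unfolding ray_measure_def by (intro sets_pair_measure_cong) auto

context
  fixes s :: real and c :: "'a::euclidean_space"
  assumes s: "0 < s" "s < 1"
begin

abbreviation (input) "radial_part \<equiv> density lborel (\<lambda>t. ennreal (indicator {0..1} t * t powr - s))"
abbreviation (input) "offset_part \<equiv> density lborel (\<lambda>z. ennreal (indicator (ball c 1) z))"

lemma finite_radial_part: "finite_measure radial_part"
proof
  show "emeasure radial_part (space radial_part) \<noteq> \<infinity>"
    using nn_integral_powr_unit_interval[of "- s"] s by (simp add: emeasure_density)
qed

lemma emeasure_offset_part: "emeasure offset_part (space offset_part) = emeasure lborel (ball c 1)"
proof -
  have "emeasure offset_part (space offset_part) = (\<integral>\<^sup>+z. ennreal (indicator (ball c 1) z) * indicator (space offset_part) z \<partial>lborel)"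
    by (rule emeasure_density) (auto intro!: borel_measurable_indicator)
  also have "\<dots> = (\<integral>\<^sup>+z. indicator (ball c 1) z \<partial>lborel)"
    by (rule nn_integral_cong) (simp add: ennreal_indicator)
  also have "\<dots> = emeasure lborel (ball c 1)" by simp
  finally show ?thesis .
qed

lemma finite_offset_part: "finite_measure offset_part"
proof
  show "emeasure offset_part (space offset_part) \<noteq> \<infinity>"
    unfolding emeasure_offset_part using emeasure_lborel_ball_finite[of c 1] by auto
qed

lemma pair_sigma_finite_parts: "pair_sigma_finite radial_part offset_part"
  using finite_radial_part finite_offset_part unfolding pair_sigma_finite_def by (simp add: finite_measure.axioms(1))

lemma finite_ray_measure: "finite_measure (ray_measure s c)"
proof
  interpret offset: finite_measure offset_part by (rule finite_offset_part)
  interpret radial: finite_measure radial_part by (rule finite_radial_part)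
  have "emeasure (ray_measure s c) (space (ray_measure s c)) = emeasure radial_part (space radial_part) * emeasure offset_part (space offset_part)"
    unfolding ray_measure_def space_pair_measure by (rule offset.emeasure_pair_measure_Times) auto
  also have "\<dots> \<noteq> \<infinity>" using offset.emeasure_finite radial.emeasure_finite by (simp add: ennreal_mult_eq_top_iff)
  finally show "emeasure (ray_measure s c) (space (ray_measure s c)) \<noteq> \<infinity>" .
qed

lemma ray_integrable:
  fixes g :: "'a \<Rightarrow> real"
  assumes [measurable]: "g \<in> borel_measurable borel" and B: "\<And>x. \<bar>g x\<bar> \<le> B" and e: "0 \<le> e"
  shows "integrable (ray_measure s c) (\<lambda>y. g (x + fst y *\<^sub>R snd y) * fst y powr e)"
proof (rule finite_measure.integrable_const_bound[OF finite_ray_measure, where B = B])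
  show "(\<lambda>y. g (x + fst y *\<^sub>R snd y) * fst y powr e) \<in> borel_measurable (ray_measure s c)" by measurable
  have "AE t in radial_part. t \<in> {0..1}" by (subst AE_density) (auto simp: indicator_def split: if_splits)
  then have "AE t in radial_part. AE z in offset_part. fst (t, z) \<in> {0..1}" by eventually_elim simp
  moreover have "{y \<in> space (radial_part \<Otimes>\<^sub>M offset_part). fst y \<in> {0..1}} \<in> sets (radial_part \<Otimes>\<^sub>M offset_part)" by measurable
  ultimately have "AE y in ray_measure s c. fst y \<in> {0..1}"
    unfolding ray_measure_def by (intro pair_sigma_finite.AE_pair_measure[OF pair_sigma_finite_parts])
  then show "AE y in ray_measure s c. norm (g (x + fst y *\<^sub>R snd y) * fst y powr e) \<le> B"
  proof eventually_elim
    case (elim y)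
    then have "fst y powr e \<le> 1" using e by (auto simp: powr_le1)
    then show ?case using B[of "x + fst y *\<^sub>R snd y"] mult_mono[OF B, of "fst y powr e" 1 "x + fst y *\<^sub>R snd y"]
      by (simp add: abs_mult order_trans[OF abs_ge_zero B])
  qed
qed

text \<open>For fixed \<open>t\<close> the average over the offsets costs a factor \<open>t^(-d)\<close>; the power \<open>t^b\<close> makes it
  integrable near \<open>t = 0\<close> exactly when \<open>b > d - 1\<close>. The bound does not depend on \<open>x\<close>.\<close>

lemma ray_integral_bound:
  fixes g :: "'a \<Rightarrow> real"
  assumes [measurable]: "g \<in> borel_measurable borel" and g: "integrable lborel g" "\<And>x. 0 \<le> g x"
    and B: "\<And>x. \<bar>g x\<bar> \<le> B" and b: "real DIM('a) - 1 < b" "0 \<le> b + s"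
  shows "(\<integral>y. g (x + fst y *\<^sub>R snd y) * fst y powr (b + s) \<partial>ray_measure s c)
    \<le> 1 / (b - real DIM('a) + 1) * (\<integral>x. g x \<partial>lborel)"
proof -
  interpret offset: finite_measure offset_part by (rule finite_offset_part)
  define I where "I = (\<integral>x. g x \<partial>lborel)"
  have I: "0 \<le> I" "(\<integral>\<^sup>+z. ennreal (g z) \<partial>lborel) = ennreal I"
    using g by (simp_all add: I_def nn_integral_eq_integral)
  have inner: "ennreal (indicator {0..1} t * t powr - s) * (\<integral>\<^sup>+z. ennreal (g (x + t *\<^sub>R z) * t powr (b + s)) \<partial>offset_part)
      \<le> ennreal (indicator {0..1} t * t powr (b - real DIM('a))) * ennreal I" for t
  proof (cases "0 < t \<and> t \<le> 1")
    case True
    then have t: "0 < t" by simp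
    have "ennreal (t powr - s) * (\<integral>\<^sup>+z. ennreal (g (x + t *\<^sub>R z) * t powr (b + s)) \<partial>offset_part)
        \<le> ennreal (t powr - s) * (\<integral>\<^sup>+z. ennreal (g (x + t *\<^sub>R z) * t powr (b + s)) \<partial>lborel)"
      by (intro mult_left_mono) (auto simp: nn_integral_density indicator_def intro!: nn_integral_mono)
    also have "\<dots> = ennreal (t powr - s) * ennreal (t powr (b + s)) * (\<integral>\<^sup>+z. ennreal (g (x + t *\<^sub>R z)) \<partial>lborel)"
      using g(2) by (simp add: ennreal_mult nn_integral_multc nn_integral_cmult mult_ac)
    also have "ennreal (t powr - s) * ennreal (t powr (b + s)) = ennreal (t powr (b - real DIM('a))) * ennreal (t ^ DIM('a))"
      using t by (simp flip: ennreal_mult powr_add powr_realpow)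
    also have "\<dots> * (\<integral>\<^sup>+z. ennreal (g (x + t *\<^sub>R z)) \<partial>lborel) = ennreal (t powr (b - real DIM('a))) * ennreal I"
      using nn_integral_affine_image[of "\<lambda>z. ennreal (g z)" t x] t I(2) by (simp add: mult.assoc)
    finally show ?thesis using True by (simp add: indicator_def)
  qed (auto simp: indicator_def not_less le_less)
  have "ennreal (\<integral>y. g (x + fst y *\<^sub>R snd y) * fst y powr (b + s) \<partial>ray_measure s c)
      = (\<integral>\<^sup>+y. ennreal (g (x + fst y *\<^sub>R snd y) * fst y powr (b + s)) \<partial>ray_measure s c)"
    using ray_integrable[OF assms(1) B b(2)] g(2) by (simp add: nn_integral_eq_integral)
  also have "\<dots> = (\<integral>\<^sup>+t. (\<integral>\<^sup>+z. ennreal (g (x + t *\<^sub>R z) * t powr (b + s)) \<partial>offset_part) \<partial>radial_part)"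
    unfolding ray_measure_def by (subst offset.nn_integral_fst[symmetric]) auto
  also have "\<dots> = (\<integral>\<^sup>+t. ennreal (indicator {0..1} t * t powr - s) *
      (\<integral>\<^sup>+z. ennreal (g (x + t *\<^sub>R z) * t powr (b + s)) \<partial>offset_part) \<partial>lborel)"
    by (subst nn_integral_density) (auto intro!: offset.borel_measurable_nn_integral)
  also have "\<dots> \<le> (\<integral>\<^sup>+t. ennreal (indicator {0..1} t * t powr (b - real DIM('a))) * ennreal I \<partial>lborel)"
    by (intro nn_integral_mono inner)
  also have "\<dots> = ennreal (1 / (b - real DIM('a) + 1)) * ennreal I"
    using b by (simp add: nn_integral_multc nn_integral_powr_unit_interval)
  also have "\<dots> = ennreal (1 / (b - real DIM('a) + 1) * I)" 
    using I b by (intro ennreal_mult[symmetric]) auto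
  finally show ?thesis unfolding I_def[symmetric] using I b by (subst (asm) ennreal_le_iff) auto
qed

text \<open>Integrated over \<open>x\<close>, each translate contributes the same amount.\<close>

lemma ray_integral_total:
  fixes g :: "'a \<Rightarrow> real"
  assumes [measurable]: "g \<in> borel_measurable borel" and g: "integrable lborel g" "\<And>x. 0 \<le> g x"
    and B: "\<And>x. \<bar>g x\<bar> \<le> B"
  shows "(\<integral>\<^sup>+x. ennreal (\<integral>y. g (x + fst y *\<^sub>R snd y) \<partial>ray_measure s c) \<partial>lborel)
    = ennreal (measure (ray_measure s c) (space (ray_measure s c)) * (\<integral>x. g x \<partial>lborel))"
proof -
  interpret M: finite_measure "ray_measure s c" by (rule finite_ray_measure)
  interpret P: pair_sigma_finite "lborel :: 'a measure" "ray_measure s c" ..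
  have "integrable (ray_measure s c) (\<lambda>y. g (x + fst y *\<^sub>R snd y))" for x
    by (rule M.integrable_const_bound[where B = B]) (use B in auto)
  then have "(\<integral>\<^sup>+x. ennreal (\<integral>y. g (x + fst y *\<^sub>R snd y) \<partial>ray_measure s c) \<partial>lborel)
      = (\<integral>\<^sup>+x. (\<integral>\<^sup>+y. ennreal (g (x + fst y *\<^sub>R snd y)) \<partial>ray_measure s c) \<partial>lborel)"
    using g(2) by (simp add: nn_integral_eq_integral)
  also have "\<dots> = (\<integral>\<^sup>+y. (\<integral>\<^sup>+x. ennreal (g (x + fst y *\<^sub>R snd y)) \<partial>lborel) \<partial>ray_measure s c)"
    by (rule P.Fubini'[symmetric]) simp
  also have "\<dots> = (\<integral>\<^sup>+y. ennreal (\<integral>x. g x \<partial>lborel) \<partial>ray_measure s c)"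
  proof (rule nn_integral_cong)
    fix y
    show "(\<integral>\<^sup>+x. ennreal (g (x + fst y *\<^sub>R snd y)) \<partial>lborel) = ennreal (\<integral>x. g x \<partial>lborel)"
      using nn_integral_affine_image[of "\<lambda>z. ennreal (g z)" 1 "fst y *\<^sub>R snd y"] g
      by (simp add: nn_integral_eq_integral add.commute)
  qed
  also have "\<dots> = ennreal (measure (ray_measure s c) (space (ray_measure s c)) * (\<integral>x. g x \<partial>lborel))"
    using g by (simp add: M.emeasure_eq_measure ennreal_mult' mult.commute)
  finally show ?thesis .
qed

text \<open>The fundamental theorem of calculus on the segments from \<open>x\<close> to \<open>x + z\<close>, averaged over the
  offsets \<open>z\<close> in the ball. The factor \<open>t^s\<close> undoes the density of the measure.\<close>

lemma ray_representation:
  fixes f :: "'a \<Rightarrow> real"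
  assumes f: "\<And>x. GDERIV f x :> G x" and G: "continuous_on UNIV G" "\<And>x. norm (G x) \<le> B"
    and K: "\<And>z. z \<in> ball c 1 \<Longrightarrow> norm z \<le> K" and zero: "\<And>z. z \<in> ball c 1 \<Longrightarrow> f (x + z) = 0"
  shows "measure lborel (ball c 1) * \<bar>f x\<bar>
    \<le> K * (\<integral>y. norm (G (x + fst y *\<^sub>R snd y)) * fst y powr s \<partial>ray_measure s c)"
proof -
  interpret P: pair_sigma_finite radial_part offset_part by (rule pair_sigma_finite_parts)
  interpret offset: finite_measure offset_part by (rule finite_offset_part)
  have [measurable]: "G \<in> borel_measurable borel" using G(1) by (simp add: borel_measurable_continuous_onI)
  have int: "integrable (radial_part \<Otimes>\<^sub>M offset_part) (\<lambda>(t, z). norm (G (x + t *\<^sub>R z)) * t powr s)"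
    using ray_integrable[of "\<lambda>x. norm (G x)" B s x] G s
    by (simp add: ray_measure_def case_prod_beta')
  have K0: "0 \<le> K" using order_trans[OF norm_ge_zero K[of c]] by simp
  have path: "\<bar>f x\<bar> \<le> K * (\<integral>t. norm (G (x + t *\<^sub>R z)) * t powr s \<partial>radial_part)" if z: "z \<in> ball c 1" for z
  proof -
    have Gz: "continuous_on UNIV (\<lambda>t. G (x + t *\<^sub>R z))"
      by (intro continuous_on_compose2[OF G(1)] continuous_intros) auto
    have der: "((\<lambda>t. f (x + t *\<^sub>R z)) has_real_derivative z \<bullet> G (x + t *\<^sub>R z)) (at t)" for t
    proof -
      have "((\<lambda>t. x + t *\<^sub>R z) has_derivative (\<lambda>t. t *\<^sub>R z)) (at t)"
        by (auto intro!: derivative_eq_intros)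
      moreover have "(f has_derivative (\<lambda>k. k \<bullet> G (x + t *\<^sub>R z))) (at (x + t *\<^sub>R z))" using f by (simp add: gderiv_def)
      ultimately have "((\<lambda>t. f (x + t *\<^sub>R z)) has_derivative (\<lambda>h. (h *\<^sub>R z) \<bullet> G (x + t *\<^sub>R z))) (at t)"
        using has_derivative_compose by fast
      moreover have "(\<lambda>h. (h *\<^sub>R z) \<bullet> G (x + t *\<^sub>R z)) = (*) (z \<bullet> G (x + t *\<^sub>R z))" by auto
      ultimately show ?thesis by (simp add: has_field_derivative_def)
    qed
    have "(\<integral>t. (z \<bullet> G (x + t *\<^sub>R z)) * indicator {0..1} t \<partial>lborel) = f (x + 1 *\<^sub>R z) - f (x + 0 *\<^sub>R z)"
      by (rule integral_FTC_Icc_real[OF _ der])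
        (auto intro!: continuous_intros continuous_on_subset[OF Gz] simp: continuous_on_eq_continuous_at[symmetric] intro: continuous_on_interior[OF Gz])
    then have "\<bar>f x\<bar> = \<bar>\<integral>t. (z \<bullet> G (x + t *\<^sub>R z)) * indicator {0..1} t \<partial>lborel\<bar>" using zero[OF z] by simp
    also have "\<dots> \<le> (\<integral>t. \<bar>(z \<bullet> G (x + t *\<^sub>R z)) * indicator {0..1} t\<bar> \<partial>lborel)" by (rule integral_abs_bound)
    also have "\<dots> \<le> (\<integral>t. K * (norm (G (x + t *\<^sub>R z)) * indicator {0..1} t) \<partial>lborel)"
    proof (rule integral_mono_AE')
      have "set_integrable lborel {0..1} (\<lambda>t. norm (G (x + t *\<^sub>R z)))"
        unfolding set_integrable_def
        by (intro borel_integrable_compact continuous_on_norm continuous_on_subset[OF Gz]) auto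
      then show "integrable lborel (\<lambda>t. K * (norm (G (x + t *\<^sub>R z)) * indicator {0..1} t))"
        by (simp add: set_integrable_def mult.commute)
      show "AE t in lborel. \<bar>(z \<bullet> G (x + t *\<^sub>R z)) * indicator {0..1} t\<bar> \<le> K * (norm (G (x + t *\<^sub>R z)) * indicator {0..1} t)"
      proof (rule AE_I2)
        fix t
        have "\<bar>z \<bullet> G (x + t *\<^sub>R z)\<bar> \<le> norm z * norm (G (x + t *\<^sub>R z))" by (rule Cauchy_Schwarz_ineq2)
        also have "\<dots> \<le> K * norm (G (x + t *\<^sub>R z))" using K[OF z] by (intro mult_right_mono) auto
        finally show "\<bar>(z \<bullet> G (x + t *\<^sub>R z)) * indicator {0..1} t\<bar> \<le> K * (norm (G (x + t *\<^sub>R z)) * indicator {0..1} t)"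
          by (auto simp: indicator_def)
      qed
      show "AE t in lborel. 0 \<le> K * (norm (G (x + t *\<^sub>R z)) * indicator {0..1} t)" using K0 by simp
    qed
    also have "\<dots> = K * (\<integral>t. norm (G (x + t *\<^sub>R z)) * indicator {0..1} t \<partial>lborel)" by simp
    also have "(\<integral>t. norm (G (x + t *\<^sub>R z)) * indicator {0..1} t \<partial>lborel) = (\<integral>t. norm (G (x + t *\<^sub>R z)) * t powr s \<partial>radial_part)"
    proof -
      have "(\<integral>t. norm (G (x + t *\<^sub>R z)) * t powr s \<partial>radial_part)
          = (\<integral>t. (indicator {0..1} t * t powr - s) *\<^sub>R (norm (G (x + t *\<^sub>R z)) * t powr s) \<partial>lborel)"
        by (rule integral_density) auto
      also have "\<dots> = (\<integral>t. norm (G (x + t *\<^sub>R z)) * indicator {0..1} t \<partial>lborel)"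
      proof (rule integral_cong_AE)
        show "AE t in lborel. (indicator {0..1} t * t powr - s) *\<^sub>R (norm (G (x + t *\<^sub>R z)) * t powr s)
          = norm (G (x + t *\<^sub>R z)) * indicator {0..1} t"
          using AE_lborel_singleton[of 0]
          by eventually_elim (auto simp: indicator_def powr_minus)
      qed measurable
      finally show ?thesis by simp
    qed
    finally show ?thesis .
  qed
  have AE_offset: "AE z in offset_part. z \<in> ball c 1" by (subst AE_density) (auto simp: indicator_def split: if_splits)
  have "measure lborel (ball c 1) * \<bar>f x\<bar> = (\<integral>z. \<bar>f x\<bar> \<partial>offset_part)"
    using emeasure_offset_part by (simp add: measure_def)
  also have "\<dots> \<le> (\<integral>z. K * (\<integral>t. norm (G (x + t *\<^sub>R z)) * t powr s \<partial>radial_part) \<partial>offset_part)"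
  proof (rule integral_mono_AE)
    show "integrable offset_part (\<lambda>z. K * (\<integral>t. norm (G (x + t *\<^sub>R z)) * t powr s \<partial>radial_part))"
      using P.integrable_snd[OF int] by simp
    show "AE z in offset_part. \<bar>f x\<bar> \<le> K * (\<integral>t. norm (G (x + t *\<^sub>R z)) * t powr s \<partial>radial_part)"
      using AE_offset by eventually_elim (rule path)
  qed simp
  also have "\<dots> = K * (\<integral>z. (\<integral>t. norm (G (x + t *\<^sub>R z)) * t powr s \<partial>radial_part) \<partial>offset_part)" by simp
  also have "(\<integral>z. (\<integral>t. norm (G (x + t *\<^sub>R z)) * t powr s \<partial>radial_part) \<partial>offset_part)
      = (\<integral>y. norm (G (x + fst y *\<^sub>R snd y)) * fst y powr s \<partial>ray_measure s c)"
    using P.integral_snd[OF int] by (simp add: ray_measure_def case_prod_beta')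
  finally show ?thesis .
qed

end

text \<open>The Sobolev inequality in the subcritical range, on a bounded set. All rays from points of
  \<open>\<Omega>\<close> to a far away translate of the unit ball end outside of \<open>\<Omega>\<close>, so \<open>|\<phi>(x)|\<close> is at most a
  constant times the average \<open>F(x)\<close> of \<open>g = |\<nabla>\<phi>|\<close> along these rays. Hoelder's inequality bounds \<open>F\<close> by a product of
  \<open>Ga^(1/q)\<close> and \<open>Gb^(1/2 - 1/q)\<close>, two averages of \<open>g\<^sup>2\<close> with different weights in the ray parameter
  \<open>t\<close>: the first is cheap to integrate over \<open>x\<close>, the second is bounded uniformly in \<open>x\<close>. The exponents
  of \<open>t\<close> can be balanced precisely below the critical exponent. This replaces Young's convolution
  inequality for the Riesz kernel \<open>|x|^(1-d)\<close> and treats all dimensions alike.\<close>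

lemma Sobolev_test_functions:
  fixes \<Omega> :: "'a::euclidean_space set"
  assumes bdd: "bounded \<Omega>" and q: "2 < q" "(real DIM('a) - 2) * q < 2 * real DIM('a)"
  obtains C where "0 \<le> C" "\<And>\<phi>. \<phi> \<in> test_functions \<Omega> \<Longrightarrow>
    (\<integral>\<^sup>+x. ennreal (\<bar>\<phi> x\<bar> powr q) \<partial>lborel) \<le> ennreal (C * (\<integral>x. (norm (gradient \<phi> x))\<^sup>2 \<partial>lborel) powr (q / 2))"
proof -
  (* The unit ball around c is so far away that x + z lies outside of the ball of radius R
     whenever x lies in it and z is an offset. *)
  obtain R where R: "0 < R" "\<Omega> \<subseteq> cball 0 R"
    using bdd unfolding bounded_pos by (auto simp: subset_iff)
  define c :: 'a where "c = (2 * R + 2) *\<^sub>R (SOME i. i \<in> Basis)"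
  have nc: "norm c = 2 * R + 2"
    using R(1) SOME_Basis unfolding c_def by simp
  define K where "K = 2 * R + 3"
  have ball_c: "2 * R + 1 < norm z" "norm z \<le> K" if "z \<in> ball c 1" for z
    using that norm_triangle_ineq3[of c z] nc unfolding K_def by (auto simp: dist_norm)
  (* The one place where the exponent has to be subcritical: the lower bound makes the weight
     t^b integrable against t^(-d), the upper bound gives s < 1. *)
  have "real DIM('a) - 1 < (q + 2) / (q - 2)"
    using q by (simp add: field_simps)
  then obtain b where b: "real DIM('a) - 1 < b" "b < (q + 2) / (q - 2)" using dense by blast
  have "1 \<le> real DIM('a)" using DIM_positive[where 'a='a] by linarith
  then have b0: "0 < b" using b(1) by linarith
  define s where "s = b * (q - 2) / (q + 2)"
  have s: "0 < s" "s < 1" using b b0 q unfolding s_def by (auto simp: field_simps)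
  (* The powers of t in the interpolation of F between Ga and Gb match. *)
  have bs: "(b + s) * ((q - 2) / (2 * q)) = s"
  proof -
    have "b * (q - 2) = s * (q + 2)" using q unfolding s_def by simp
    then have "(b + s) * (q - 2) = s * (2 * q)" by (simp add: algebra_simps)
    then show ?thesis using q by (simp add: field_simps)
  qed
  interpret M: finite_measure "ray_measure s c" by (rule finite_ray_measure[OF s])
  define m where "m = measure (ray_measure s c) (space (ray_measure s c))"
  define w where "w = measure lborel (ball c 1)"
  have w: "0 < w" unfolding w_def using content_ball_pos[of 1 c] by simp
  define D where "D = 1 / (b - real DIM('a) + 1)"
  have D: "0 < D" using b unfolding D_def by simp
  have m: "0 \<le> m" unfolding m_def by simp
  have K: "0 < K" using R unfolding K_def by simp
  define C where "C = (K / w) powr q * m powr (q / 2) * D powr (q / 2 - 1) * m"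
  have "(\<integral>\<^sup>+x. ennreal (\<bar>\<phi> x\<bar> powr q) \<partial>lborel)
      \<le> ennreal (C * (\<integral>x. (norm (gradient \<phi> x))\<^sup>2 \<partial>lborel) powr (q / 2))"
    if \<phi>: "\<phi> \<in> test_functions \<Omega>" for \<phi>
  proof -
    define g where "g x = norm (gradient \<phi> x)" for x
    note cont = test_functionD(3)[OF \<phi>]
    have supp: "gradient \<phi> x = 0" if "x \<notin> cball 0 R" for x
      using test_functionD(5)[OF \<phi>] that R(2) by blast
    obtain B where B: "0 \<le> B" "\<And>x. norm (gradient \<phi> x) \<le> B"
      using continuous_compact_support_bounded[OF cont supp] by blast
    have gc: "continuous_on UNIV g" "continuous_on UNIV (\<lambda>x. (g x)\<^sup>2)"
      unfolding g_def by (intro continuous_intros cont)+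
    then have [measurable]: "g \<in> borel_measurable borel" by (simp add: borel_measurable_continuous_onI)
    have g0: "0 \<le> g x" "g x \<le> B" for x using B by (simp_all add: g_def)
    have g2: "\<bar>(g x)\<^sup>2\<bar> \<le> B\<^sup>2" for x using g0 by (simp add: power_mono)
    have g2_int: "integrable lborel (\<lambda>x. (g x)\<^sup>2)"
      using supp by (intro continuous_compact_support_integrable[OF gc(2)]) (auto simp: g_def)
    define I where "I = (\<integral>x. (g x)\<^sup>2 \<partial>lborel)"
    have I0: "0 \<le> I" unfolding I_def by simp
    define Ga where "Ga x = (\<integral>y. (g (x + fst y *\<^sub>R snd y))\<^sup>2 \<partial>ray_measure s c)" for x
    define Gb where "Gb x = (\<integral>y. (g (x + fst y *\<^sub>R snd y))\<^sup>2 * fst y powr (b + s) \<partial>ray_measure s c)" for x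
    define F where "F x = (\<integral>y. g (x + fst y *\<^sub>R snd y) * fst y powr s \<partial>ray_measure s c)" for x
    have Ga0: "0 \<le> Ga x" and Gb0: "0 \<le> Gb x" and F0: "0 \<le> F x" for x
      unfolding Ga_def Gb_def F_def using g0 by (auto intro!: Bochner_Integration.integral_nonneg)
    have Gb: "Gb x \<le> D * I" for x
      unfolding Gb_def D_def I_def
      by (rule ray_integral_bound[OF s]) (use g2_int g2 b b0 s in auto)
    have \<phi>F: "w * \<bar>\<phi> x\<bar> \<le> K * F x" for x
    proof (cases "x \<in> \<Omega>")
      case True
      show ?thesis unfolding w_def F_def g_def
      proof (rule ray_representation[OF s test_functionD(1)[OF \<phi>] cont B(2) ball_c(2)])
        fix z assume "z \<in> ball c 1"
        then have "R < norm (x + z)"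
          using ball_c(1)[of z] R True norm_triangle_ineq4[of "x + z" x] by (auto simp: subset_iff)
        then show "\<phi> (x + z) = 0" using R(2) by (intro test_functionD(4)[OF \<phi>]) auto
      qed
    next
      case False
      then show ?thesis using test_functionD(4)[OF \<phi> False] K F0[of x] by simp
    qed
    have FG: "F x \<le> m powr (1/2) * (Ga x powr (1 / q) * Gb x powr ((q - 2) / (2 * q)))" for x
    proof -
      define A where "A y = (g (x + fst y *\<^sub>R snd y))\<^sup>2" for y :: "real \<times> 'a"
      define A' where "A' y = A y * fst y powr (b + s)" for y :: "real \<times> 'a"
      have A: "integrable (ray_measure s c) A"
        unfolding A_def by (rule M.integrable_const_bound[where B = "B\<^sup>2"]) (use g2 in auto)
      have A': "integrable (ray_measure s c) A'"
        unfolding A'_def A_def by (rule ray_integrable[OF s]) (use g2 b0 s in auto)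
      have pos: "0 \<le> A y" "0 \<le> A' y" for y by (simp_all add: A_def A'_def)
      note H = Hoelder_integral[of "2 / q" "(q - 2) / q" "ray_measure s c" A A', OF _ _ _ A pos(1) A' pos(2)]
      define h where "h y = A y powr (2 / q) * A' y powr ((q - 2) / q)" for y
      have h: "integrable (ray_measure s c) h" "(\<integral>y. h y \<partial>ray_measure s c) \<le> Ga x powr (2 / q) * Gb x powr ((q - 2) / q)"
        unfolding h_def Ga_def Gb_def A_def[symmetric] A'_def[symmetric]
        by (rule H; use q in \<open>simp add: field_simps\<close>)+
      have h0: "0 \<le> h y" for y by (simp add: h_def)
      have eq: "g (x + fst y *\<^sub>R snd y) * fst y powr s = h y powr (1/2) * 1 powr (1/2)" for y
      proof -
        let ?g = "g (x + fst y *\<^sub>R snd y)"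
        have "h y powr (1/2) = (?g\<^sup>2) powr (1 / q) * (?g\<^sup>2) powr ((q - 2) / (2 * q)) * fst y powr ((b + s) * ((q - 2) / (2 * q)))"
          by (simp add: h_def A_def A'_def powr_mult powr_powr mult.commute[of q 2])
        also have "(?g\<^sup>2) powr (1 / q) * (?g\<^sup>2) powr ((q - 2) / (2 * q)) = (?g\<^sup>2) powr (1/2)"
          using q by (simp add: field_simps flip: powr_add)
        also have "\<dots> = ?g" using g0(1) by (simp add: powr_half_sqrt)
        finally show ?thesis unfolding bs by simp
      qed
      have "F x = (\<integral>y. h y powr (1/2) * 1 powr (1/2) \<partial>ray_measure s c)"
        unfolding F_def eq ..
      also have "\<dots> \<le> (\<integral>y. h y \<partial>ray_measure s c) powr (1/2) * (\<integral>y. 1 \<partial>ray_measure s c) powr (1/2)"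
        by (rule Hoelder_integral(2)[OF _ _ _ h(1) h0]) auto
      also have "\<dots> = (\<integral>y. h y \<partial>ray_measure s c) powr (1/2) * m powr (1/2)" by (simp add: m_def)
      also have "\<dots> \<le> (Ga x powr (2 / q) * Gb x powr ((q - 2) / q)) powr (1/2) * m powr (1/2)"
        using h h0 by (intro mult_right_mono powr_mono2 Bochner_Integration.integral_nonneg) auto
      also have "\<dots> = m powr (1/2) * (Ga x powr (1 / q) * Gb x powr ((q - 2) / (2 * q)))"
        by (simp add: powr_mult powr_powr mult.commute[of q 2])
      finally show ?thesis .
    qed
    (* Raise the interpolation inequality to the power q; only Ga still depends on x. *)
    define E where "E = (K / w) powr q * m powr (q / 2) * (D * I) powr (q / 2 - 1)"
    have pt: "\<bar>\<phi> x\<bar> powr q \<le> E * Ga x" for x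
    proof -
      have "\<bar>\<phi> x\<bar> \<le> (K / w) * F x" using \<phi>F[of x] w by (simp add: field_simps)
      also have "\<dots> \<le> (K / w) * (m powr (1/2) * (Ga x powr (1 / q) * Gb x powr ((q - 2) / (2 * q))))"
        using FG K w by (intro mult_left_mono) auto
      finally have "\<bar>\<phi> x\<bar> powr q \<le> ((K / w) * (m powr (1/2) * (Ga x powr (1 / q) * Gb x powr ((q - 2) / (2 * q))))) powr q"
        using q by (intro powr_mono2) auto
      also have "\<dots> = (K / w) powr q * (m powr (q / 2) * (Ga x * Gb x powr (q / 2 - 1)))"
      proof -
        have split: "(k * (u * (v * v'))) powr q = k powr q * (u powr q * (v powr q * v' powr q))"
          if "0 \<le> k" "0 \<le> u" "0 \<le> v" "0 \<le> v'" for k u v v'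
          using that by (simp add: powr_mult)
        have "Gb x powr ((q - 2) / 2) = Gb x powr (q / 2 - 1)" by (simp add: diff_divide_distrib)
        then show ?thesis using q K w Ga0[of x] by (subst split) (simp_all add: powr_powr)
      qed
      also have "\<dots> \<le> (K / w) powr q * (m powr (q / 2) * (Ga x * (D * I) powr (q / 2 - 1)))"
        using q Gb[of x] Gb0[of x] Ga0[of x] by (intro mult_left_mono powr_mono2) auto
      finally show ?thesis by (simp add: E_def mult_ac)
    qed
    have E0: "0 \<le> E" by (simp add: E_def)
    have [measurable]: "Ga \<in> borel_measurable borel" unfolding Ga_def[abs_def] by measurable
    have "(\<integral>\<^sup>+x. ennreal (\<bar>\<phi> x\<bar> powr q) \<partial>lborel) \<le> (\<integral>\<^sup>+x. ennreal E * ennreal (Ga x) \<partial>lborel)"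
      using pt E0 Ga0 by (intro nn_integral_mono) (simp add: ennreal_leI flip: ennreal_mult)
    also have "\<dots> = ennreal E * (\<integral>\<^sup>+x. ennreal (Ga x) \<partial>lborel)" by (rule nn_integral_cmult) simp
    also have "(\<integral>\<^sup>+x. ennreal (Ga x) \<partial>lborel) = ennreal (m * I)"
      unfolding Ga_def m_def I_def by (rule ray_integral_total[OF s]) (use g2_int g2 in auto)
    also have "ennreal E * ennreal (m * I) = ennreal (E * (m * I))"
      using E0 m I0 by (intro ennreal_mult[symmetric]) auto
    also have "E * (m * I) = C * I powr (q / 2)"
    proof -
      have "I powr (q / 2 - 1) * I = I powr (q / 2)"
        using I0 q powr_add[of I "q / 2 - 1" 1] by simp
      then show ?thesis using D I0 by (simp add: E_def C_def powr_mult mult_ac)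
    qed
    finally show ?thesis by (simp add: I_def g_def)
  qed
  moreover have "0 \<le> C" using m by (simp add: C_def)
  ultimately show ?thesis using that by blast
qed


section \<open>The Sobolev space as a closed subspace of a Hilbert space\<close>

lemma L2_scaleR_integrable:
  fixes u :: "'a::euclidean_space \<Rightarrow> real" and F :: "'a \<Rightarrow> 'b::euclidean_space"
  assumes "u \<in> L2_space \<Omega>" "F \<in> L2_space \<Omega>"
  shows "integrable (lebesgue_on \<Omega>) (\<lambda>x. u x *\<^sub>R F x)"
proof (rule Bochner_Integration.integrable_bound)
  note [measurable] = assms[THEN L2_spaceD(1)]
  have n: "(\<lambda>x. \<bar>u x\<bar>) \<in> L2_space \<Omega>" "(\<lambda>x. norm (F x)) \<in> L2_space \<Omega>"
    using assms by (auto simp: L2_space_def)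
  show "integrable (lebesgue_on \<Omega>) (\<lambda>x. \<bar>u x\<bar> \<bullet> norm (F x))"
    by (rule L2_space_inner_integrable[OF n])
  show "(\<lambda>x. u x *\<^sub>R F x) \<in> borel_measurable (lebesgue_on \<Omega>)" by measurable
  show "AE x in lebesgue_on \<Omega>. norm (u x *\<^sub>R F x) \<le> norm (\<bar>u x\<bar> \<bullet> norm (F x))" by simp
qed

lemma L2_space_Pair_iff:
  fixes f :: "'a::euclidean_space \<Rightarrow> 'b::euclidean_space" and g :: "'a \<Rightarrow> 'c::euclidean_space"
  shows "(\<lambda>x. (f x, g x)) \<in> L2_space \<Omega> \<longleftrightarrow> f \<in> L2_space \<Omega> \<and> g \<in> L2_space \<Omega>"
proof
  assume L: "(\<lambda>x. (f x, g x)) \<in> L2_space \<Omega>"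
  note [measurable] = L2_spaceD(1)[OF L]
  have "(\<lambda>x. fst (f x, g x)) \<in> borel_measurable (lebesgue_on \<Omega>)"
    "(\<lambda>x. snd (f x, g x)) \<in> borel_measurable (lebesgue_on \<Omega>)"
    using measurable_compose[OF L2_spaceD(1)[OF L]
        borel_measurable_continuous_onI[OF continuous_on_fst[OF continuous_on_id]]]
      measurable_compose[OF L2_spaceD(1)[OF L]
        borel_measurable_continuous_onI[OF continuous_on_snd[OF continuous_on_id]]] by simp_all
  then have [measurable]: "f \<in> borel_measurable (lebesgue_on \<Omega>)" "g \<in> borel_measurable (lebesgue_on \<Omega>)"
    by simp_all
  have "integrable (lebesgue_on \<Omega>) (\<lambda>x. (norm (f x))\<^sup>2)" "integrable (lebesgue_on \<Omega>) (\<lambda>x. (norm (g x))\<^sup>2)"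
    by (rule Bochner_Integration.integrable_bound[OF L2_spaceD(2)[OF L]]; simp add: norm_Pair)+
  then show "f \<in> L2_space \<Omega> \<and> g \<in> L2_space \<Omega>" by (simp add: L2_space_def)
next
  assume "f \<in> L2_space \<Omega> \<and> g \<in> L2_space \<Omega>"
  then show "(\<lambda>x. (f x, g x)) \<in> L2_space \<Omega>"
    by (auto simp: L2_space_def norm_Pair intro!: borel_measurable_Pair)
qed

text \<open>Lebesgue measure is complete, so a function equal almost everywhere to a measurable one is
  measurable.\<close>

lemma L2_space_AE_cong:
  assumes \<Omega>: "\<Omega> \<in> sets lebesgue" and f: "f \<in> L2_space \<Omega>" and eq: "AE x in lebesgue_on \<Omega>. f x = g x"
  shows "g \<in> L2_space \<Omega>"
proof -
  have "(\<lambda>x. if x \<in> \<Omega> then g x else 0) \<in> borel_measurable lebesgue"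
  proof (rule borel_measurable_AE)
    show "(\<lambda>x. if x \<in> \<Omega> then f x else 0) \<in> borel_measurable lebesgue"
      using L2_spaceD(1)[OF f] \<Omega> by (simp add: borel_measurable_if)
    show "AE x in lebesgue. (if x \<in> \<Omega> then f x else 0) = (if x \<in> \<Omega> then g x else 0)"
      using eq \<Omega> by (auto simp: AE_restrict_space_iff elim!: eventually_mono)
  qed
  then have g[measurable]: "g \<in> borel_measurable (lebesgue_on \<Omega>)"
    using \<Omega> by (simp add: borel_measurable_if)
  note [measurable] = L2_spaceD(1)[OF f]
  have "integrable (lebesgue_on \<Omega>) (\<lambda>x. (norm (g x))\<^sup>2)"
    by (rule integrable_cong_AE_imp[OF L2_spaceD(2)[OF f]]) (use eq in \<open>auto elim!: eventually_mono\<close>)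
  with g show ?thesis by (simp add: L2_space_def)
qed

lemma sq_norm_AE_cong:
  assumes "f \<in> L2_space \<Omega>" "g \<in> L2_space \<Omega>" "AE x in lebesgue_on \<Omega>. f x = g x"
  shows "sq_norm \<Omega> f = sq_norm \<Omega> g"
  using assms(1,2)[THEN L2_spaceD(1)] assms(3)
  by (intro integral_cong_AE) (auto elim!: eventually_mono)

text \<open>The closure in \<open>L\<^sup>2\<close> of the pairs of a test function and its gradient. Pairs make the \<open>H\<^sup>1\<close> inner
  product an \<open>L\<^sup>2\<close> inner product of functions with values in a Euclidean space.\<close>

definition H10_graph :: "'a::euclidean_space set \<Rightarrow> ('a \<Rightarrow> real \<times> 'a) set" where
  "H10_graph \<Omega> = {U \<in> L2_space \<Omega>. \<exists>\<phi>. (\<forall>n::nat. \<phi> n \<in> test_functions \<Omega>) \<and>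
     (\<lambda>n. sq_norm \<Omega> (\<lambda>x. (\<phi> n x, gradient (\<phi> n) x) - U x)) \<longlonglongrightarrow> 0}"

abbreviation with_gradient :: "'a::euclidean_space set \<Rightarrow> ('a \<Rightarrow> real) \<Rightarrow> 'a \<Rightarrow> real \<times> 'a" where
  "with_gradient \<Omega> u \<equiv> \<lambda>x. (u x, weak_gradient \<Omega> u x)"

lemma H1_inner_eq: "H1_inner \<Omega> u v = (\<integral>x. with_gradient \<Omega> u x \<bullet> with_gradient \<Omega> v x \<partial>lebesgue_on \<Omega>)"
  by (simp add: H1_inner_def)

lemma H1_inner_self: "H1_inner \<Omega> u u = sq_norm \<Omega> (with_gradient \<Omega> u)"
  by (simp only: H1_inner_eq power2_norm_eq_inner)

lemma H1_norm_sq: "(H1_norm \<Omega> u)\<^sup>2 = sq_norm \<Omega> (with_gradient \<Omega> u)"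
proof -
  have "0 \<le> sq_norm \<Omega> (with_gradient \<Omega> u)" by (rule Bochner_Integration.integral_nonneg) simp
  then show ?thesis by (simp only: H1_norm_def H1_inner_self real_sqrt_pow2)
qed

locale bounded_open =
  fixes \<Omega> :: "'a::euclidean_space set"
  assumes open_\<Omega>: "open \<Omega>" and bounded_\<Omega>: "bounded \<Omega>"
begin

lemma sets_\<Omega>: "\<Omega> \<in> sets lebesgue"
  using open_\<Omega> by simp

lemma finite_measure_\<Omega>: "finite_measure (lebesgue_on \<Omega>)"
  using open_\<Omega> bounded_\<Omega> by (intro finite_measure_lebesgue_on) (simp add: bounded_set_imp_lmeasurable)

lemma L2_locally_integrable:
  fixes f :: "'a \<Rightarrow> 'b::euclidean_space"
  assumes "f \<in> L2_space \<Omega>"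
  shows "locally_integrable \<Omega> f"
  unfolding locally_integrable_def
proof (intro allI impI)
  fix K assume K: "compact K \<and> K \<subseteq> \<Omega>"
  have "set_integrable lebesgue \<Omega> f"
    using L2_finite_L1(1)[OF finite_measure_\<Omega> assms] sets_\<Omega>
    by (simp add: set_integrable_def integrable_restrict_space)
  then show "set_integrable lebesgue K f"
    by (rule set_integrable_subset) (use K in \<open>auto simp: lmeasurable_compact fmeasurableD\<close>)
qed

lemma continuous_bounded_L2:
  fixes f :: "'a \<Rightarrow> 'b::euclidean_space"
  assumes "continuous_on UNIV f" "\<And>x. norm (f x) \<le> B"
  shows "f \<in> L2_space \<Omega>"
proof -
  have m[measurable]: "f \<in> borel_measurable (lebesgue_on \<Omega>)"
    by (rule measurable_restrict_space1, rule measurable_completion)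
      (simp add: borel_measurable_continuous_onI assms(1))
  have "integrable (lebesgue_on \<Omega>) (\<lambda>x. (norm (f x))\<^sup>2)"
    by (rule finite_measure.integrable_const_bound[OF finite_measure_\<Omega>, where B = "B\<^sup>2"])
      (auto simp: assms(2) power_mono)
  then show ?thesis using m by (simp add: L2_space_def)
qed

lemma test_function_L2:
  assumes \<phi>: "\<phi> \<in> test_functions \<Omega>"
  shows "\<phi> \<in> L2_space \<Omega>" "gradient \<phi> \<in> L2_space \<Omega>"
proof -
  obtain R where R: "\<And>x. x \<notin> cball 0 R \<Longrightarrow> \<phi> x = 0" "\<And>x. x \<notin> cball 0 R \<Longrightarrow> gradient \<phi> x = 0"
    using test_function_support_ball[OF bounded_\<Omega> \<phi>] by blast
  obtain B B' where "\<And>x. norm (\<phi> x) \<le> B" "\<And>x. norm (gradient \<phi> x) \<le> B'"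
    using continuous_compact_support_bounded[OF test_functionD(2)[OF \<phi>] R(1)]
      continuous_compact_support_bounded[OF test_functionD(3)[OF \<phi>] R(2)] by metis
  then show "\<phi> \<in> L2_space \<Omega>" "gradient \<phi> \<in> L2_space \<Omega>"
    using continuous_bounded_L2 test_functionD(2,3)[OF \<phi>] by blast+
qed

text \<open>Integration by parts against the test function \<open>\<psi>\<close> in direction \<open>b\<close> is orthogonality of
  \<open>(u, g)\<close> to a fixed square integrable function, hence a linear condition that is closed under limits
  in \<open>L\<^sup>2\<close>.\<close>

lemma weak_gradient_test_identity:
  assumes U: "(\<lambda>x. (u x, g x)) \<in> L2_space \<Omega>" and \<psi>: "\<psi> \<in> test_functions \<Omega>"
  shows "(\<lambda>x. (gradient \<psi> x \<bullet> b, \<psi> x *\<^sub>R b)) \<in> L2_space \<Omega>"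
    and "(\<integral>x. (u x, g x) \<bullet> (gradient \<psi> x \<bullet> b, \<psi> x *\<^sub>R b) \<partial>lebesgue_on \<Omega>)
      = ((\<integral>x. u x *\<^sub>R gradient \<psi> x \<partial>lebesgue_on \<Omega>) + (\<integral>x. \<psi> x *\<^sub>R g x \<partial>lebesgue_on \<Omega>)) \<bullet> b"
proof -
  note T = test_function_L2[OF \<psi>]
  have u: "u \<in> L2_space \<Omega>" "g \<in> L2_space \<Omega>" using U by (simp_all add: L2_space_Pair_iff)
  obtain R where R: "\<And>x. x \<notin> cball 0 R \<Longrightarrow> \<psi> x = 0" "\<And>x. x \<notin> cball 0 R \<Longrightarrow> gradient \<psi> x = 0"
    using test_function_support_ball[OF bounded_\<Omega> \<psi>] by blast
  have c: "continuous_on UNIV (\<lambda>x. (gradient \<psi> x \<bullet> b, \<psi> x *\<^sub>R b))"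
    by (intro continuous_intros test_functionD[OF \<psi>])
  have "(gradient \<psi> x \<bullet> b, \<psi> x *\<^sub>R b) = 0" if "x \<notin> cball 0 R" for x
    using R that by (simp add: zero_prod_def)
  from continuous_compact_support_bounded[OF c this]
  obtain B where "\<And>x. norm (gradient \<psi> x \<bullet> b, \<psi> x *\<^sub>R b) \<le> B" by blast
  then show "(\<lambda>x. (gradient \<psi> x \<bullet> b, \<psi> x *\<^sub>R b)) \<in> L2_space \<Omega>"
    by (rule continuous_bounded_L2[OF c])
  have i: "integrable (lebesgue_on \<Omega>) (\<lambda>x. u x *\<^sub>R gradient \<psi> x)" "integrable (lebesgue_on \<Omega>) (\<lambda>x. \<psi> x *\<^sub>R g x)"
    by (intro L2_scaleR_integrable u T)+
  have "(\<integral>x. (u x, g x) \<bullet> (gradient \<psi> x \<bullet> b, \<psi> x *\<^sub>R b) \<partial>lebesgue_on \<Omega>)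
      = (\<integral>x. (u x *\<^sub>R gradient \<psi> x) \<bullet> b + (\<psi> x *\<^sub>R g x) \<bullet> b \<partial>lebesgue_on \<Omega>)"
    by simp
  also have "\<dots> = ((\<integral>x. u x *\<^sub>R gradient \<psi> x \<partial>lebesgue_on \<Omega>) + (\<integral>x. \<psi> x *\<^sub>R g x \<partial>lebesgue_on \<Omega>)) \<bullet> b"
    using i by (subst Bochner_Integration.integral_add)
      (auto simp del: inner_scaleR_left simp: inner_add_left)
  finally show "(\<integral>x. (u x, g x) \<bullet> (gradient \<psi> x \<bullet> b, \<psi> x *\<^sub>R b) \<partial>lebesgue_on \<Omega>)
      = ((\<integral>x. u x *\<^sub>R gradient \<psi> x \<partial>lebesgue_on \<Omega>) + (\<integral>x. \<psi> x *\<^sub>R g x \<partial>lebesgue_on \<Omega>)) \<bullet> b" .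
qed

lemma has_weak_gradient_iff_orthogonal:
  assumes U: "(\<lambda>x. (u x, g x)) \<in> L2_space \<Omega>"
  shows "has_weak_gradient \<Omega> u g \<longleftrightarrow> (\<forall>\<psi>\<in>test_functions \<Omega>. \<forall>b\<in>Basis.
    (\<integral>x. (u x, g x) \<bullet> (gradient \<psi> x \<bullet> b, \<psi> x *\<^sub>R b) \<partial>lebesgue_on \<Omega>) = 0)"
proof -
  have u: "locally_integrable \<Omega> u" "locally_integrable \<Omega> g"
    using U by (auto simp: L2_space_Pair_iff intro: L2_locally_integrable)
  have "has_weak_gradient \<Omega> u g \<longleftrightarrow> (\<forall>\<psi>\<in>test_functions \<Omega>. \<forall>b\<in>Basis.
     ((\<integral>x. u x *\<^sub>R gradient \<psi> x \<partial>lebesgue_on \<Omega>) + (\<integral>x. \<psi> x *\<^sub>R g x \<partial>lebesgue_on \<Omega>)) \<bullet> b = 0)"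
    using u unfolding has_weak_gradient_def euclidean_all_zero_iff by (simp add: eq_neg_iff_add_eq_0)
  then show ?thesis using weak_gradient_test_identity(2)[OF U] by simp
qed

lemma weak_gradient_AE_eq:
  assumes "has_weak_gradient \<Omega> u g"
  shows "AE x in lebesgue_on \<Omega>. weak_gradient \<Omega> u x = g x"
proof -
  have "has_weak_gradient \<Omega> u (weak_gradient \<Omega> u)"
    unfolding weak_gradient_def by (rule someI[of "has_weak_gradient \<Omega> u", OF assms])
  then show ?thesis by (rule weak_gradient_unique[OF open_\<Omega> _ assms])
qed

lemma with_gradient_L2:
  assumes "u \<in> H1_space \<Omega>"
  shows "with_gradient \<Omega> u \<in> L2_space \<Omega>" "has_weak_gradient \<Omega> u (weak_gradient \<Omega> u)"
proof -
  obtain g where g: "u \<in> L2_space \<Omega>" "g \<in> L2_space \<Omega>" "has_weak_gradient \<Omega> u g"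
    using assms by (auto simp: H1_space_def)
  show "has_weak_gradient \<Omega> u (weak_gradient \<Omega> u)"
    unfolding weak_gradient_def by (rule someI[of "has_weak_gradient \<Omega> u", OF g(3)])
  have "AE x in lebesgue_on \<Omega>. g x = weak_gradient \<Omega> u x"
    using weak_gradient_AE_eq[OF g(3)] by eventually_elim simp
  then show "with_gradient \<Omega> u \<in> L2_space \<Omega>"
    using g(1) L2_space_AE_cong[OF sets_\<Omega> g(2)] by (simp add: L2_space_Pair_iff)
qed

lemma test_function_graph_L2:
  "\<phi> \<in> test_functions \<Omega> \<Longrightarrow> (\<lambda>x. (\<phi> x, gradient \<phi> x)) \<in> L2_space \<Omega>"
  using test_function_L2 by (simp add: L2_space_Pair_iff)

lemma has_weak_gradient_lincomb:
  assumes U: "(\<lambda>x. (u x, g x)) \<in> L2_space \<Omega>" "(\<lambda>x. (v x, h x)) \<in> L2_space \<Omega>"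
    and wg: "has_weak_gradient \<Omega> u g" "has_weak_gradient \<Omega> v h"
  shows "has_weak_gradient \<Omega> (\<lambda>x. u x + c * v x) (\<lambda>x. g x + c *\<^sub>R h x)"
proof -
  have L: "(\<lambda>x. (u x + c * v x, g x + c *\<^sub>R h x)) \<in> L2_space \<Omega>"
    using L2_space_lincomb(1)[OF U, of c] by simp
  show ?thesis
    unfolding has_weak_gradient_iff_orthogonal[OF L]
  proof (intro ballI)
    fix \<psi> and b :: 'a assume \<psi>: "\<psi> \<in> test_functions \<Omega>" and b: "b \<in> Basis"
    define H where "H x = (gradient \<psi> x \<bullet> b, \<psi> x *\<^sub>R b)" for x
    have H: "H \<in> L2_space \<Omega>" unfolding H_def[abs_def] by (rule weak_gradient_test_identity(1)[OF U(1) \<psi>])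
    have z: "(\<integral>x. (u x, g x) \<bullet> H x \<partial>lebesgue_on \<Omega>) = 0" "(\<integral>x. (v x, h x) \<bullet> H x \<partial>lebesgue_on \<Omega>) = 0"
      using wg \<psi> b unfolding H_def has_weak_gradient_iff_orthogonal[OF U(1)] has_weak_gradient_iff_orthogonal[OF U(2)]
      by blast+
    have "(\<integral>x. (u x + c * v x, g x + c *\<^sub>R h x) \<bullet> H x \<partial>lebesgue_on \<Omega>)
        = (\<integral>x. (u x, g x) \<bullet> H x + c * ((v x, h x) \<bullet> H x) \<partial>lebesgue_on \<Omega>)"
      by (simp add: H_def inner_add_left algebra_simps)
    also have "\<dots> = 0"
      using z L2_space_inner_integrable[OF U(1) H] L2_space_inner_integrable[OF U(2) H]
      by (subst Bochner_Integration.integral_add) (auto simp del: inner_Pair)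
    finally show "(\<integral>x. (u x + c * v x, g x + c *\<^sub>R h x) \<bullet> (gradient \<psi> x \<bullet> b, \<psi> x *\<^sub>R b) \<partial>lebesgue_on \<Omega>) = 0"
      by (simp add: H_def)
  qed
qed

lemma H10_graph_weak_gradient:
  assumes "(\<lambda>x. (u x, g x)) \<in> H10_graph \<Omega>"
  shows "has_weak_gradient \<Omega> u g"
proof -
  from assms obtain \<phi> where U: "(\<lambda>x. (u x, g x)) \<in> L2_space \<Omega>" and \<phi>: "\<And>n::nat. \<phi> n \<in> test_functions \<Omega>"
    and lim: "(\<lambda>n. sq_norm \<Omega> (\<lambda>x. (\<phi> n x, gradient (\<phi> n) x) - (u x, g x))) \<longlonglongrightarrow> 0"
    unfolding H10_graph_def by blast
  show ?thesis
    unfolding has_weak_gradient_iff_orthogonal[OF U]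
  proof (intro ballI)
    fix \<psi> and b :: 'a assume \<psi>: "\<psi> \<in> test_functions \<Omega>" and b: "b \<in> Basis"
    have "(\<integral>x. (\<phi> n x, gradient (\<phi> n) x) \<bullet> (gradient \<psi> x \<bullet> b, \<psi> x *\<^sub>R b) \<partial>lebesgue_on \<Omega>) = 0" for n
      using test_function_has_weak_gradient[OF bounded_\<Omega> sets_\<Omega> \<phi>[of n]] \<psi> b
        has_weak_gradient_iff_orthogonal[OF test_function_graph_L2[OF \<phi>[of n]]] by blast
    with L2_tendsto_inner[OF test_function_graph_L2[OF \<phi>] U lim weak_gradient_test_identity(1)[OF U \<psi>, of b]]
    show "(\<integral>x. (u x, g x) \<bullet> (gradient \<psi> x \<bullet> b, \<psi> x *\<^sub>R b) \<partial>lebesgue_on \<Omega>) = 0"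
      by (simp only: LIMSEQ_const_iff)
  qed
qed

lemma H10_graph_lincomb:
  assumes "U \<in> H10_graph \<Omega>" "V \<in> H10_graph \<Omega>"
  shows "(\<lambda>x. U x + c *\<^sub>R V x) \<in> H10_graph \<Omega>"
proof -
  from assms obtain \<phi> \<psi> where U: "U \<in> L2_space \<Omega>" "V \<in> L2_space \<Omega>"
    and t: "\<And>n::nat. \<phi> n \<in> test_functions \<Omega>" "\<And>n::nat. \<psi> n \<in> test_functions \<Omega>"
    and lim: "(\<lambda>n. sq_norm \<Omega> (\<lambda>x. (\<phi> n x, gradient (\<phi> n) x) - U x)) \<longlonglongrightarrow> 0"
     "(\<lambda>n. sq_norm \<Omega> (\<lambda>x. (\<psi> n x, gradient (\<psi> n) x) - V x)) \<longlonglongrightarrow> 0"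
    unfolding H10_graph_def by blast
  define \<eta> where "\<eta> n x = \<phi> n x + c * \<psi> n x" for n x
  have \<eta>: "\<eta> n \<in> test_functions \<Omega>" for n
    unfolding \<eta>_def[abs_def] by (rule test_function_lincomb(1)[OF t])
  have g: "gradient (\<eta> n) x = gradient (\<phi> n) x + c *\<^sub>R gradient (\<psi> n) x" for n x
    unfolding \<eta>_def[abs_def] by (rule test_function_lincomb(2)[OF t])
  have L: "(\<lambda>x. U x + c *\<^sub>R V x) \<in> L2_space \<Omega>" by (rule L2_space_lincomb(1)[OF U])
  have le: "sq_norm \<Omega> (\<lambda>x. (\<eta> n x, gradient (\<eta> n) x) - (U x + c *\<^sub>R V x))
      \<le> 2 * sq_norm \<Omega> (\<lambda>x. (\<phi> n x, gradient (\<phi> n) x) - U x) + 2 * c\<^sup>2 * sq_norm \<Omega> (\<lambda>x. (\<psi> n x, gradient (\<psi> n) x) - V x)" for n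
  proof -
    define A where "A x = (\<phi> n x, gradient (\<phi> n) x) - U x" for x
    define B where "B x = (\<psi> n x, gradient (\<psi> n) x) - V x" for x
    have AB: "A \<in> L2_space \<Omega>" "B \<in> L2_space \<Omega>"
      unfolding A_def[abs_def] B_def[abs_def] by (intro L2_space_diff test_function_graph_L2 t U)+
    have "(\<eta> n x, gradient (\<eta> n) x) - (U x + c *\<^sub>R V x) = A x + c *\<^sub>R B x" for x
      unfolding g unfolding \<eta>_def A_def B_def by (simp add: prod_eq_iff algebra_simps)
    then have "sq_norm \<Omega> (\<lambda>x. (\<eta> n x, gradient (\<eta> n) x) - (U x + c *\<^sub>R V x)) = sq_norm \<Omega> (\<lambda>x. A x + c *\<^sub>R B x)"
      by (simp only:)
    moreover have "0 \<le> sq_norm \<Omega> (\<lambda>x. A x + (- c) *\<^sub>R B x)" by (rule Bochner_Integration.integral_nonneg) simp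
    ultimately show ?thesis
      unfolding A_def[symmetric] B_def[symmetric] L2_space_lincomb(2)[OF AB] by simp
  qed
  have "(\<lambda>n. 2 * sq_norm \<Omega> (\<lambda>x. (\<phi> n x, gradient (\<phi> n) x) - U x) + 2 * c\<^sup>2 * sq_norm \<Omega> (\<lambda>x. (\<psi> n x, gradient (\<psi> n) x) - V x)) \<longlonglongrightarrow> 0"
    using tendsto_add[OF tendsto_mult[OF tendsto_const[of 2] lim(1)] tendsto_mult[OF tendsto_const[of "2 * c\<^sup>2"] lim(2)]] by simp
  then have "(\<lambda>n. sq_norm \<Omega> (\<lambda>x. (\<eta> n x, gradient (\<eta> n) x) - (U x + c *\<^sub>R V x))) \<longlonglongrightarrow> 0"
    by (rule Lim_null_comparison[rotated], intro always_eventually allI)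
      (use le in \<open>simp add: Bochner_Integration.integral_nonneg\<close>)
  then show ?thesis using L \<eta> unfolding H10_graph_def by blast
qed

text \<open>A diagonal sequence of test functions.\<close>

lemma H10_graph_closed:
  assumes U: "\<And>n::nat. U n \<in> H10_graph \<Omega>" and V: "V \<in> L2_space \<Omega>"
    and lim: "(\<lambda>n. sq_norm \<Omega> (\<lambda>x. U n x - V x)) \<longlonglongrightarrow> 0"
  shows "V \<in> H10_graph \<Omega>"
proof -
  have "\<exists>\<phi>\<in>test_functions \<Omega>. sq_norm \<Omega> (\<lambda>x. (\<phi> x, gradient \<phi> x) - U n x) < inverse (real (Suc n))" for n
  proof -
    from U[of n] obtain \<phi> where \<phi>: "\<And>k::nat. \<phi> k \<in> test_functions \<Omega>"
      and l: "(\<lambda>k. sq_norm \<Omega> (\<lambda>x. (\<phi> k x, gradient (\<phi> k) x) - U n x)) \<longlonglongrightarrow> 0"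
      unfolding H10_graph_def by blast
    have "\<forall>\<^sub>F k in sequentially. sq_norm \<Omega> (\<lambda>x. (\<phi> k x, gradient (\<phi> k) x) - U n x) < inverse (real (Suc n))"
      by (rule order_tendstoD(2)[OF l]) simp
    then obtain k where "sq_norm \<Omega> (\<lambda>x. (\<phi> k x, gradient (\<phi> k) x) - U n x) < inverse (real (Suc n))"
      using eventually_happens'[OF sequentially_bot] by blast
    then show ?thesis by (rule bexI[of _ "\<phi> k"]) (rule \<phi>)
  qed
  then have "\<forall>n. \<exists>\<phi>. \<phi> \<in> test_functions \<Omega> \<and> sq_norm \<Omega> (\<lambda>x. (\<phi> x, gradient \<phi> x) - U n x) < inverse (real (Suc n))"
    by blast
  from choice[OF this] obtain \<phi> where \<phi>: "\<And>n. \<phi> n \<in> test_functions \<Omega>"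
    and lt: "\<And>n. sq_norm \<Omega> (\<lambda>x. (\<phi> n x, gradient (\<phi> n) x) - U n x) < inverse (real (Suc n))" by blast
  have UL: "U n \<in> L2_space \<Omega>" for n using U by (simp add: H10_graph_def)
  have "(\<lambda>n. 2 * inverse (real (Suc n)) + 2 * sq_norm \<Omega> (\<lambda>x. U n x - V x)) \<longlonglongrightarrow> 0"
    using tendsto_add[OF tendsto_mult[OF tendsto_const[of 2] LIMSEQ_inverse_real_of_nat] tendsto_mult[OF tendsto_const[of 2] lim]] by simp
  then have "(\<lambda>n. sq_norm \<Omega> (\<lambda>x. (\<phi> n x, gradient (\<phi> n) x) - V x)) \<longlonglongrightarrow> 0"
  proof (rule Lim_null_comparison[rotated], intro always_eventually allI)
    fix n
    have "sq_norm \<Omega> (\<lambda>x. (\<phi> n x, gradient (\<phi> n) x) - V x)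
      \<le> 2 * sq_norm \<Omega> (\<lambda>x. (\<phi> n x, gradient (\<phi> n) x) - U n x) + 2 * sq_norm \<Omega> (\<lambda>x. U n x - V x)"
      by (rule sq_norm_diff_triangle[OF test_function_graph_L2[OF \<phi>] UL V])
    then have "sq_norm \<Omega> (\<lambda>x. (\<phi> n x, gradient (\<phi> n) x) - V x)
      \<le> 2 * inverse (real (Suc n)) + 2 * sq_norm \<Omega> (\<lambda>x. U n x - V x)" using lt[of n] by simp
    then show "norm (sq_norm \<Omega> (\<lambda>x. (\<phi> n x, gradient (\<phi> n) x) - V x))
      \<le> 2 * inverse (real (Suc n)) + 2 * sq_norm \<Omega> (\<lambda>x. U n x - V x)"
      by (simp add: Bochner_Integration.integral_nonneg)
  qed
  then show ?thesis using V \<phi> unfolding H10_graph_def by blast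
qed

lemma H10_graph_AE_cong:
  assumes U: "U \<in> H10_graph \<Omega>" and eq: "AE x in lebesgue_on \<Omega>. U x = V x"
  shows "V \<in> H10_graph \<Omega>"
proof (rule H10_graph_closed[OF U])
  have UL: "U \<in> L2_space \<Omega>" using U by (simp add: H10_graph_def)
  show V: "V \<in> L2_space \<Omega>" by (rule L2_space_AE_cong[OF sets_\<Omega> UL eq])
  have "sq_norm \<Omega> (\<lambda>x. U x - V x) = 0"
    using eq by (intro integral_eq_zero_AE) (auto elim!: eventually_mono)
  then show "(\<lambda>n. sq_norm \<Omega> (\<lambda>x. U x - V x)) \<longlonglongrightarrow> 0" by simp
qed

lemma H1_norm_diff_test:
  assumes u: "u \<in> H1_space \<Omega>" and \<phi>: "\<phi> \<in> test_functions \<Omega>"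
  shows "(H1_norm \<Omega> (\<lambda>x. \<phi> x - u x))\<^sup>2 = sq_norm \<Omega> (\<lambda>x. (\<phi> x, gradient \<phi> x) - with_gradient \<Omega> u x)"
proof -
  have wg: "has_weak_gradient \<Omega> (\<lambda>x. \<phi> x - u x) (\<lambda>x. gradient \<phi> x - weak_gradient \<Omega> u x)"
    using has_weak_gradient_lincomb[OF test_function_graph_L2[OF \<phi>] with_gradient_L2(1)[OF u]
      test_function_has_weak_gradient[OF bounded_\<Omega> sets_\<Omega> \<phi>] with_gradient_L2(2)[OF u], of "-1"] by simp
  have L: "(\<lambda>x. (\<phi> x, gradient \<phi> x) - with_gradient \<Omega> u x) \<in> L2_space \<Omega>"
    by (rule L2_space_diff[OF test_function_graph_L2[OF \<phi>] with_gradient_L2(1)[OF u]])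
  have eq: "AE x in lebesgue_on \<Omega>. (\<phi> x, gradient \<phi> x) - with_gradient \<Omega> u x = with_gradient \<Omega> (\<lambda>x. \<phi> x - u x) x"
    using weak_gradient_AE_eq[OF wg] by eventually_elim simp
  show ?thesis unfolding H1_norm_sq
    by (rule sq_norm_AE_cong[OF L2_space_AE_cong[OF sets_\<Omega> L eq] L]) (use eq in \<open>eventually_elim, simp\<close>)
qed

text \<open>By the uniqueness of weak gradients, convergence of test functions in the \<open>H\<^sup>1\<close> norm is
  convergence of the pairs in \<open>L\<^sup>2\<close>.\<close>

lemma H10_space_iff: "u \<in> H10_space \<Omega> \<longleftrightarrow> u \<in> H1_space \<Omega> \<and> with_gradient \<Omega> u \<in> H10_graph \<Omega>"
proof -
  have "(\<lambda>n. H1_norm \<Omega> (\<lambda>x. \<phi> n x - u x)) \<longlonglongrightarrow> 0 \<longleftrightarrow>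
      (\<lambda>n. sq_norm \<Omega> (\<lambda>x. (\<phi> n x, gradient (\<phi> n) x) - with_gradient \<Omega> u x)) \<longlonglongrightarrow> 0"
    if "u \<in> H1_space \<Omega>" "\<And>n::nat. \<phi> n \<in> test_functions \<Omega>" for \<phi>
    unfolding H1_norm_diff_test[OF that(1) that(2), symmetric]
  proof
    assume "(\<lambda>n. H1_norm \<Omega> (\<lambda>x. \<phi> n x - u x)) \<longlonglongrightarrow> 0"
    from tendsto_power[OF this, of 2] show "(\<lambda>n. (H1_norm \<Omega> (\<lambda>x. \<phi> n x - u x))\<^sup>2) \<longlonglongrightarrow> 0" by simp
  next
    assume "(\<lambda>n. (H1_norm \<Omega> (\<lambda>x. \<phi> n x - u x))\<^sup>2) \<longlonglongrightarrow> 0"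
    then show "(\<lambda>n. H1_norm \<Omega> (\<lambda>x. \<phi> n x - u x)) \<longlonglongrightarrow> 0"
      by (simp add: tendsto_null_power)
  qed
  then show ?thesis
    using with_gradient_L2(1)[of u] unfolding H10_space_def H10_graph_def by blast
qed

text \<open>Every element of the closure is, almost everywhere, the graph of a function in \<open>H\<^sup>1\<^sub>0\<close>, so that the closed subspace to
  which Riesz' theorem applies contains nothing but that space.\<close>

lemma H10_graphD:
  assumes "(\<lambda>x. (u x, g x)) \<in> H10_graph \<Omega>"
  shows "u \<in> H10_space \<Omega>" "AE x in lebesgue_on \<Omega>. weak_gradient \<Omega> u x = g x"
proof -
  have wg: "has_weak_gradient \<Omega> u g" by (rule H10_graph_weak_gradient[OF assms])
  show AE: "AE x in lebesgue_on \<Omega>. weak_gradient \<Omega> u x = g x" by (rule weak_gradient_AE_eq[OF wg])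
  have "(\<lambda>x. (u x, g x)) \<in> L2_space \<Omega>" using assms by (simp add: H10_graph_def)
  then have "u \<in> H1_space \<Omega>" using wg by (auto simp: H1_space_def L2_space_Pair_iff)
  moreover have "with_gradient \<Omega> u \<in> H10_graph \<Omega>"
    by (rule H10_graph_AE_cong[OF assms]) (use AE in \<open>eventually_elim, simp\<close>)
  ultimately show "u \<in> H10_space \<Omega>" by (simp add: H10_space_iff)
qed

lemma H10_space_graph: "u \<in> H10_space \<Omega> \<Longrightarrow> with_gradient \<Omega> u \<in> H10_graph \<Omega>"
  by (simp add: H10_space_iff)

lemma H10_space_L2: "u \<in> H10_space \<Omega> \<Longrightarrow> with_gradient \<Omega> u \<in> L2_space \<Omega>"
  using H10_space_graph by (simp add: H10_graph_def)

lemma H10_space_lincomb: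
  assumes "u \<in> H10_space \<Omega>" "v \<in> H10_space \<Omega>"
  shows "(\<lambda>x. u x + c * v x) \<in> H10_space \<Omega>"
    and "AE x in lebesgue_on \<Omega>. with_gradient \<Omega> (\<lambda>x. u x + c * v x) x
      = with_gradient \<Omega> u x + c *\<^sub>R with_gradient \<Omega> v x"
proof -
  have "(\<lambda>x. (u x + c * v x, weak_gradient \<Omega> u x + c *\<^sub>R weak_gradient \<Omega> v x)) \<in> H10_graph \<Omega>"
    using H10_graph_lincomb[OF assms[THEN H10_space_graph], of c] by simp
  note H10_graphD[OF this]
  then show "(\<lambda>x. u x + c * v x) \<in> H10_space \<Omega>"
    and "AE x in lebesgue_on \<Omega>. with_gradient \<Omega> (\<lambda>x. u x + c * v x) x
      = with_gradient \<Omega> u x + c *\<^sub>R with_gradient \<Omega> v x"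
    by (auto elim!: eventually_mono)
qed

lemma H10_space_AE_cong:
  assumes u: "u \<in> H10_space \<Omega>" and eq: "AE x in lebesgue_on \<Omega>. v x = u x"
  shows "v \<in> H10_space \<Omega>" "AE x in lebesgue_on \<Omega>. with_gradient \<Omega> v x = with_gradient \<Omega> u x"
proof -
  have "(\<lambda>x. (v x, weak_gradient \<Omega> u x)) \<in> H10_graph \<Omega>"
    by (rule H10_graph_AE_cong[OF H10_space_graph[OF u]]) (use eq in \<open>eventually_elim, simp\<close>)
  note H = H10_graphD[OF this]
  show "v \<in> H10_space \<Omega>" by (rule H(1))
  show "AE x in lebesgue_on \<Omega>. with_gradient \<Omega> v x = with_gradient \<Omega> u x"
    using H(2) eq by eventually_elim simp
qed

end


section \<open>The Rayleigh quotient along the iteration\<close>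

text \<open>Convexity of \<open>t \<mapsto> t^q\<close> at \<open>a + b = l (a/l) + (1-l) (b/(1-l))\<close>. It serves instead of Minkowski's
  inequality: the factor in front of \<open>|a|^q\<close> tends to 1 as \<open>l\<close> tends to 1.\<close>

lemma powr_add_convex_bound:
  fixes a b q l :: real
  assumes q: "1 \<le> q" and l: "0 < l" "l < 1"
  shows "\<bar>a + b\<bar> powr q \<le> l powr (1 - q) * \<bar>a\<bar> powr q + (1 - l) powr (1 - q) * \<bar>b\<bar> powr q"
proof -
  have ge1: "1 \<le> t powr (1 - q)" if "0 < t" "t < 1" for t
    using powr_mono'[of "1 - q" 0 t] that q by simp
  have le: "\<bar>a + b\<bar> powr q \<le> (\<bar>a\<bar> + \<bar>b\<bar>) powr q"
    using q by (intro powr_mono2) auto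
  show ?thesis
  proof (cases "a = 0 \<or> b = 0")
    case True
    then show ?thesis
    proof
      assume "a = 0"
      then show ?thesis
        using mult_right_mono[OF ge1[of "1 - l"], of "\<bar>b\<bar> powr q"] l by simp
    next
      assume "b = 0"
      then show ?thesis
        using mult_right_mono[OF ge1[of l], of "\<bar>a\<bar> powr q"] l by simp
    qed
  next
    case False
    have "(\<bar>a\<bar> + \<bar>b\<bar>) powr q \<le> l * (\<bar>a\<bar> / l) powr q + (1 - l) * (\<bar>b\<bar> / (1 - l)) powr q"
      using convex_onD[OF powr_convex[OF q], of "1 - l" "\<bar>a\<bar> / l" "\<bar>b\<bar> / (1 - l)"] False l by simp
    moreover have "l * (\<bar>a\<bar> / l) powr q = l powr (1 - q) * \<bar>a\<bar> powr q"
      using l by (simp add: powr_divide powr_diff)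
    moreover have "(1 - l) * (\<bar>b\<bar> / (1 - l)) powr q = (1 - l) powr (1 - q) * \<bar>b\<bar> powr q"
      using l by (simp add: powr_divide powr_diff)
    ultimately show ?thesis using le l by simp
  qed
qed

locale subcritical = bounded_open \<Omega> for \<Omega> :: "'a::euclidean_space set" +
  fixes p :: real
  assumes p: "1 < p" and subcritical: "(real DIM('a) - 2) * (p + 1) < 2 * real DIM('a)"
begin

definition potential :: "('a \<Rightarrow> real) \<Rightarrow> real" where
  "potential u = (\<integral>x. \<bar>u x\<bar> powr (p + 1) \<partial>lebesgue_on \<Omega>)"

abbreviation H1_sq :: "('a \<Rightarrow> real) \<Rightarrow> real" where
  "H1_sq u \<equiv> sq_norm \<Omega> (with_gradient \<Omega> u)"

lemma potential_nonneg: "0 \<le> potential u"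
  unfolding potential_def by (rule Bochner_Integration.integral_nonneg) simp

lemma H1_sq_nonneg: "0 \<le> H1_sq u"
  by (rule Bochner_Integration.integral_nonneg) simp

lemma H10_measurable: "u \<in> H10_space \<Omega> \<Longrightarrow> u \<in> borel_measurable (lebesgue_on \<Omega>)"
  using H10_space_L2 L2_spaceD(1) by (auto simp: L2_space_Pair_iff)

text \<open>The transfer to Lebesgue measure on \<open>\<Omega>\<close>, and to the full \<open>H\<^sup>1\<close> norm on the right-hand side.\<close>

lemma test_function_Sobolev:
  obtains C where "0 \<le> C" "\<And>\<phi>. \<phi> \<in> test_functions \<Omega> \<Longrightarrow>
    integrable (lebesgue_on \<Omega>) (\<lambda>x. \<bar>\<phi> x\<bar> powr (p + 1)) \<and>
    potential \<phi> \<le> C * sq_norm \<Omega> (\<lambda>x. (\<phi> x, gradient \<phi> x)) powr ((p + 1) / 2)"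
proof -
  obtain C where C: "0 \<le> C" "\<And>\<phi>. \<phi> \<in> test_functions \<Omega> \<Longrightarrow>
    (\<integral>\<^sup>+x. ennreal (\<bar>\<phi> x\<bar> powr (p + 1)) \<partial>lborel)
      \<le> ennreal (C * (\<integral>x. (norm (gradient \<phi> x))\<^sup>2 \<partial>lborel) powr ((p + 1) / 2))"
    using Sobolev_test_functions[OF bounded_\<Omega> _ subcritical] p by auto
  have "integrable (lebesgue_on \<Omega>) (\<lambda>x. \<bar>\<phi> x\<bar> powr (p + 1)) \<and>
    potential \<phi> \<le> C * sq_norm \<Omega> (\<lambda>x. (\<phi> x, gradient \<phi> x)) powr ((p + 1) / 2)" if \<phi>: "\<phi> \<in> test_functions \<Omega>" for \<phi>
  proof -
    note L = test_function_L2[OF \<phi>]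
    note [measurable] = L2_spaceD(1)[OF L(1)]
    define G where "G = (\<integral>x. (norm (gradient \<phi> x))\<^sup>2 \<partial>lborel)"
    define S where "S = sq_norm \<Omega> (\<lambda>x. (\<phi> x, gradient \<phi> x))"
    have gm: "(\<lambda>x. (norm (gradient \<phi> x))\<^sup>2) \<in> borel_measurable lborel"
      using test_functionD(3)[OF \<phi>] by (simp add: borel_measurable_continuous_onI continuous_intros)
    have "G = sq_norm \<Omega> (gradient \<phi>)"
      using test_functionD(5)[OF \<phi>] unfolding G_def integral_completion[OF gm, symmetric]
      by (subst lebesgue_on_integral_extend(1)[OF sets_\<Omega>]) auto
    also have "\<dots> \<le> S"
      unfolding S_def
      by (rule integral_mono[OF L2_spaceD(2)[OF L(2)] L2_spaceD(2)[OF test_function_graph_L2[OF \<phi>]]])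
        (simp add: norm_Pair)
    finally have GS: "G \<le> S" .
    have G0: "0 \<le> G" unfolding G_def by simp
    have "(\<integral>\<^sup>+x. ennreal (\<bar>\<phi> x\<bar> powr (p + 1)) \<partial>lebesgue_on \<Omega>)
        = (\<integral>\<^sup>+x. ennreal (\<bar>\<phi> x\<bar> powr (p + 1)) * indicator \<Omega> x \<partial>lebesgue)"
      using sets_\<Omega> by (simp add: nn_integral_restrict_space)
    also have "\<dots> \<le> (\<integral>\<^sup>+x. ennreal (\<bar>\<phi> x\<bar> powr (p + 1)) \<partial>lebesgue)"
      by (rule nn_integral_mono) (auto simp: indicator_def)
    also have "\<dots> = (\<integral>\<^sup>+x. ennreal (\<bar>\<phi> x\<bar> powr (p + 1)) \<partial>lborel)" by (rule nn_integral_completion)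
    also have "\<dots> \<le> ennreal (C * G powr ((p + 1) / 2))" unfolding G_def by (rule C(2)[OF \<phi>])
    also have "\<dots> \<le> ennreal (C * S powr ((p + 1) / 2))"
      using GS G0 p C(1) by (intro ennreal_leI mult_left_mono powr_mono2) auto
    finally have le: "(\<integral>\<^sup>+x. ennreal (\<bar>\<phi> x\<bar> powr (p + 1)) \<partial>lebesgue_on \<Omega>) \<le> ennreal (C * S powr ((p + 1) / 2))" .
    have int: "integrable (lebesgue_on \<Omega>) (\<lambda>x. \<bar>\<phi> x\<bar> powr (p + 1))"
      by (rule integrableI_nonneg) (use le in \<open>auto intro: le_less_trans\<close>)
    have "ennreal (potential \<phi>) \<le> ennreal (C * S powr ((p + 1) / 2))"
      using le int by (simp add: potential_def nn_integral_eq_integral)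
    then have "potential \<phi> \<le> C * S powr ((p + 1) / 2)" using C(1) by (subst (asm) ennreal_le_iff) auto
    with int show ?thesis by (simp add: S_def)
  qed
  with C(1) show ?thesis using that by blast
qed

text \<open>Approximating test functions converge almost everywhere along a subsequence, so Fatou's lemma
  carries the inequality to the whole space.\<close>

lemma Sobolev_H10:
  "\<exists>C\<ge>0. \<forall>u\<in>H10_space \<Omega>. integrable (lebesgue_on \<Omega>) (\<lambda>x. \<bar>u x\<bar> powr (p + 1)) \<and>
    potential u \<le> C * H1_sq u powr ((p + 1) / 2)"
proof -
  obtain C where C: "0 \<le> C" "\<And>\<phi>. \<phi> \<in> test_functions \<Omega> \<Longrightarrow>
    integrable (lebesgue_on \<Omega>) (\<lambda>x. \<bar>\<phi> x\<bar> powr (p + 1)) \<and>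
    potential \<phi> \<le> C * sq_norm \<Omega> (\<lambda>x. (\<phi> x, gradient \<phi> x)) powr ((p + 1) / 2)"
    using test_function_Sobolev by blast
  have "integrable (lebesgue_on \<Omega>) (\<lambda>x. \<bar>u x\<bar> powr (p + 1)) \<and> potential u \<le> C * H1_sq u powr ((p + 1) / 2)"
    if u: "u \<in> H10_space \<Omega>" for u
  proof -
    have UL: "with_gradient \<Omega> u \<in> L2_space \<Omega>" by (rule H10_space_L2[OF u])
    from H10_space_graph[OF u] obtain \<phi> where \<phi>: "\<And>n::nat. \<phi> n \<in> test_functions \<Omega>"
      and lim: "(\<lambda>n. sq_norm \<Omega> (\<lambda>x. (\<phi> n x, gradient (\<phi> n) x) - with_gradient \<Omega> u x)) \<longlonglongrightarrow> 0"
      unfolding H10_graph_def by blast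
    obtain r :: "nat \<Rightarrow> nat" where r: "strict_mono r"
      and AE: "AE x in lebesgue_on \<Omega>. (\<lambda>n. (\<phi> (r n) x, gradient (\<phi> (r n)) x)) \<longlonglongrightarrow> with_gradient \<Omega> u x"
      using L2_AE_subseq[OF finite_measure_\<Omega> test_function_graph_L2[OF \<phi>] UL lim] by blast
    have lim': "(\<lambda>n. sq_norm \<Omega> (\<lambda>x. (\<phi> n x, gradient (\<phi> n) x))) \<longlonglongrightarrow> H1_sq u"
      by (rule L2_tendsto_sq_norm[OF test_function_graph_L2[OF \<phi>] UL lim])
    have "(\<lambda>n. sq_norm \<Omega> (\<lambda>x. (\<phi> (r n) x, gradient (\<phi> (r n)) x))) \<longlonglongrightarrow> H1_sq u"
      using LIMSEQ_subseq_LIMSEQ[OF lim' r] by (simp add: o_def)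
    then have c: "(\<lambda>n. C * sq_norm \<Omega> (\<lambda>x. (\<phi> (r n) x, gradient (\<phi> (r n)) x)) powr ((p + 1) / 2))
        \<longlonglongrightarrow> C * H1_sq u powr ((p + 1) / 2)"
      using p by (intro tendsto_mult tendsto_const tendsto_powr') (auto simp: always_eventually Bochner_Integration.integral_nonneg)
    have L: "AE x in lebesgue_on \<Omega>. (\<lambda>n. \<bar>\<phi> (r n) x\<bar> powr (p + 1)) \<longlonglongrightarrow> \<bar>u x\<bar> powr (p + 1)"
      using AE
    proof eventually_elim
      case (elim x)
      have "(\<lambda>n. \<phi> (r n) x) \<longlonglongrightarrow> u x" using tendsto_fst[OF elim] by simp
      then show ?case using p by (intro tendsto_powr' tendsto_rabs tendsto_const) auto
    qed
    have m: "(\<lambda>x. \<bar>u x\<bar> powr (p + 1)) \<in> borel_measurable (lebesgue_on \<Omega>)"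
      using H10_measurable[OF u] by measurable
    have i: "integrable (lebesgue_on \<Omega>) (\<lambda>x. \<bar>\<phi> (r n) x\<bar> powr (p + 1))" for n
      using C(2)[OF \<phi>] by blast
    have b: "(\<integral>x. \<bar>\<phi> (r n) x\<bar> powr (p + 1) \<partial>lebesgue_on \<Omega>)
        \<le> C * sq_norm \<Omega> (\<lambda>x. (\<phi> (r n) x, gradient (\<phi> (r n)) x)) powr ((p + 1) / 2)" for n
      using C(2)[OF \<phi>, of "r n"] by (simp add: potential_def)
    show ?thesis
      using integrable_Fatou[OF i _ m _ L b c] by (simp add: potential_def)
  qed
  with C(1) show ?thesis by blast
qed

lemma H10_powr_integrable:
  "u \<in> H10_space \<Omega> \<Longrightarrow> integrable (lebesgue_on \<Omega>) (\<lambda>x. \<bar>u x\<bar> powr (p + 1))"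
  using Sobolev_H10 by blast

text \<open>Hoelder's inequality with the exponents \<open>(p+1)/p\<close> and \<open>p+1\<close>. With the Sobolev inequality it makes
  the nonlinearity a bounded functional on \<open>H\<^sup>1\<^sub>0\<close>.\<close>

lemma power_nl_pairing:
  assumes u: "u \<in> H10_space \<Omega>" and v: "v \<in> H10_space \<Omega>"
  shows "integrable (lebesgue_on \<Omega>) (\<lambda>x. power_nl p u x * v x)"
    and "\<bar>\<integral>x. power_nl p u x * v x \<partial>lebesgue_on \<Omega>\<bar> \<le> potential u powr (p / (p + 1)) * potential v powr (1 / (p + 1))"
proof -
  note [measurable] = H10_measurable[OF u] H10_measurable[OF v]
  note H = Hoelder_integral[of "p / (p + 1)" "1 / (p + 1)", OF _ _ _ H10_powr_integrable[OF u] _ H10_powr_integrable[OF v]]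
  have ab: "0 < p / (p + 1)" "0 < 1 / (p + 1)" "p / (p + 1) + 1 / (p + 1) = 1"
    using p by (auto simp: field_simps)
  have eq: "\<bar>power_nl p u x * v x\<bar> = (\<bar>u x\<bar> powr (p + 1)) powr (p / (p + 1)) * (\<bar>v x\<bar> powr (p + 1)) powr (1 / (p + 1))" for x
  proof -
    have "\<bar>u x\<bar> powr (p - 1) * \<bar>u x\<bar> = \<bar>u x\<bar> powr p"
      using powr_add[of "\<bar>u x\<bar>" "p - 1" 1] by simp
    then show ?thesis using p by (simp add: power_nl_def abs_mult powr_powr)
  qed
  have i: "integrable (lebesgue_on \<Omega>) (\<lambda>x. \<bar>power_nl p u x * v x\<bar>)"
    unfolding eq by (rule H(1)[OF ab]) auto
  have [measurable]: "power_nl p u \<in> borel_measurable (lebesgue_on \<Omega>)"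
    unfolding power_nl_def[abs_def] by measurable
  show "integrable (lebesgue_on \<Omega>) (\<lambda>x. power_nl p u x * v x)"
    by (rule Bochner_Integration.integrable_bound[OF i]) auto
  have "\<bar>\<integral>x. power_nl p u x * v x \<partial>lebesgue_on \<Omega>\<bar> \<le> (\<integral>x. \<bar>power_nl p u x * v x\<bar> \<partial>lebesgue_on \<Omega>)"
    by (rule integral_abs_bound)
  also have "\<dots> \<le> potential u powr (p / (p + 1)) * potential v powr (1 / (p + 1))"
    unfolding eq potential_def by (rule H(2)[OF ab]) auto
  finally show "\<bar>\<integral>x. power_nl p u x * v x \<partial>lebesgue_on \<Omega>\<bar> \<le> potential u powr (p / (p + 1)) * potential v powr (1 / (p + 1))" .
qed

lemma power_nl_self: "power_nl p u x * u x = \<bar>u x\<bar> powr (p + 1)"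
proof -
  have "\<bar>u x\<bar> powr (p + 1) = \<bar>u x\<bar> powr (p - 1) * \<bar>u x\<bar> powr 2"
    unfolding powr_add[symmetric] by (simp add: add.commute)
  also have "\<bar>u x\<bar> powr 2 = u x * u x" by (simp add: powr_numeral power2_eq_square)
  finally show ?thesis unfolding power_nl_def mult.assoc by (rule sym)
qed

text \<open>Since the inverse operator is a choice of a preimage, everything that can be said about it comes
  from the existence of one, which is Riesz' theorem.\<close>

lemma dirichlet_op_inv_power_nl:
  assumes u: "u \<in> H10_space \<Omega>"
  defines "w \<equiv> dirichlet_op_inv \<Omega> (L2_functional \<Omega> (power_nl p u))"
  shows "w \<in> H10_space \<Omega>"
    and "\<And>v. v \<in> H10_space \<Omega> \<Longrightarrow> H1_inner \<Omega> w v = (\<integral>x. power_nl p u x * v x \<partial>lebesgue_on \<Omega>)"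
proof -
  obtain C where C: "0 \<le> C" "\<And>u. u \<in> H10_space \<Omega> \<Longrightarrow> potential u \<le> C * H1_sq u powr ((p + 1) / 2)"
    using Sobolev_H10 by blast
  define l where "l U = (\<integral>x. power_nl p u x * fst (U x) \<partial>lebesgue_on \<Omega>)" for U :: "'a \<Rightarrow> real \<times> 'a"
  have gr: "(\<lambda>x. fst (U x)) \<in> H10_space \<Omega>" "H1_sq (\<lambda>x. fst (U x)) = sq_norm \<Omega> U" if U: "U \<in> H10_graph \<Omega>" for U
  proof -
    have "(\<lambda>x. (fst (U x), snd (U x))) \<in> H10_graph \<Omega>" using U by simp
    note H = H10_graphD[OF this]
    show h: "(\<lambda>x. fst (U x)) \<in> H10_space \<Omega>" by (rule H(1))
    show "H1_sq (\<lambda>x. fst (U x)) = sq_norm \<Omega> U"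
    proof (rule sq_norm_AE_cong[OF H10_space_L2[OF h]])
      show "U \<in> L2_space \<Omega>" using U by (simp add: H10_graph_def)
      show "AE x in lebesgue_on \<Omega>. (fst (U x), weak_gradient \<Omega> (\<lambda>x. fst (U x)) x) = U x"
        using H(2) by eventually_elim simp
    qed
  qed
  have "\<exists>W\<in>H10_graph \<Omega>. \<forall>U\<in>H10_graph \<Omega>. (\<integral>x. W x \<bullet> U x \<partial>lebesgue_on \<Omega>) = l U"
  proof (rule Riesz_closed_subspace[OF finite_measure_\<Omega>, of "H10_graph \<Omega>" l "potential u powr (p / (p + 1)) * C powr (1 / (p + 1))"])
    show "H10_graph \<Omega> \<subseteq> L2_space \<Omega>" by (auto simp: H10_graph_def)
    show "H10_graph \<Omega> \<noteq> {}" using H10_space_graph[OF u] by blast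
    show "(\<lambda>x. f x + c *\<^sub>R g x) \<in> H10_graph \<Omega>" if "f \<in> H10_graph \<Omega>" "g \<in> H10_graph \<Omega>" for f g c
      using that by (rule H10_graph_lincomb)
    show "f' \<in> H10_graph \<Omega>" if "\<And>n::nat. f n \<in> H10_graph \<Omega>" "f' \<in> L2_space \<Omega>"
      "(\<lambda>n. sq_norm \<Omega> (\<lambda>x. f n x - f' x)) \<longlonglongrightarrow> 0" for f f'
      using that by (rule H10_graph_closed)
    show "l (\<lambda>x. f x + c *\<^sub>R g x) = l f + c * l g" if "f \<in> H10_graph \<Omega>" "g \<in> H10_graph \<Omega>" for f g c
    proof -
      have "l (\<lambda>x. f x + c *\<^sub>R g x) = (\<integral>x. power_nl p u x * fst (f x) + c * (power_nl p u x * fst (g x)) \<partial>lebesgue_on \<Omega>)"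
        unfolding l_def by (rule Bochner_Integration.integral_cong) (auto simp: algebra_simps)
      then show ?thesis
        using power_nl_pairing(1)[OF u gr(1)[OF that(1)]] power_nl_pairing(1)[OF u gr(1)[OF that(2)]]
        by (simp add: l_def)
    qed
    show "\<bar>l f\<bar> \<le> potential u powr (p / (p + 1)) * C powr (1 / (p + 1)) * sqrt (sq_norm \<Omega> f)" if f: "f \<in> H10_graph \<Omega>" for f
    proof -
      have S0: "0 \<le> sq_norm \<Omega> f" by (rule Bochner_Integration.integral_nonneg) simp
      have "\<bar>l f\<bar> \<le> potential u powr (p / (p + 1)) * potential (\<lambda>x. fst (f x)) powr (1 / (p + 1))"
        unfolding l_def by (rule power_nl_pairing(2)[OF u gr(1)[OF f]])
      also have "\<dots> \<le> potential u powr (p / (p + 1)) * (C * sq_norm \<Omega> f powr ((p + 1) / 2)) powr (1 / (p + 1))"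
        using C(2)[OF gr(1)[OF f]] p unfolding gr(2)[OF f]
        by (intro mult_left_mono powr_mono2) (auto simp: potential_nonneg)
      also have "(C * sq_norm \<Omega> f powr ((p + 1) / 2)) powr (1 / (p + 1)) = C powr (1 / (p + 1)) * sqrt (sq_norm \<Omega> f)"
      proof -
        have "(p + 1) / 2 * (1 / (p + 1)) = 1 / 2" using p by simp
        then have "(sq_norm \<Omega> f powr ((p + 1) / 2)) powr (1 / (p + 1)) = sqrt (sq_norm \<Omega> f)"
          by (simp only: powr_powr powr_half_sqrt[OF S0])
        then show ?thesis using C(1) by (simp only: powr_mult powr_ge_zero)
      qed
      finally show ?thesis by (simp add: mult.assoc)
    qed
  qed
  then obtain W where W: "W \<in> H10_graph \<Omega>" "\<And>U. U \<in> H10_graph \<Omega> \<Longrightarrow> (\<integral>x. W x \<bullet> U x \<partial>lebesgue_on \<Omega>) = l U"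
    by blast
  define w0 where "w0 x = fst (W x)" for x
  have w0: "w0 \<in> H10_space \<Omega>" unfolding w0_def[abs_def] by (rule gr(1)[OF W(1)])
  have WL: "W \<in> L2_space \<Omega>" using W(1) by (simp add: H10_graph_def)
  have "(\<lambda>x. (w0 x, snd (W x))) \<in> H10_graph \<Omega>" using W(1) by (simp add: w0_def)
  from H10_graphD(2)[OF this] have AE: "AE x in lebesgue_on \<Omega>. with_gradient \<Omega> w0 x = W x"
    by eventually_elim (simp add: w0_def[abs_def] prod_eq_iff)
  have "H1_inner \<Omega> w0 v = (\<integral>x. power_nl p u x * v x \<partial>lebesgue_on \<Omega>)" if v: "v \<in> H10_space \<Omega>" for v
  proof -
    note [measurable] = L2_spaceD(1)[OF WL] L2_spaceD(1)[OF H10_space_L2[OF v]] L2_spaceD(1)[OF H10_space_L2[OF w0]]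
    have "H1_inner \<Omega> w0 v = (\<integral>x. W x \<bullet> with_gradient \<Omega> v x \<partial>lebesgue_on \<Omega>)"
      unfolding H1_inner_eq
      by (rule integral_cong_AE, intro borel_measurable_inner L2_spaceD(1) H10_space_L2 w0 v,
          intro borel_measurable_inner L2_spaceD(1) H10_space_L2 WL v) (use AE in \<open>eventually_elim, simp\<close>)
    then show ?thesis using W(2)[OF H10_space_graph[OF v]] by (simp add: l_def)
  qed
  then have "L2_functional \<Omega> (power_nl p u) = dirichlet_op \<Omega> w0"
    unfolding L2_functional_def dirichlet_op_def by (intro restrict_ext) simp
  then have im: "L2_functional \<Omega> (power_nl p u) \<in> dirichlet_op \<Omega> ` H10_space \<Omega>" using w0 by blast
  show "w \<in> H10_space \<Omega>" unfolding w_def dirichlet_op_inv_def by (rule inv_into_into[OF im])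
  have eq: "dirichlet_op \<Omega> w = L2_functional \<Omega> (power_nl p u)"
    unfolding w_def dirichlet_op_inv_def by (rule f_inv_into_f[OF im])
  show "H1_inner \<Omega> w v = (\<integral>x. power_nl p u x * v x \<partial>lebesgue_on \<Omega>)" if v: "v \<in> H10_space \<Omega>" for v
    using fun_cong[OF eq, of v] v by (simp add: dirichlet_op_def L2_functional_def)
qed

lemma H10_nontrivial_pos:
  assumes u: "u \<in> H10_space \<Omega>" and nt: "nontrivial_on \<Omega> u"
  shows "0 < potential u"
proof (rule ccontr)
  assume "\<not> 0 < potential u"
  then have "potential u = 0" using potential_nonneg[of u] by simp
  then have "AE x in lebesgue_on \<Omega>. \<bar>u x\<bar> powr (p + 1) = 0"
    using integral_nonneg_eq_0_iff_AE[OF H10_powr_integrable[OF u]] by (simp add: potential_def)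
  then have "AE x in lebesgue_on \<Omega>. u x = 0" by eventually_elim simp
  then show False using nt by (simp add: nontrivial_on_def)
qed

lemma potential_pos_imp_H1_sq_pos:
  assumes u: "u \<in> H10_space \<Omega>" and "0 < potential u"
  shows "0 < H1_sq u"
proof -
  obtain C where C: "potential u \<le> C * H1_sq u powr ((p + 1) / 2)"
    using Sobolev_H10 u by blast
  from C assms(2) have "H1_sq u \<noteq> 0" using p by (intro notI) simp
  then show ?thesis by (intro le_neq_trans[OF H1_sq_nonneg]) simp
qed

lemma M_quot_eq: "u \<in> H10_space \<Omega> \<Longrightarrow> M_quot \<Omega> p u = H1_sq u / potential u"
  by (simp add: M_quot_def dirichlet_op_def L2_functional_def H1_inner_self power_nl_self potential_def)

lemma E_one_eq: "E_one \<Omega> p u = 1 / 2 * H1_sq u - 1 / (p + 1) * potential u"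
proof -
  have "Lq_norm \<Omega> (p + 1) u powr (p + 1) = potential u"
    using p potential_nonneg[of u] by (simp add: Lq_norm_def potential_def[symmetric] powr_powr)
  then show ?thesis by (simp only: E_one_def H1_norm_sq)
qed

lemma E_M_eq:
  assumes "u \<in> H10_space \<Omega>" "0 < potential u"
  shows "E_M \<Omega> p u = (if H1_sq u \<le> potential u then ereal ((1 / 2 - 1 / (p + 1)) * H1_sq u) else \<infinity>)"
proof -
  have "Lq_norm \<Omega> (p + 1) u powr (p + 1) = potential u"
    using p potential_nonneg[of u] by (simp add: Lq_norm_def potential_def[symmetric] powr_powr)
  moreover have "H1_sq u / potential u \<le> 1 \<longleftrightarrow> H1_sq u \<le> potential u" using assms(2) by simp
  moreover have "1 / 2 * H1_sq u - 1 / (p + 1) * (H1_sq u / potential u) * potential u = (1 / 2 - 1 / (p + 1)) * H1_sq u"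
    using assms(2) by (simp add: left_diff_distrib)
  ultimately show ?thesis
    unfolding E_M_def M_quot_eq[OF assms(1)] H1_norm_sq by (simp only:)
qed

lemma AE_cong_H1_sq_potential:
  assumes u: "u \<in> H10_space \<Omega>" and eq: "AE x in lebesgue_on \<Omega>. v x = u x"
  shows "H1_sq v = H1_sq u" "potential v = potential u"
proof -
  note v = H10_space_AE_cong[OF u eq]
  show "H1_sq v = H1_sq u" by (rule sq_norm_AE_cong[OF H10_space_L2[OF v(1)] H10_space_L2[OF u] v(2)])
  note [measurable] = H10_measurable[OF u] H10_measurable[OF v(1)]
  show "potential v = potential u" unfolding potential_def
    by (rule integral_cong_AE) (measurable, use eq in \<open>eventually_elim, simp\<close>)
qed

text \<open>The power \<open>p + 1\<close> of the quotient of squared norms \<open>\<parallel>u\<parallel>\<^sup>2 / \<parallel>u\<parallel>\<^sub>q\<^sup>2\<close> for the embedding of \<open>H\<^sup>1\<^sub>0\<close>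
  into \<open>L\<^sup>q\<close>, \<open>q = p + 1\<close>.\<close>

definition rayleigh :: "('a \<Rightarrow> real) \<Rightarrow> real" where
  "rayleigh u = H1_sq u powr (p + 1) / (potential u)\<^sup>2"

lemma rayleigh_scale:
  assumes w: "w \<in> H10_space \<Omega>" and c: "0 < c"
  shows "(\<lambda>x. c * w x) \<in> H10_space \<Omega>" "potential (\<lambda>x. c * w x) = c powr (p + 1) * potential w"
    "rayleigh (\<lambda>x. c * w x) = rayleigh w"
proof -
  have "(\<lambda>x. w x + (c - 1) * w x) = (\<lambda>x. c * w x)" by (auto simp: algebra_simps)
  moreover have "with_gradient \<Omega> w x + (c - 1) *\<^sub>R with_gradient \<Omega> w x = c *\<^sub>R with_gradient \<Omega> w x" for x
    by (simp add: algebra_simps)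
  ultimately have cw: "(\<lambda>x. c * w x) \<in> H10_space \<Omega>"
    "AE x in lebesgue_on \<Omega>. with_gradient \<Omega> (\<lambda>x. c * w x) x = c *\<^sub>R with_gradient \<Omega> w x"
    using H10_space_lincomb[OF w w, of "c - 1"] by simp_all
  show "(\<lambda>x. c * w x) \<in> H10_space \<Omega>" by (rule cw(1))
  show P: "potential (\<lambda>x. c * w x) = c powr (p + 1) * potential w"
    using c by (simp add: potential_def abs_mult powr_mult)
  have "H1_sq (\<lambda>x. c * w x) = sq_norm \<Omega> (\<lambda>x. c *\<^sub>R with_gradient \<Omega> w x)"
    by (rule sq_norm_AE_cong[OF H10_space_L2[OF cw(1)] _ cw(2)])
      (rule L2_space_AE_cong[OF sets_\<Omega> H10_space_L2[OF cw(1)] cw(2)])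
  also have "\<dots> = c\<^sup>2 * H1_sq w" by (simp only: norm_scaleR power_mult_distrib power2_abs integral_mult_right_zero)
  finally have "H1_sq (\<lambda>x. c * w x) = c\<^sup>2 * H1_sq w" .
  moreover have "(c\<^sup>2 * H1_sq w) powr (p + 1) = (c powr (p + 1))\<^sup>2 * H1_sq w powr (p + 1)"
    using c H1_sq_nonneg[of w] by (simp add: powr_mult power2_eq_square)
  ultimately show "rayleigh (\<lambda>x. c * w x) = rayleigh w"
    using c by (simp only: rayleigh_def P power_mult_distrib) simp
qed

text \<open>With \<open>N, P\<close> for \<open>u\<close> and \<open>W, Q\<close> for \<open>w\<close>, the weak equation for \<open>w\<close> gives \<open>P\<^sup>2 \<le> W N\<close> when tested
  with \<open>u\<close>, and \<open>W^(p+1) \<le> P^p Q\<close> when tested with \<open>w\<close>. Eliminating the powers of \<open>P\<close> leaves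
  \<open>W^(p+1) P\<^sup>2 \<le> N^(p+1) Q\<^sup>2\<close>.\<close>

lemma rayleigh_decreasing:
  assumes u: "u \<in> H10_space \<Omega>" "0 < potential u"
  defines "w \<equiv> dirichlet_op_inv \<Omega> (L2_functional \<Omega> (power_nl p u))"
  shows "w \<in> H10_space \<Omega>" "0 < potential w" "rayleigh w \<le> rayleigh u"
proof -
  note sol = dirichlet_op_inv_power_nl[OF u(1), folded w_def]
  show w: "w \<in> H10_space \<Omega>" by (rule sol(1))
  have PWN: "potential u \<le> sqrt (H1_sq w) * sqrt (H1_sq u)"
  proof -
    have "potential u = H1_inner \<Omega> w u" unfolding sol(2)[OF u(1)] by (simp add: power_nl_self potential_def)
    also have "\<dots> \<le> \<bar>H1_inner \<Omega> w u\<bar>" by simp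
    also have "\<dots> \<le> sqrt (H1_sq w) * sqrt (H1_sq u)"
      unfolding H1_inner_eq by (rule L2_Cauchy_Schwarz[OF H10_space_L2[OF w] H10_space_L2[OF u(1)]])
    finally show ?thesis .
  qed
  have WPQ: "H1_sq w \<le> potential u powr (p / (p + 1)) * potential w powr (1 / (p + 1))"
  proof -
    have "H1_sq w = (\<integral>x. power_nl p u x * w x \<partial>lebesgue_on \<Omega>)" unfolding H1_inner_self[symmetric] by (rule sol(2)[OF w])
    then show ?thesis using power_nl_pairing(2)[OF u(1) w] by linarith
  qed
  define N P W Q where "N = H1_sq u" and "P = potential u" and "W = H1_sq w" and "Q = potential w"
  have P: "0 < P" and N: "0 \<le> N" and W: "0 \<le> W" and Q: "0 \<le> Q"
    using u(2) H1_sq_nonneg potential_nonneg by (auto simp: N_def P_def W_def Q_def)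
  have "W \<noteq> 0" using PWN P by (auto simp: W_def P_def)
  with W have W: "0 < W" by simp
  have "Q \<noteq> 0" using WPQ W p by (auto simp: W_def Q_def)
  with Q have Q: "0 < Q" by simp
  then show "0 < potential w" by (simp add: Q_def)
  define X where "X = W powr (p + 1)"
  have X: "0 < X" using W by (simp add: X_def)
  have XPQ: "X \<le> P powr p * Q"
  proof -
    have "X \<le> (P powr (p / (p + 1)) * Q powr (1 / (p + 1))) powr (p + 1)"
      unfolding X_def using WPQ W p by (intro powr_mono2) (auto simp: W_def Q_def P_def)
    also have "\<dots> = P powr p * Q" using p P Q by (simp add: powr_mult powr_powr)
    finally show ?thesis .
  qed
  have "P\<^sup>2 \<le> W * N"
    using power_mono[OF PWN, of 2] P W N by (simp add: P_def W_def N_def power_mult_distrib H1_sq_nonneg)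
  then have "(P\<^sup>2) powr (p + 1) \<le> (W * N) powr (p + 1)" using p by (intro powr_mono2) auto
  then have "(P powr p)\<^sup>2 * P\<^sup>2 \<le> X * N powr (p + 1)"
    using P W N by (simp add: X_def powr_mult powr_add power2_eq_square mult_ac)
  (* Multiply by the square of the other inequality; then P powr p and one X cancel. *)
  then have "((P powr p)\<^sup>2 * P\<^sup>2) * X\<^sup>2 \<le> (X * N powr (p + 1)) * (P powr p * Q)\<^sup>2"
    by (rule mult_mono[OF _ power_mono[OF XPQ]]) (use X in auto)
  then have "((P powr p)\<^sup>2 * X) * (X * P\<^sup>2) \<le> ((P powr p)\<^sup>2 * X) * (N powr (p + 1) * Q\<^sup>2)"
    by (simp add: power2_eq_square mult_ac)
  then have "X * P\<^sup>2 \<le> N powr (p + 1) * Q\<^sup>2"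
    using P X by (subst (asm) mult_le_cancel_left_pos) auto
  then show "rayleigh w \<le> rayleigh u"
    using P Q by (simp add: rayleigh_def X_def W_def P_def N_def Q_def divide_simps)
qed

text \<open>Among the multiples of \<open>u\<close>, the energy is largest on the Nehari manifold, where its value is the
  right-hand side. Analytically this is the weighted inequality of arithmetic and geometric means
  for \<open>N = J^((p-1)/(p+1)) P^(2/(p+1))\<close>.\<close>

lemma E_one_le_rayleigh:
  assumes "0 < potential u"
  shows "E_one \<Omega> p u \<le> (1 / 2 - 1 / (p + 1)) * rayleigh u powr (1 / (p - 1))"
proof -
  define N P J where "N = H1_sq u" and "P = potential u" and "J = rayleigh u powr (1 / (p - 1))"
  have P: "0 < P" and N: "0 \<le> N" using assms H1_sq_nonneg by (auto simp: N_def P_def)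
  have "J powr ((p - 1) / (p + 1)) = (N powr (p + 1) / P\<^sup>2) powr (1 / (p + 1))"
    using p by (simp add: J_def rayleigh_def powr_powr N_def P_def)
  also have "\<dots> = N / P powr (2 / (p + 1))"
    using p P N by (simp add: powr_divide powr_powr flip: powr_numeral)
  finally have "N = J powr ((p - 1) / (p + 1)) * P powr (2 / (p + 1))" using P by simp
  also have "\<dots> \<le> (p - 1) / (p + 1) * J + 2 / (p + 1) * P"
    by (rule powr_weighted_am_gm) (use p P in \<open>auto simp: J_def simp flip: add_divide_distrib\<close>)
  also have "\<dots> = 2 * ((1 / 2 - 1 / (p + 1)) * J + 1 / (p + 1) * P)"
  proof -
    have "(p - 1) / (p + 1) = 2 * (1 / 2 - 1 / (p + 1))" using p by (simp add: field_simps)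
    then show ?thesis by (simp only: distrib_left mult.assoc)
  qed
  finally have "N \<le> 2 * ((1 / 2 - 1 / (p + 1)) * J + 1 / (p + 1) * P)" .
  moreover have "1 / 2 * N - y \<le> x" if "N \<le> 2 * (x + y)" for x y using that by simp
  ultimately show ?thesis
    unfolding E_one_eq N_def[symmetric] P_def[symmetric] J_def[symmetric] by blast
qed

text \<open>If \<open>N \<le> P\<close>, the function has to be shrunk in order to reach the Nehari manifold.\<close>

lemma rayleigh_le_H1_sq:
  assumes u: "u \<in> H10_space \<Omega>" "0 < potential u" and M: "H1_sq u \<le> potential u"
  shows "rayleigh u powr (1 / (p - 1)) \<le> H1_sq u"
proof -
  define N where "N = H1_sq u"
  have N: "0 < N" using potential_pos_imp_H1_sq_pos[OF u] by (simp add: N_def)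
  have "rayleigh u \<le> N powr (p + 1) / N\<^sup>2"
    using M N unfolding rayleigh_def N_def[symmetric] by (intro divide_left_mono power_mono mult_pos_pos) auto
  also have "\<dots> = N powr (p - 1)"
  proof -
    have "N powr (p + 1) = N powr (p - 1) * N powr 2"
      unfolding powr_add[symmetric] by (simp add: add.commute)
    also have "N powr 2 = N\<^sup>2" using N by (simp add: powr_numeral)
    finally show ?thesis using N by simp
  qed
  finally have "rayleigh u powr (1 / (p - 1)) \<le> (N powr (p - 1)) powr (1 / (p - 1))"
    using p by (intro powr_mono2) (auto simp: rayleigh_def)
  also have "\<dots> = N" using N p by (simp add: powr_powr)
  finally show ?thesis by (simp add: N_def)
qed

text \<open>The scalar factor in the iteration map is positive and does not change the Rayleigh quotient.\<close>

lemma iterates_rayleigh: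
  assumes u0: "u0 \<in> H10_space \<Omega>" "nontrivial_on \<Omega> u0"
    and init: "AE x in lebesgue_on \<Omega>. u 0 x = u0 x"
    and step: "\<And>n. AE x in lebesgue_on \<Omega>. u (Suc n) x = A_map \<Omega> p \<gamma> (u n) x"
  shows "u n \<in> H10_space \<Omega> \<and> 0 < potential (u n) \<and> rayleigh (u n) \<le> rayleigh u0"
proof (induction n)
  case 0
  have "0 < potential u0" by (rule H10_nontrivial_pos[OF u0])
  then show ?case
    using H10_space_AE_cong(1)[OF u0(1) init] AE_cong_H1_sq_potential[OF u0(1) init] by (simp add: rayleigh_def)
next
  case (Suc n)
  then have un: "u n \<in> H10_space \<Omega>" "0 < potential (u n)" "rayleigh (u n) \<le> rayleigh u0" by auto
  define w where "w = dirichlet_op_inv \<Omega> (L2_functional \<Omega> (power_nl p (u n)))"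
  define c where "c = M_quot \<Omega> p (u n) powr \<gamma>"
  have "0 < M_quot \<Omega> p (u n)"
    using potential_pos_imp_H1_sq_pos[OF un(1,2)] un(2) by (simp add: M_quot_eq[OF un(1)])
  then have c: "0 < c" by (simp add: c_def)
  note w = rayleigh_decreasing[OF un(1,2), folded w_def]
  note cw = rayleigh_scale[OF w(1) c]
  have eq: "AE x in lebesgue_on \<Omega>. u (Suc n) x = c * w x"
    using step[of n] by (simp add: A_map_def c_def w_def)
  show ?case
    using H10_space_AE_cong(1)[OF cw(1) eq] AE_cong_H1_sq_potential[OF cw(1) eq] cw(2,3) w(2,3) c un(3)
    by (simp add: rayleigh_def)
qed

text \<open>The energy decreases in \<open>P\<close>, so upper semicontinuity of \<open>P\<close> suffices. The convexity bound, with parameter \<open>l < 1\<close> fixed,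
  and the Sobolev inequality for \<open>u n - \<phi>\<close> give a limes superior of at most \<open>l^(-p) P(\<phi>)\<close>; then
  \<open>l\<close> tends to 1.\<close>

lemma E_one_le_of_H1_limit:
  assumes u: "\<And>n::nat. u n \<in> H10_space \<Omega>" and \<phi>: "\<phi> \<in> H10_space \<Omega>"
    and lim: "(\<lambda>n. H1_norm \<Omega> (\<lambda>x. u n x - \<phi> x)) \<longlonglongrightarrow> 0" and le: "\<And>n. E_one \<Omega> p (u n) \<le> B"
  shows "E_one \<Omega> p \<phi> \<le> B"
proof -
  obtain C where C: "0 \<le> C" "\<And>u. u \<in> H10_space \<Omega> \<Longrightarrow> potential u \<le> C * H1_sq u powr ((p + 1) / 2)"
    using Sobolev_H10 by blast
  have d: "(\<lambda>x. u n x - \<phi> x) \<in> H10_space \<Omega>"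
    "AE x in lebesgue_on \<Omega>. with_gradient \<Omega> (\<lambda>x. u n x - \<phi> x) x = with_gradient \<Omega> (u n) x - with_gradient \<Omega> \<phi> x" for n
    using H10_space_lincomb[OF u[of n] \<phi>, of "-1"] by simp_all
  have lim2: "(\<lambda>n. H1_sq (\<lambda>x. u n x - \<phi> x)) \<longlonglongrightarrow> 0"
    using tendsto_power[OF lim, of 2] by (simp only: H1_norm_sq zero_power2)
  have "H1_sq (\<lambda>x. u n x - \<phi> x) = sq_norm \<Omega> (\<lambda>x. with_gradient \<Omega> (u n) x - with_gradient \<Omega> \<phi> x)" for n
    by (rule sq_norm_AE_cong[OF H10_space_L2[OF d(1)] L2_space_diff[OF H10_space_L2[OF u] H10_space_L2[OF \<phi>]] d(2)])
  then have "(\<lambda>n. sq_norm \<Omega> (\<lambda>x. with_gradient \<Omega> (u n) x - with_gradient \<Omega> \<phi> x)) \<longlonglongrightarrow> 0"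
    using lim2 by (simp only:)
  from L2_tendsto_sq_norm[OF H10_space_L2[OF u] H10_space_L2[OF \<phi>] this]
  have limN: "(\<lambda>n. H1_sq (u n)) \<longlonglongrightarrow> H1_sq \<phi>" .
  have PC: "(\<lambda>n. C * H1_sq (\<lambda>x. u n x - \<phi> x) powr ((p + 1) / 2)) \<longlonglongrightarrow> C * 0 powr ((p + 1) / 2)"
    using p by (intro tendsto_mult tendsto_const tendsto_powr' lim2) (auto simp: H1_sq_nonneg intro!: always_eventually)
  have key: "1 / 2 * H1_sq \<phi> - B \<le> 1 / (p + 1) * (l powr (- p) * potential \<phi>)" if l: "0 < l" "l < 1" for l
  proof -
    (* The upper bound for P(u n) / (p + 1) that the convexity and Sobolev inequalities give. *)
    define a where "a n = 1 / (p + 1) * (l powr (- p) * potential \<phi> + (1 - l) powr (- p) * (C * H1_sq (\<lambda>x. u n x - \<phi> x) powr ((p + 1) / 2)))" for n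
    have "1 / 2 * H1_sq (u n) - B \<le> a n" for n
    proof -
      have "potential (u n) \<le> (\<integral>x. l powr (- p) * \<bar>\<phi> x\<bar> powr (p + 1) + (1 - l) powr (- p) * \<bar>u n x - \<phi> x\<bar> powr (p + 1) \<partial>lebesgue_on \<Omega>)"
        unfolding potential_def
      proof (rule integral_mono)
        show "integrable (lebesgue_on \<Omega>) (\<lambda>x. \<bar>u n x\<bar> powr (p + 1))" by (rule H10_powr_integrable[OF u])
        show "integrable (lebesgue_on \<Omega>) (\<lambda>x. l powr (- p) * \<bar>\<phi> x\<bar> powr (p + 1) + (1 - l) powr (- p) * \<bar>u n x - \<phi> x\<bar> powr (p + 1))"
          using H10_powr_integrable[OF \<phi>] H10_powr_integrable[OF d(1)[of n]] by auto
        show "\<bar>u n x\<bar> powr (p + 1) \<le> l powr (- p) * \<bar>\<phi> x\<bar> powr (p + 1) + (1 - l) powr (- p) * \<bar>u n x - \<phi> x\<bar> powr (p + 1)" for x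
          using powr_add_convex_bound[of "p + 1" l "\<phi> x" "u n x - \<phi> x"] p l by simp
      qed
      also have "\<dots> = l powr (- p) * potential \<phi> + (1 - l) powr (- p) * potential (\<lambda>x. u n x - \<phi> x)"
        using H10_powr_integrable[OF \<phi>] H10_powr_integrable[OF d(1)[of n]] by (simp add: potential_def)
      also have "\<dots> \<le> l powr (- p) * potential \<phi> + (1 - l) powr (- p) * (C * H1_sq (\<lambda>x. u n x - \<phi> x) powr ((p + 1) / 2))"
        using C(2)[OF d(1)[of n]] by (intro add_left_mono mult_left_mono) auto
      finally have "1 / (p + 1) * potential (u n) \<le> a n" unfolding a_def using p by (intro mult_left_mono) auto
      then show ?thesis using le[of n] unfolding E_one_eq by linarith
    qed
    moreover have "a \<longlonglongrightarrow> 1 / (p + 1) * (l powr (- p) * potential \<phi> + (1 - l) powr (- p) * (C * 0 powr ((p + 1) / 2)))"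
      unfolding a_def by (intro tendsto_intros PC)
    ultimately have "1 / 2 * H1_sq \<phi> - B \<le> 1 / (p + 1) * (l powr (- p) * potential \<phi> + (1 - l) powr (- p) * (C * 0 powr ((p + 1) / 2)))"
      by (intro LIMSEQ_le[OF tendsto_diff[OF tendsto_mult[OF tendsto_const limN] tendsto_const]]) auto
    then show ?thesis by simp
  qed
  have "((\<lambda>l. 1 / (p + 1) * (l powr (- p) * potential \<phi>)) \<longlongrightarrow> 1 / (p + 1) * (1 powr (- p) * potential \<phi>)) (at_left 1)"
    by (intro tendsto_intros) auto
  moreover have "\<forall>\<^sub>F l in at_left 1. 1 / 2 * H1_sq \<phi> - B \<le> 1 / (p + 1) * (l powr (- p) * potential \<phi>)"
    by (rule eventually_at_leftI[of 0], rule key) auto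
  ultimately have "1 / 2 * H1_sq \<phi> - B \<le> 1 / (p + 1) * (1 powr (- p) * potential \<phi>)"
    by (intro tendsto_lowerbound) auto
  then show ?thesis unfolding E_one_eq by simp
qed

end

theorem theorem4p7:
  fixes \<Omega> :: "'a::euclidean_space set"
    and p \<gamma> :: real
    and u0 :: "'a \<Rightarrow> real"
    and u :: "nat \<Rightarrow> 'a \<Rightarrow> real"
  assumes "open \<Omega>" and "bounded \<Omega>" and "convex \<Omega>" and "\<Omega> \<noteq> {}"
    and "1 < p"
    and "DIM('a) \<ge> 3 \<Longrightarrow> p < (real DIM('a) + 2) / (real DIM('a) - 2)"
    and "\<gamma> = p / (p - 1)"
    and "u0 \<in> H10_space \<Omega>" and "nontrivial_on \<Omega> u0"
    and "AE x in lebesgue_on \<Omega>. u 0 x = u0 x"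
    and "\<And>n. AE x in lebesgue_on \<Omega>. u (Suc n) x = A_map \<Omega> p \<gamma> (u n) x"
  shows "liminf (\<lambda>n. ereal (E_one \<Omega> p (u n))) \<le> E_M \<Omega> p u0 \<and>
    (\<forall>\<phi> r. weak_solution \<Omega> p \<phi> \<and> nontrivial_on \<Omega> \<phi> \<and> strict_mono (r :: nat \<Rightarrow> nat) \<and>
           (\<lambda>n. H1_norm \<Omega> (\<lambda>x. u (r n) x - \<phi> x)) \<longlonglongrightarrow> 0
       \<longrightarrow> ereal (E_one \<Omega> p \<phi>) \<le> E_M \<Omega> p u0)"
proof -
  have "(real DIM('a) - 2) * (p + 1) < 2 * real DIM('a)"
  proof (cases "DIM('a) \<ge> 3")
    case True
    then have "p < (real DIM('a) + 2) / (real DIM('a) - 2)" by (rule assms(6))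
    then show ?thesis using True by (simp add: field_simps)
  next
    case False
    then have "(real DIM('a) - 2) * (p + 1) \<le> 0" using \<open>1 < p\<close> by (intro mult_nonpos_nonneg) auto
    then show ?thesis using DIM_positive[where 'a='a] by (smt (verit) of_nat_0_less_iff)
  qed
  then interpret subcritical \<Omega> p
    using assms by unfold_locales auto
  note it = iterates_rayleigh[OF assms(8-11)]
  show ?thesis
  proof (cases "H1_sq u0 \<le> potential u0")
    case False
    then have "E_M \<Omega> p u0 = \<infinity>" using E_M_eq[OF assms(8) H10_nontrivial_pos[OF assms(8,9)]] by simp
    then show ?thesis by simp
  next
    case True
    define B where "B = (1 / 2 - 1 / (p + 1)) * H1_sq u0"
    have EM: "E_M \<Omega> p u0 = ereal B"
      using True E_M_eq[OF assms(8) H10_nontrivial_pos[OF assms(8,9)]] by (simp add: B_def)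
    have bound: "E_one \<Omega> p (u n) \<le> B" for n
    proof -
      have c: "0 \<le> 1 / 2 - 1 / (p + 1)" using \<open>1 < p\<close> by (simp add: field_simps)
      have "E_one \<Omega> p (u n) \<le> (1 / 2 - 1 / (p + 1)) * rayleigh (u n) powr (1 / (p - 1))"
        using it[of n] by (intro E_one_le_rayleigh) auto
      also have "\<dots> \<le> (1 / 2 - 1 / (p + 1)) * rayleigh u0 powr (1 / (p - 1))"
        using it[of n] \<open>1 < p\<close> by (intro mult_left_mono[OF _ c] powr_mono2) (auto simp: rayleigh_def)
      also have "\<dots> \<le> B"
        unfolding B_def
        by (intro mult_left_mono[OF _ c] rayleigh_le_H1_sq[OF assms(8) H10_nontrivial_pos[OF assms(8,9)] True])
      finally show ?thesis .
    qed
    have "liminf (\<lambda>n. ereal (E_one \<Omega> p (u n))) \<le> liminf (\<lambda>n::nat. ereal B)"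
      by (rule Liminf_mono) (simp add: bound)
    then have "liminf (\<lambda>n. ereal (E_one \<Omega> p (u n))) \<le> ereal B" by (simp add: Liminf_const)
    moreover have "E_one \<Omega> p \<phi> \<le> B" if "weak_solution \<Omega> p \<phi>"
      "(\<lambda>n. H1_norm \<Omega> (\<lambda>x. u (r n) x - \<phi> x)) \<longlonglongrightarrow> 0" for \<phi> and r :: "nat \<Rightarrow> nat"
      by (rule E_one_le_of_H1_limit[OF _ _ that(2) bound]) (use it that(1) in \<open>auto simp: weak_solution_def\<close>)
    ultimately show ?thesis unfolding EM by auto
  qed
qed

end
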